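(* The Hilbert transform $H$ on $\mathbb{T}$ is strong $(p,p)$ for every $1<p<\infty$ (that is, for each such $p$ there is a constant $C_p$ with $\|Hf\|_{L^p(\mathbb{T})}\le C_p\|f\|_{L^p(\mathbb{T})}$ for all $f\in L^p\cap L^2(\mathbb{T})$, so that $H$ determines a unique bounded linear operator $H:L^p(\mathbb{T})\to L^p(\mathbb{T})$), and $$\widehat{(Hf)}(n)=-i\,\operatorname{sign}(n)\,\hat f(n)\qquad\text{for all } f\in L^p(\mathbb{T}),\ n\in\mathbb{Z}.$$
   Context: $\mathbb{T}=\mathbb{R}/2\pi\mathbb{Z}$; functions are complex-valued and $2\pi$-periodic; $\|f\|_{L^p(\mathbb{T})}=\big(\frac{1}{2\pi}\int_{\mathbb{T}}|f|^p\,dt\big)^{1/p}$; $\hat f(n)=\frac{1}{2\pi}\int_{\mathbb{T}}f(t)e^{-int}\,dt$. The Hilbert transform is initially defined on $L^2(\mathbb{T})$ by $Hf=\sum_{n\in\mathbb{Z}}\big(-i\,\operatorname{sign}(n)\hat f(n)\big)e^{int}$ (convergence in $L^2(\mathbb{T})$), where $\operatorname{sign}(0)=0$. *)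

theory Defs
  imports "HOL-Analysis.Analysis"
begin

text \<open>
  Functions on the circle are \<open>2 * pi\<close>-periodic functions on the real line. Elements of
  \<open>Lp p\<close> are representatives, so identities in \<open>L\<^sup>p\<close> are stated almost everywhere.
\<close>

definition Lp :: "real \<Rightarrow> (real \<Rightarrow> complex) set" where
  "Lp p = {f. periodic_fun_simple f (2 * pi) \<and> f \<in> borel_measurable lebesgue \<and>
              set_integrable lebesgue {0..2 * pi} (\<lambda>t. norm (f t) powr p)}"

text \<open>Only meaningful on \<open>Lp p\<close>: for a non-integrable integrand the Bochner integral is 0.\<close>

definition Lp_norm :: "real \<Rightarrow> (real \<Rightarrow> complex) \<Rightarrow> real" where
  "Lp_norm p f = (1 / (2 * pi) * (LINT t:{0..2 * pi}|lebesgue. norm (f t) powr p)) powr (1 / p)"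

definition ae_eq :: "(real \<Rightarrow> complex) \<Rightarrow> (real \<Rightarrow> complex) \<Rightarrow> bool" (infix "=\<^sub>a\<^sub>e" 50) where
  "f =\<^sub>a\<^sub>e g \<longleftrightarrow> (AE t in lebesgue. f t = g t)"

definition fourier_coeff :: "(real \<Rightarrow> complex) \<Rightarrow> int \<Rightarrow> complex" where
  "fourier_coeff f n =
     1 / (2 * pi) * (LINT t:{0..2 * pi}|lebesgue. f t * cis (- (of_int n * t)))"

text \<open>
  Unconditional convergence of a series indexed by the integers, as in \<^const>\<open>has_sum\<close>, but with
  respect to the \<open>L\<^sup>2\<close> norm.
\<close>

definition has_sum_L2 :: "(int \<Rightarrow> real \<Rightarrow> complex) \<Rightarrow> (real \<Rightarrow> complex) \<Rightarrow> bool" where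
  "has_sum_L2 u g \<longleftrightarrow> (\<forall>n. u n \<in> Lp 2) \<and> g \<in> Lp 2 \<and>
     ((\<lambda>F. Lp_norm 2 (\<lambda>t. (\<Sum>n\<in>F. u n t) - g t)) \<longlongrightarrow> 0) (finite_subsets_at_top UNIV)"

text \<open>
  For \<open>f \<in> Lp 2\<close> the sum exists by the Riesz--Fischer theorem and is unique up to a null set;
  the choice operator only selects a representative.
\<close>

definition hilbert_L2 :: "(real \<Rightarrow> complex) \<Rightarrow> real \<Rightarrow> complex" where
  "hilbert_L2 f =
     (SOME g. has_sum_L2 (\<lambda>n t. - \<i> * of_int (sgn n) * fourier_coeff f n * cis (of_int n * t)) g)"

text \<open>Strong type \<open>(p, p)\<close> for an operator initially defined on a class \<open>D\<close> of functions.\<close>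

definition strong_type :: "real \<Rightarrow> (real \<Rightarrow> complex) set \<Rightarrow>
    ((real \<Rightarrow> complex) \<Rightarrow> real \<Rightarrow> complex) \<Rightarrow> bool" where
  "strong_type p D T \<longleftrightarrow>
     (\<exists>C. \<forall>f \<in> Lp p \<inter> D. T f \<in> Lp p \<and> Lp_norm p (T f) \<le> C * Lp_norm p f)"

text \<open>
  Bounded linear operators on \<open>L\<^sup>p\<close>, given on representatives; the second conjunct says that the
  operator descends to classes modulo equality almost everywhere.
\<close>

definition bounded_linear_Lp :: "real \<Rightarrow> ((real \<Rightarrow> complex) \<Rightarrow> real \<Rightarrow> complex) \<Rightarrow> bool" where
  "bounded_linear_Lp p T \<longleftrightarrow>
     (\<forall>f \<in> Lp p. T f \<in> Lp p) \<and>
     (\<forall>f \<in> Lp p. \<forall>g \<in> Lp p. f =\<^sub>a\<^sub>e g \<longrightarrow> T f =\<^sub>a\<^sub>e T g) \<and>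
     (\<forall>f \<in> Lp p. \<forall>g \<in> Lp p. T (\<lambda>t. f t + g t) =\<^sub>a\<^sub>e (\<lambda>t. T f t + T g t)) \<and>
     (\<forall>f \<in> Lp p. \<forall>c. T (\<lambda>t. c * f t) =\<^sub>a\<^sub>e (\<lambda>t. c * T f t)) \<and>
     (\<exists>C. \<forall>f \<in> Lp p. Lp_norm p (T f) \<le> C * Lp_norm p f)"

definition extends_hilbert :: "real \<Rightarrow> ((real \<Rightarrow> complex) \<Rightarrow> real \<Rightarrow> complex) \<Rightarrow> bool" where
  "extends_hilbert p T \<longleftrightarrow>
     bounded_linear_Lp p T \<and> (\<forall>f \<in> Lp p \<inter> Lp 2. T f =\<^sub>a\<^sub>e hilbert_L2 f)"

end

theory Submission
  imports Defs "HOL-Complex_Analysis.Complex_Analysis"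
begin

text \<open>
  This is M. Riesz's theorem on conjugate functions. The heart of it is an inequality for an analytic
  function \<open>F\<close> on the disc with positive real part and \<open>F 0\<close> real, when \<open>1 < p \<le> 2\<close>. In the right half
  plane \<open>\<bar>Im z\<bar> powr p \<le> A * Re z powr p - B * Re (z powr p)\<close> with constants depending only on \<open>p\<close>
  (\<open>sector_inequality\<close>). Since \<open>F powr p\<close> is again analytic, its mean over the circle is
  \<open>F 0 powr p \<ge> 0\<close>, so the last term disappears on integration and the imaginary part of \<open>F\<close> on the circle
  is bounded in \<open>L\<^sup>p\<close> by the real part (\<open>conjugate_inequality_positive\<close>).

  For \<open>f \<ge> \<delta> > 0\<close> in \<open>L\<^sup>2\<close> this is applied to polynomials \<open>F\<close> whose real part on the circle is a Fejer mean
  of \<open>f\<close>. Fejer means preserve the lower bound and contract the \<open>L\<^sup>p\<close> norm (\<open>fejer_mean_ge\<close>,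
  \<open>pmass_fejer_mean_le\<close>), while the imaginary part of \<open>F\<close> is the Cesaro mean of the conjugate series and
  converges in \<open>L\<^sup>2\<close> to the Hilbert transform of \<open>f\<close> (\<open>pmass_2_Cesaro\<close>). Passing to the limit with
  Fatou's lemma and splitting a general function into four nonnegative parts gives the strong type
  bound for \<open>1 < p \<le> 2\<close> (\<open>hilbert_strong_type_le_2\<close>).

  The multiplier is odd, so the Hilbert transform is antisymmetric for the bilinear pairing
  (\<open>hilbert_L2_antisymmetric\<close>); by duality the bound for the conjugate exponent \<open>q < 2\<close> yields
  the one for \<open>p > 2\<close> (\<open>hilbert_strong_type_gt_2\<close>).

  Bounded functions are dense in \<open>L\<^sup>p\<close> and lie in \<open>L\<^sup>2\<close>, and \<open>L\<^sup>p\<close> is complete (\<open>Lp_complete\<close>), so the operator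
  extends uniquely; Fourier coefficients are continuous on \<open>L\<^sup>p\<close>, so the multiplier formula extends with it.
  The same completeness statement for \<open>p = 2\<close>, with Bessel's inequality, shows that the defining series of
  the Hilbert transform on \<open>L\<^sup>2\<close> converges (\<open>Riesz_Fischer\<close>).
\<close>

section \<open>The p-th power functional on the circle\<close>

abbreviation circle :: "real measure" where "circle \<equiv> lebesgue_on {0..2 * pi}"

definition periodic_measurable :: "(real \<Rightarrow> complex) set" where
  "periodic_measurable = {f. periodic_fun_simple f (2 * pi) \<and> f \<in> borel_measurable lebesgue}"

text \<open>
The \<open>p\<close>-th power of the norm, as an extended real and without the root. Bounds, limits and Fatou's
lemma can then be stated before integrability is known, and an operator bound
\<open>pmass p (T f) \<le> C * pmass p f\<close> is the \<open>p\<close>-th power of a norm bound.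
\<close>

definition pmass :: "real \<Rightarrow> (real \<Rightarrow> complex) \<Rightarrow> ennreal" where
  "pmass p f = (\<integral>\<^sup>+ t. ennreal (norm (f t) powr p) \<partial>circle)"

lemma emeasure_circle_space: "emeasure circle {0..2 * pi} = ennreal (2 * pi)"
  by (simp add: emeasure_restrict_space)

lemma nn_integral_circle_const: "(\<integral>\<^sup>+ t. c \<partial>circle) = c * ennreal (2 * pi)"
  by (simp add: emeasure_circle_space)

lemma measurable_circle: "f \<in> borel_measurable lebesgue \<Longrightarrow> f \<in> borel_measurable circle"
  by (rule measurable_restrict_space1)

lemma periodic_measurableI:
  "(\<And>t. f (t + 2 * pi) = f t) \<Longrightarrow> f \<in> borel_measurable lebesgue \<Longrightarrow> f \<in> periodic_measurable"
  by (simp add: periodic_measurable_def periodic_fun_simple_def)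

lemma periodic_measurable_period: "f \<in> periodic_measurable \<Longrightarrow> f (t + 2 * pi) = f t"
  by (simp add: periodic_measurable_def periodic_fun_simple_def)

lemma periodic_measurable_lebesgue: "f \<in> periodic_measurable \<Longrightarrow> f \<in> borel_measurable lebesgue"
  by (simp add: periodic_measurable_def)

lemma periodic_measurable_circle:
  "f \<in> periodic_measurable \<Longrightarrow> f \<in> borel_measurable circle"
  by (simp add: periodic_measurable_lebesgue measurable_circle)

lemma norm_powr_measurable_circle:
  assumes "f \<in> periodic_measurable"
  shows "(\<lambda>t. norm (f t) powr p) \<in> borel_measurable circle"
proof -
  have [measurable]: "f \<in> borel_measurable circle" using assms by (rule periodic_measurable_circle)
  show ?thesis by measurable
qed

lemma ennreal_norm_powr_measurable_circle:
  "f \<in> periodic_measurable \<Longrightarrow> (\<lambda>t. ennreal (norm (f t) powr p)) \<in> borel_measurable circle"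
  using measurable_compose[OF norm_powr_measurable_circle measurable_ennreal] .

lemma periodic_measurable_comp:
  assumes "f \<in> periodic_measurable" "\<phi> \<in> borel_measurable borel"
  shows "(\<lambda>t. \<phi> (f t)) \<in> periodic_measurable"
  using measurable_compose[OF periodic_measurable_lebesgue[OF assms(1)] assms(2)]
  by (intro periodic_measurableI) (simp_all add: periodic_measurable_period[OF assms(1)])

lemma periodic_measurable_add:
  "f \<in> periodic_measurable \<Longrightarrow> g \<in> periodic_measurable \<Longrightarrow> (\<lambda>t. f t + g t) \<in> periodic_measurable"
  by (intro periodic_measurableI borel_measurable_add)
     (simp_all add: periodic_measurable_period periodic_measurable_lebesgue)

lemma periodic_measurable_diff:
  "f \<in> periodic_measurable \<Longrightarrow> g \<in> periodic_measurable \<Longrightarrow> (\<lambda>t. f t - g t) \<in> periodic_measurable"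
  by (intro periodic_measurableI borel_measurable_diff)
     (simp_all add: periodic_measurable_period periodic_measurable_lebesgue)

lemma periodic_measurable_mult:
  "f \<in> periodic_measurable \<Longrightarrow> g \<in> periodic_measurable \<Longrightarrow> (\<lambda>t. f t * g t) \<in> periodic_measurable"
  by (intro periodic_measurableI borel_measurable_times)
     (simp_all add: periodic_measurable_period periodic_measurable_lebesgue)

lemma periodic_measurable_const: "(\<lambda>t. c) \<in> periodic_measurable"
  by (intro periodic_measurableI) auto

lemma periodic_measurable_cis: "(\<lambda>t. cis (of_int n * t)) \<in> periodic_measurable"
proof (rule periodic_measurableI)
  show "cis (of_int n * (t + 2 * pi)) = cis (of_int n * t)" for t
  proof -
    have "cis (of_int n * (t + 2 * pi)) = cis (of_int n * t) * cis (2 * pi * of_int n)"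
      by (simp add: cis_mult algebra_simps)
    then show ?thesis by simp
  qed
  have "continuous_on UNIV (\<lambda>t. cis (real_of_int n * t))" by (intro continuous_intros)
  then have "(\<lambda>t. cis (real_of_int n * t)) \<in> borel_measurable lborel"
    by (simp add: borel_measurable_continuous_onI)
  then show "(\<lambda>t. cis (of_int n * t)) \<in> borel_measurable lebesgue"
    by (rule measurable_completion)
qed

lemma Lp_iff: "f \<in> Lp p \<longleftrightarrow> f \<in> periodic_measurable \<and> pmass p f < \<infinity>"
proof -
  have "set_integrable lebesgue {0..2 * pi} (\<lambda>t. norm (f t) powr p) \<longleftrightarrow> pmass p f < \<infinity>"
    if f: "f \<in> periodic_measurable"
  proof -
    have "(\<lambda>t. norm (f t) powr p) \<in> borel_measurable circle"
      using f by (rule norm_powr_measurable_circle)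
    then show ?thesis
      unfolding set_integrable_def pmass_def
      by (subst integrable_restrict_space[symmetric]) (auto simp: integrable_iff_bounded)
  qed
  then show ?thesis
    by (auto simp: Lp_def periodic_measurable_def)
qed

lemma Lp_periodic_measurable: "f \<in> Lp p \<Longrightarrow> f \<in> periodic_measurable" by (simp add: Lp_iff)

lemma Lp_pmass_finite: "f \<in> Lp p \<Longrightarrow> pmass p f < \<infinity>" by (simp add: Lp_iff)

lemma Lp_norm_eq:
  assumes "f \<in> periodic_measurable"
  shows "Lp_norm p f = (enn2real (pmass p f) / (2 * pi)) powr (1 / p)"
proof -
  have "(LINT t:{0..2 * pi}|lebesgue. norm (f t) powr p) = integral\<^sup>L circle (\<lambda>t. norm (f t) powr p)"
    unfolding set_lebesgue_integral_def
    by (subst integral_restrict_space) auto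
  also have "\<dots> = enn2real (pmass p f)"
    unfolding pmass_def by (rule integral_eq_nn_integral) (use norm_powr_measurable_circle[OF assms] in auto)
  finally show ?thesis by (simp add: Lp_norm_def)
qed

lemma fourier_coeff_circle:
  "fourier_coeff f n = 1 / (2 * pi) * (LINT t|circle. f t * cis (- (of_int n * t)))"
  unfolding fourier_coeff_def set_lebesgue_integral_def
  by (subst integral_restrict_space) auto

lemma pmass_cong_AE: "AE t in circle. f t = g t \<Longrightarrow> pmass p f = pmass p g"
  unfolding pmass_def by (rule nn_integral_cong_AE) auto

lemma pmass_mono_AE:
  assumes "AE t in circle. norm (f t) \<le> norm (g t)" "0 \<le> p"
  shows "pmass p f \<le> pmass p g"
  unfolding pmass_def
  by (rule nn_integral_mono_AE) (use assms in \<open>auto intro!: ennreal_leI powr_mono2\<close>)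

lemma pmass_mono:
  "(\<And>t. norm (f t) \<le> norm (g t)) \<Longrightarrow> 0 \<le> p \<Longrightarrow> pmass p f \<le> pmass p g"
  by (rule pmass_mono_AE) auto

lemma pmass_mult:
  assumes "f \<in> periodic_measurable"
  shows "pmass p (\<lambda>t. c * f t) = ennreal (norm c powr p) * pmass p f"
  unfolding pmass_def using assms
  by (subst nn_integral_cmult[symmetric])
     (auto simp: norm_mult powr_mult ennreal_mult intro!: norm_powr_measurable_circle ennreal_norm_powr_measurable_circle)

lemma pmass_eq_0:
  assumes "f \<in> periodic_measurable" "pmass p f = 0"
  shows "AE t in circle. f t = 0"
proof -
  have "AE t in circle. ennreal (norm (f t) powr p) = 0"
    using assms unfolding pmass_def
    by (subst nn_integral_0_iff_AE[symmetric])
       (auto intro!: norm_powr_measurable_circle ennreal_norm_powr_measurable_circle)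
  then show ?thesis by (auto simp: ennreal_eq_0_iff powr_def split: if_splits)
qed

lemma powr_add_le:
  fixes x y :: real
  assumes "0 \<le> x" "0 \<le> y" "0 \<le> p"
  shows "(x + y) powr p \<le> 2 powr p * (x powr p + y powr p)"
proof -
  have "(x + y) powr p \<le> (2 * max x y) powr p"
    using assms by (intro powr_mono2) auto
  also have "\<dots> = 2 powr p * max x y powr p"
    using assms by (simp add: powr_mult)
  also have "max x y powr p \<le> x powr p + y powr p" by (auto simp: max_def)
  finally show ?thesis by simp
qed

text \<open>
  Constants are not tracked, so a triangle inequality up to a factor serves both for bounds and for
  limits, and it follows from its pointwise version.
\<close>

lemma pmass_add:
  assumes "f \<in> periodic_measurable" "g \<in> periodic_measurable" "0 \<le> p"
  shows "pmass p (\<lambda>t. f t + g t) \<le> ennreal (2 powr p) * (pmass p f + pmass p g)"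
proof -
  have [measurable]: "f \<in> borel_measurable circle" "g \<in> borel_measurable circle"
    using assms periodic_measurable_circle by auto
  have "pmass p (\<lambda>t. f t + g t) \<le>
      (\<integral>\<^sup>+ t. ennreal (2 powr p) * (ennreal (norm (f t) powr p) + ennreal (norm (g t) powr p)) \<partial>circle)"
    unfolding pmass_def
  proof (rule nn_integral_mono)
    fix t
    have "norm (f t + g t) powr p \<le> (norm (f t) + norm (g t)) powr p"
      using assms by (intro powr_mono2 norm_triangle_ineq) auto
    also have "\<dots> \<le> 2 powr p * (norm (f t) powr p + norm (g t) powr p)"
      using assms by (intro powr_add_le) auto
    finally show "ennreal (norm (f t + g t) powr p)
        \<le> ennreal (2 powr p) * (ennreal (norm (f t) powr p) + ennreal (norm (g t) powr p))"
      by (metis ennreal_leI ennreal_mult ennreal_plus powr_ge_zero add_nonneg_nonneg)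
  qed
  also have "\<dots> = ennreal (2 powr p) * (pmass p f + pmass p g)"
    unfolding pmass_def by (subst nn_integral_cmult) (auto simp: nn_integral_add)
  finally show ?thesis .
qed

lemma pmass_minus: "pmass p (\<lambda>t. - f t) = pmass p f"
  by (simp add: pmass_def)

lemma pmass_diff_commute: "pmass p (\<lambda>t. f t - g t) = pmass p (\<lambda>t. g t - f t)"
  by (simp add: pmass_def norm_minus_commute)

lemma pmass_diff:
  assumes "f \<in> periodic_measurable" "g \<in> periodic_measurable" "0 \<le> p"
  shows "pmass p (\<lambda>t. f t - g t) \<le> ennreal (2 powr p) * (pmass p f + pmass p g)"
proof -
  have "(\<lambda>t. - g t) \<in> periodic_measurable"
    using periodic_measurable_mult[OF periodic_measurable_const[of "-1"] assms(2)] by simp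
  from pmass_add[OF assms(1) this assms(3)] show ?thesis by (simp add: pmass_minus)
qed

lemma pmass_diff_triangle:
  assumes "f \<in> periodic_measurable" "g \<in> periodic_measurable" "h \<in> periodic_measurable" "0 \<le> p"
  shows "pmass p (\<lambda>t. f t - h t) \<le>
    ennreal (2 powr p) * (pmass p (\<lambda>t. f t - g t) + pmass p (\<lambda>t. g t - h t))"
  using pmass_add[OF periodic_measurable_diff periodic_measurable_diff, of f g g h p] assms by simp

lemma Lp_add: "f \<in> Lp p \<Longrightarrow> g \<in> Lp p \<Longrightarrow> 0 \<le> p \<Longrightarrow> (\<lambda>t. f t + g t) \<in> Lp p"
  using pmass_add[of f g p] 
  by (auto simp: Lp_iff periodic_measurable_add ennreal_mult_less_top intro: le_less_trans)

lemma Lp_diff: "f \<in> Lp p \<Longrightarrow> g \<in> Lp p \<Longrightarrow> 0 \<le> p \<Longrightarrow> (\<lambda>t. f t - g t) \<in> Lp p"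
  using pmass_diff[of f g p] 
  by (auto simp: Lp_iff periodic_measurable_diff ennreal_mult_less_top intro: le_less_trans)

lemma Lp_cmult: "f \<in> Lp p \<Longrightarrow> (\<lambda>t. c * f t) \<in> Lp p"
  by (auto simp: Lp_iff pmass_mult periodic_measurable_mult periodic_measurable_const ennreal_mult_less_top)

lemma Lp_bounded:
  assumes "f \<in> periodic_measurable" "\<And>t. norm (f t) \<le> B" "0 \<le> p"
  shows "f \<in> Lp p"
proof -
  have "pmass p f \<le> pmass p (\<lambda>t. of_real \<bar>B\<bar>)"
    using assms(2) abs_ge_self[of B] by (intro pmass_mono assms) (simp, metis order_trans)
  also have "\<dots> < \<infinity>"
    by (simp add: pmass_def nn_integral_circle_const ennreal_mult_less_top del: nn_integral_const)
  finally show ?thesis using assms by (simp add: Lp_iff)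
qed

lemma Lp_const: "0 \<le> p \<Longrightarrow> (\<lambda>t. c) \<in> Lp p"
  by (rule Lp_bounded[where B="norm c"]) (auto simp: periodic_measurable_const)

lemma Lp_cis: "0 \<le> p \<Longrightarrow> (\<lambda>t. cis (of_int n * t)) \<in> Lp p"
  by (rule Lp_bounded[where B=1]) (auto simp: periodic_measurable_cis)

lemma Lp_sum:
  assumes "finite F" "\<And>i. i \<in> F \<Longrightarrow> u i \<in> Lp p" "0 \<le> p"
  shows "(\<lambda>t. \<Sum>i\<in>F. u i t) \<in> Lp p"
  using assms by (induction F) (auto intro: Lp_add Lp_const)

text \<open>
  Below height \<open>\<epsilon>\<close> the \<open>q\<close>-th power is at most \<open>\<epsilon> powr q\<close>; above it, it is at most
  \<open>\<epsilon> powr (q - p)\<close> times the \<open>p\<close>-th power. Together with a free choice of \<open>\<epsilon>\<close> this gives the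
  inclusion of \<open>L\<^sup>p\<close> in \<open>L\<^sup>q\<close> and its continuity at once.
\<close>

lemma pmass_lower_exponent:
  assumes f: "f \<in> periodic_measurable" and "0 < \<epsilon>" "0 < q" "q \<le> p"
  shows "pmass q f \<le> ennreal (2 * pi * \<epsilon> powr q) + ennreal (\<epsilon> powr (q - p)) * pmass p f"
proof -
  have [measurable]: "f \<in> borel_measurable circle" using f periodic_measurable_circle by auto
  have le: "x powr q \<le> \<epsilon> powr q + \<epsilon> powr (q - p) * x powr p" if "0 \<le> x" for x :: real
  proof (cases "x \<le> \<epsilon>")
    case True
    then have "x powr q \<le> \<epsilon> powr q" using assms that by (intro powr_mono2) auto
    then show ?thesis by (simp add: add_increasing2)
  next
    case False
    have "x powr q = x powr (q - p) * x powr p"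
      by (simp flip: powr_add)
    also have "x powr (q - p) \<le> \<epsilon> powr (q - p)"
      using False assms by (intro powr_mono2') auto
    finally show ?thesis
      using powr_ge_zero[of \<epsilon> q] by (smt (verit) mult_right_mono powr_ge_zero)
  qed
  have "pmass q f \<le> (\<integral>\<^sup>+ t. ennreal (\<epsilon> powr q) + ennreal (\<epsilon> powr (q - p)) * ennreal (norm (f t) powr p) \<partial>circle)"
    unfolding pmass_def
    by (rule nn_integral_mono) (use le in \<open>auto simp flip: ennreal_mult ennreal_plus intro!: ennreal_leI\<close>)
  also have "\<dots> = ennreal (2 * pi * \<epsilon> powr q) + ennreal (\<epsilon> powr (q - p)) * pmass p f"
    unfolding pmass_def
    by (subst nn_integral_add, simp, simp, subst nn_integral_circle_const, subst nn_integral_cmult, simp)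
       (simp add: ennreal_mult[symmetric] mult.commute)
  finally show ?thesis .
qed

lemma Lp_lower_exponent:
  assumes "f \<in> Lp p" "0 < q" "q \<le> p"
  shows "f \<in> Lp q"
  using pmass_lower_exponent[of f 1 q p] assms
  by (auto simp: Lp_iff intro: le_less_trans)

lemma pmass_tendsto_lower_exponent:
  assumes lim: "(\<lambda>k. pmass p (f k)) \<longlonglongrightarrow> 0" and f: "\<And>k. f k \<in> periodic_measurable"
    and q: "0 < q" "q \<le> p"
  shows "(\<lambda>k. pmass q (f k)) \<longlonglongrightarrow> 0"
proof (rule order_tendstoI)
  fix a :: ennreal assume "0 < a"
  define a' where "a' = min a 1"
  have a': "0 < a'" "a' \<le> a" "a' < \<infinity>" using \<open>0 < a\<close> by (auto simp: a'_def min_less_iff_disj)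
  define b where "b = enn2real a'"
  have b: "0 < b" "ennreal b = a'" using a' by (auto simp: b_def enn2real_positive_iff)
  \<comment> \<open>this level makes the first term of the splitting equal to half of the tolerance\<close>
  define \<epsilon> where "\<epsilon> = (b / (4 * pi)) powr (1 / q)"
  have \<epsilon>: "0 < \<epsilon>" "2 * pi * \<epsilon> powr q = b / 2"
    using b q by (auto simp: \<epsilon>_def powr_powr)
  have "((\<lambda>k. ennreal (2 * pi * \<epsilon> powr q) + ennreal (\<epsilon> powr (q - p)) * pmass p (f k)) \<longlonglongrightarrow>
      ennreal (2 * pi * \<epsilon> powr q) + ennreal (\<epsilon> powr (q - p)) * 0)"
    by (intro tendsto_intros lim) auto
  moreover have "ennreal (2 * pi * \<epsilon> powr q) + ennreal (\<epsilon> powr (q - p)) * 0 < ennreal b"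
    using b(1) \<epsilon>(2) by (auto intro!: ennreal_lessI)
  ultimately have "eventually (\<lambda>k. ennreal (2 * pi * \<epsilon> powr q) + ennreal (\<epsilon> powr (q - p)) * pmass p (f k)
       < ennreal b) sequentially"
    by (rule order_tendstoD(2))
  then show "eventually (\<lambda>k. pmass q (f k) < a) sequentially"
  proof eventually_elim
    case (elim k)
    show ?case
      using pmass_lower_exponent[OF f \<epsilon>(1) q, of k] elim a' b(2) by (metis le_less_trans less_le_trans)
  qed
qed auto

lemma pmass_1: "pmass 1 f = (\<integral>\<^sup>+ t. ennreal (norm (f t)) \<partial>circle)"
  by (simp add: pmass_def)

lemma Lp_1_integrable: "f \<in> Lp 1 \<Longrightarrow> integrable circle f"
  by (auto simp: Lp_iff integrable_iff_bounded pmass_1 intro: periodic_measurable_circle)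

lemma Lp_integrable: "f \<in> Lp p \<Longrightarrow> 1 \<le> p \<Longrightarrow> integrable circle f"
  using Lp_lower_exponent[of f p 1] Lp_1_integrable by auto

lemma norm_integral_le_pmass: "f \<in> Lp 1 \<Longrightarrow> ennreal (norm (integral\<^sup>L circle f)) \<le> pmass 1 f"
  using integral_norm_bound_ennreal[OF Lp_1_integrable] by (simp add: pmass_1)

lemma pmass_tendsto_AE_subseq:
  assumes lim: "(\<lambda>k. pmass p (\<lambda>t. f k t - g t)) \<longlonglongrightarrow> 0"
    and f: "\<And>k. f k \<in> Lp p" and g: "g \<in> Lp p" and p: "1 \<le> p"
  obtains r :: "nat \<Rightarrow> nat" where "strict_mono r" "AE t in circle. (\<lambda>k. f (r k) t) \<longlonglongrightarrow> g t"
proof -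
  have d: "(\<lambda>t. f k t - g t) \<in> Lp 1" for k
    using Lp_lower_exponent[OF Lp_diff[OF f g]] p by auto
  have "(\<lambda>k. pmass 1 (\<lambda>t. f k t - g t)) \<longlonglongrightarrow> 0"
    using lim by (rule pmass_tendsto_lower_exponent) (use d p in \<open>auto simp: Lp_iff\<close>)
  moreover have "pmass 1 (\<lambda>t. f k t - g t) = ennreal (\<integral>t. norm (f k t - g t) \<partial>circle)" for k
    unfolding pmass_1
    by (rule nn_integral_eq_integral) (use Lp_1_integrable[OF d] in auto)
  ultimately have "(\<lambda>k. \<integral>t. norm (f k t - g t) \<partial>circle) \<longlonglongrightarrow> 0"
    using tendsto_ennreal_iff[of "\<lambda>k. \<integral>t. norm (f k t - g t) \<partial>circle" sequentially 0] by simp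
  from tendsto_L1_AE_subseq[OF _ this] Lp_1_integrable[OF d]
  obtain r where "strict_mono r" "AE t in circle. (\<lambda>k. f (r k) t - g t) \<longlonglongrightarrow> 0" by auto
  moreover from this(2) have "AE t in circle. (\<lambda>k. f (r k) t) \<longlonglongrightarrow> g t"
    by eventually_elim (simp add: LIM_zero_iff)
  ultimately show ?thesis using that by blast
qed

lemma pmass_Fatou:
  assumes lim: "AE t in circle. (\<lambda>k. f k t) \<longlonglongrightarrow> g t"
    and f: "\<And>k. f k \<in> periodic_measurable" and p: "0 < p"
  shows "pmass p g \<le> liminf (\<lambda>k. pmass p (f k))"
proof -
  have "pmass p g = (\<integral>\<^sup>+ t. liminf (\<lambda>k. ennreal (norm (f k t) powr p)) \<partial>circle)"
    unfolding pmass_def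
  proof (rule nn_integral_cong_AE)
    show "AE t in circle. ennreal (norm (g t) powr p) = liminf (\<lambda>k. ennreal (norm (f k t) powr p))"
      using lim
    proof eventually_elim
      case (elim t)
      have "(\<lambda>k. norm (f k t) powr p) \<longlonglongrightarrow> norm (g t) powr p"
        using elim p by (intro tendsto_powr' tendsto_norm tendsto_const) auto
      then have "(\<lambda>k. ennreal (norm (f k t) powr p)) \<longlonglongrightarrow> ennreal (norm (g t) powr p)"
        by (rule tendsto_ennrealI)
      then show ?case by (intro lim_imp_Liminf[symmetric]) auto
    qed
  qed
  also have "\<dots> \<le> liminf (\<lambda>k. pmass p (f k))"
    unfolding pmass_def
    by (rule nn_integral_liminf)
       (auto intro!: norm_powr_measurable_circle ennreal_norm_powr_measurable_circle f)
  finally show ?thesis .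
qed

text \<open>
Convergence is assumed for the exponent \<open>q\<close>, the bounds are for the exponent \<open>p\<close>: an almost everywhere
convergent subsequence and Fatou's lemma carry them to the limit. Below, \<open>q\<close> is 2 because only the
\<open>L\<^sup>2\<close> theory provides the limits that define the Hilbert transform.
\<close>

lemma pmass_le_of_tendsto:
  assumes lim: "(\<lambda>k. pmass q (\<lambda>t. f k t - g t)) \<longlonglongrightarrow> 0"
    and f: "\<And>k. f k \<in> Lp q" and g: "g \<in> Lp q" and q: "1 \<le> q" and p: "0 < p"
    and le: "\<And>k. pmass p (f k) \<le> C k" and C: "C \<longlonglongrightarrow> D"
  shows "pmass p g \<le> D"
proof -
  obtain r :: "nat \<Rightarrow> nat" where r: "strict_mono r" "AE t in circle. (\<lambda>k. f (r k) t) \<longlonglongrightarrow> g t"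
    using pmass_tendsto_AE_subseq[OF lim f g q] by blast
  have "pmass p g \<le> liminf (\<lambda>k. pmass p (f (r k)))"
    using r f p by (intro pmass_Fatou) (auto simp: Lp_iff)
  also have "\<dots> \<le> liminf (\<lambda>k. C (r k))"
    by (intro Liminf_mono always_eventually) (simp add: le)
  also have "\<dots> = D"
    using LIMSEQ_subseq_LIMSEQ[OF C r(1)] by (simp add: lim_imp_Liminf o_def)
  finally show ?thesis .
qed

text \<open>
The set where two periodic functions differ is covered by the translates, by multiples of the period, of
its part in one period, hence is null as soon as that part is.
\<close>

lemma AE_circle_iff_ae_eq:
  assumes f: "f \<in> periodic_measurable" and g: "g \<in> periodic_measurable"
  shows "(AE t in circle. f t = g t) \<longleftrightarrow> f =\<^sub>a\<^sub>e g"
proof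
  assume "f =\<^sub>a\<^sub>e g"
  then show "AE t in circle. f t = g t"
    by (auto simp: ae_eq_def AE_restrict_space_iff)
next
  assume "AE t in circle. f t = g t"
  then have "AE t in lebesgue. t \<in> {0..2 * pi} \<longrightarrow> f t = g t"
    by (subst (asm) AE_restrict_space_iff) auto
  then obtain N where N: "{t. \<not> (t \<in> {0..2 * pi} \<longrightarrow> f t = g t)} \<subseteq> N" "N \<in> null_sets lebesgue"
    by (auto elim!: AE_E simp: null_sets_def)
  define N' where "N' = (\<Union>k::int. (+) (2 * pi * of_int k) ` N)"
  have "negligible N" using N(2) by (simp add: negligible_iff_null_sets)
  then have "negligible N'"
    unfolding N'_def by (intro negligible_countable_Union) (auto intro: negligible_translation)
  moreover have "{t. f t \<noteq> g t} \<subseteq> N'"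
  proof
    fix t assume t: "t \<in> {t. f t \<noteq> g t}"
    define k where "k = \<lfloor>t / (2 * pi)\<rfloor>"
    define s where "s = t - 2 * pi * of_int k"
    interpret f: periodic_fun_simple f "2 * pi" using f by (simp add: periodic_measurable_def)
    interpret g: periodic_fun_simple g "2 * pi" using g by (simp add: periodic_measurable_def)
    have ts: "t = s + of_int k * (2 * pi)" by (simp add: s_def)
    have "f s \<noteq> g s"
      using t f.plus_of_int[of s k] g.plus_of_int[of s k] unfolding ts by simp
    moreover have "s \<in> {0..2 * pi}"
    proof -
      have "of_int k \<le> t / (2 * pi)" "t / (2 * pi) < of_int k + 1"
        unfolding k_def by linarith+
      then show ?thesis by (auto simp: s_def field_simps)
    qed
    ultimately have "s \<in> N" using N(1) by blast
    then show "t \<in> N'" unfolding N'_def ts by (auto simp: image_iff mult.commute add.commute)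
  qed
  ultimately show "f =\<^sub>a\<^sub>e g"
    unfolding ae_eq_def by (intro AE_I'[of N']) (auto simp: negligible_iff_null_sets)
qed

lemma pmass_diff_eq_0:
  assumes "f \<in> periodic_measurable" "g \<in> periodic_measurable" "pmass p (\<lambda>t. f t - g t) = 0"
  shows "f =\<^sub>a\<^sub>e g"
proof -
  have "AE t in circle. f t - g t = 0"
    using assms by (intro pmass_eq_0 periodic_measurable_diff)
  then show ?thesis using AE_circle_iff_ae_eq[OF assms(1,2)] by simp
qed

lemma pmass_limit_unique:
  assumes "(\<lambda>k. pmass p (\<lambda>t. f k t - g t)) \<longlonglongrightarrow> 0" "(\<lambda>k. pmass p (\<lambda>t. f k t - h t)) \<longlonglongrightarrow> 0"
    and f: "\<And>k. f k \<in> periodic_measurable" and gh: "g \<in> periodic_measurable" "h \<in> periodic_measurable"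
    and p: "0 \<le> p"
  shows "g =\<^sub>a\<^sub>e h"
proof (rule pmass_diff_eq_0)
  have "(\<lambda>k. ennreal (2 powr p) * (pmass p (\<lambda>t. f k t - g t) + pmass p (\<lambda>t. f k t - h t)))
      \<longlonglongrightarrow> ennreal (2 powr p) * (0 + 0)"
    by (intro tendsto_intros assms) auto
  moreover have "pmass p (\<lambda>t. g t - h t) \<le>
      ennreal (2 powr p) * (pmass p (\<lambda>t. f k t - g t) + pmass p (\<lambda>t. f k t - h t))" for k
    using pmass_diff_triangle[OF gh(1) f[of k] gh(2) p] unfolding pmass_diff_commute[of p g "f k"] .
  ultimately have "pmass p (\<lambda>t. g t - h t) \<le> ennreal (2 powr p) * (0 + 0)"
    by (intro LIMSEQ_le_const) auto
  then show "pmass p (\<lambda>t. g t - h t) = 0" by simp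
qed (rule gh)+

lemma ennreal_pos_lower:
  assumes "0 < (a :: ennreal)"
  obtains e :: real where "0 < e" "ennreal e < a"
proof (cases a)
  case (real r)
  with assms have "0 < r" by simp
  with real show ?thesis by (intro that[of "r / 2"]) (simp_all add: ennreal_less_iff)
next
  case top
  then show ?thesis by (intro that[of 1]) simp_all
qed

section \<open>Completeness\<close>

text \<open>
A subsequence \<open>r\<close> is chosen so fast that its increments are summable in \<open>L\<^sup>1\<close>; it then converges
almost everywhere, and Fatou's lemma shows that the limit is the limit in \<open>L\<^sup>p\<close>. The limit is defined
pointwise by \<^const>\<open>lim\<close> at every point: where the values do not converge it is still determined by
the sequence of values, so it is exactly periodic.
\<close>

lemma Lp_complete:
  assumes f: "\<And>k. f k \<in> Lp p" and p: "1 \<le> p"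
    and Cauchy: "\<And>e. 0 < e \<Longrightarrow> \<exists>N. \<forall>m\<ge>N. \<forall>n\<ge>N. pmass p (\<lambda>t. f m t - f n t) \<le> ennreal e"
  obtains g where "g \<in> Lp p" "(\<lambda>k. pmass p (\<lambda>t. f k t - g t)) \<longlonglongrightarrow> 0"
proof -
  have fm: "f k \<in> periodic_measurable" for k using f by (rule Lp_periodic_measurable)
  have "\<exists>N. \<forall>m\<ge>N. \<forall>n\<ge>N. pmass p (\<lambda>t. f m t - f n t) \<le> ennreal (((1/2) ^ k) powr p)" for k :: nat
    by (rule Cauchy) simp
  then obtain N where N: "\<And>k m n. N k \<le> m \<Longrightarrow> N k \<le> n \<Longrightarrow>
      pmass p (\<lambda>t. f m t - f n t) \<le> ennreal (((1/2) ^ k) powr p)" for k :: nat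
    by metis
  define r where "r = (\<lambda>k. Max (N ` {..k}) + k)"
  have rN: "N k \<le> r k" "N k \<le> r (Suc k)" "k \<le> r k" for k
  proof -
    have "N k \<le> Max (N ` {..k})" "N k \<le> Max (N ` {..Suc k})" by (auto intro!: Max_ge)
    then show "N k \<le> r k" "N k \<le> r (Suc k)" "k \<le> r k" unfolding r_def by linarith+
  qed
  define d where "d = (\<lambda>k t. f (r (Suc k)) t - f (r k) t)"
  have dm: "d k \<in> periodic_measurable" for k
    unfolding d_def by (intro periodic_measurable_diff fm)
  have [measurable]: "d k \<in> borel_measurable circle" for k
    by (rule periodic_measurable_circle[OF dm])
  \<comment> \<open>the level \<open>(1/2) ^ k\<close> matches the bound on the \<open>p\<close>-th power, so both terms are of that size\<close>
  have d1: "pmass 1 (d k) \<le> ennreal ((2 * pi + 1) * (1/2) ^ k)" for k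
  proof -
    let ?\<epsilon> = "(1/2) ^ k :: real"
    have "pmass 1 (d k) \<le> ennreal (2 * pi * ?\<epsilon> powr 1) + ennreal (?\<epsilon> powr (1 - p)) * pmass p (d k)"
      by (rule pmass_lower_exponent) (use dm p in auto)
    also have "\<dots> \<le> ennreal (2 * pi * ?\<epsilon> powr 1) + ennreal (?\<epsilon> powr (1 - p)) * ennreal (?\<epsilon> powr p)"
      unfolding d_def by (intro add_left_mono mult_left_mono N rN) auto
    also have "\<dots> = ennreal (2 * pi * ?\<epsilon> powr 1 + ?\<epsilon> powr (1 - p) * ?\<epsilon> powr p)"
      by (subst ennreal_mult[symmetric], simp, simp, subst ennreal_plus[symmetric]) auto
    also have "2 * pi * ?\<epsilon> powr 1 + ?\<epsilon> powr (1 - p) * ?\<epsilon> powr p = (2 * pi + 1) * ?\<epsilon>"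
      by (simp flip: powr_add add: algebra_simps)
    finally show ?thesis .
  qed
  have "(\<integral>\<^sup>+ t. (\<Sum>k. ennreal (norm (d k t))) \<partial>circle) = (\<Sum>k. pmass 1 (d k))"
    unfolding pmass_1
    by (intro nn_integral_suminf) measurable
  also have "\<dots> \<le> (\<Sum>k. ennreal ((2 * pi + 1) * (1/2) ^ k))"
    by (intro suminf_le d1) auto
  also have "\<dots> = ennreal (\<Sum>k. (2 * pi + 1) * (1/2) ^ k)"
    by (intro suminf_ennreal2 summable_mult summable_geometric) auto
  finally have "(\<integral>\<^sup>+ t. (\<Sum>k. ennreal (norm (d k t))) \<partial>circle) \<noteq> \<infinity>"
    by (auto simp: top_unique)
  then have "AE t in circle. (\<Sum>k. ennreal (norm (d k t))) \<noteq> \<infinity>"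
    by (intro nn_integral_noteq_infinite) measurable
  then have lim: "AE t in circle. (\<lambda>k. f (r k) t) \<longlonglongrightarrow> lim (\<lambda>k. f (r k) t)"
  proof eventually_elim
    case (elim t)
    then have "summable (\<lambda>k. norm (d k t))"
      by (intro summable_suminf_not_top) auto
    then have "summable (\<lambda>k. d k t)" by (rule summable_norm_cancel)
    then have "convergent (\<lambda>n. \<Sum>k<n. d k t)" by (simp add: summable_iff_convergent)
    moreover have "(\<Sum>k<n. d k t) = f (r n) t - f (r 0) t" for n
      unfolding d_def by (rule sum_lessThan_telescope)
    ultimately have "convergent (\<lambda>n. f (r n) t - f (r 0) t)" by simp
    then have "convergent (\<lambda>n. f (r n) t)" by (simp add: convergent_diff_const_right_iff)
    then show ?case by (simp add: convergent_LIMSEQ_iff)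
  qed
  define g where "g = (\<lambda>t. lim (\<lambda>k. f (r k) t))"
  have gm: "g \<in> periodic_measurable"
    unfolding g_def using fm
    by (intro periodic_measurableI borel_measurable_lim_metric)
       (simp_all add: periodic_measurable_period periodic_measurable_lebesgue)
  have close: "pmass p (\<lambda>t. f m t - g t) \<le> ennreal e"
    if M: "\<And>n. M \<le> n \<Longrightarrow> pmass p (\<lambda>t. f m t - f n t) \<le> ennreal e" for m M e
  proof -
    have "pmass p (\<lambda>t. f m t - g t) \<le> liminf (\<lambda>k. pmass p (\<lambda>t. f m t - f (r k) t))"
    proof (rule pmass_Fatou)
      show "AE t in circle. (\<lambda>k. f m t - f (r k) t) \<longlonglongrightarrow> f m t - g t"
        using lim by eventually_elim (simp add: g_def tendsto_diff)
    qed (use p fm in \<open>auto intro: periodic_measurable_diff\<close>)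
    also have "\<dots> \<le> liminf (\<lambda>k. ennreal e)"
    proof (rule Liminf_mono)
      show "eventually (\<lambda>k. pmass p (\<lambda>t. f m t - f (r k) t) \<le> ennreal e) sequentially"
        using eventually_ge_at_top[of M]
        by eventually_elim (use M rN(3) order_trans in blast)
    qed
    also have "\<dots> = ennreal e" by (simp add: Liminf_const)
    finally show ?thesis .
  qed
  obtain M where M: "\<And>m n. M \<le> m \<Longrightarrow> M \<le> n \<Longrightarrow> pmass p (\<lambda>t. f m t - f n t) \<le> ennreal 1"
    using Cauchy[of 1] by auto
  have "(\<lambda>t. f M t - g t) \<in> Lp p"
    using close[of M M 1, OF M] fm gm
    by (auto simp: Lp_iff periodic_measurable_diff intro: le_less_trans)
  from Lp_diff[OF f[of M] this] p have "g \<in> Lp p" by simp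
  moreover have "(\<lambda>k. pmass p (\<lambda>t. f k t - g t)) \<longlonglongrightarrow> 0"
  proof (rule order_tendstoI)
    fix a :: ennreal assume "0 < a"
    then obtain e where e: "0 < e" "ennreal e < a" by (rule ennreal_pos_lower)
    obtain M where M: "\<And>m n. M \<le> m \<Longrightarrow> M \<le> n \<Longrightarrow> pmass p (\<lambda>t. f m t - f n t) \<le> ennreal e"
      using Cauchy[OF e(1)] by auto
    show "eventually (\<lambda>k. pmass p (\<lambda>t. f k t - g t) < a) sequentially"
      using eventually_ge_at_top[of M]
    proof eventually_elim
      case (elim k)
      have "pmass p (\<lambda>t. f k t - g t) \<le> ennreal e"
        by (rule close[of M]) (rule M[OF elim])
      then show ?case using e(2) by (rule le_less_trans)
    qed
  qed auto
  ultimately show ?thesis using that by blast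
qed

section \<open>The pairing of \<open>L\<^sup>p\<close> and \<open>L\<^sup>q\<close>\<close>

text \<open>
Young's inequality for \<open>l * f\<close> and \<open>g / l\<close>. The weight \<open>l\<close> stays free, so that either term can be made
small at the expense of the other; this is how the inequality is used both for the continuity of the
pairing and for absorbing a term in the duality argument.
\<close>

lemma pmass_mult_Young:
  assumes f: "f \<in> periodic_measurable" and g: "g \<in> periodic_measurable"
    and pq: "1 < p" "1 < q" "1 / p + 1 / q = 1" and l: "0 < l"
  shows "pmass 1 (\<lambda>t. f t * g t) \<le>
    ennreal (l powr p) * pmass p f + ennreal (l powr (- q)) * pmass q g"
proof -
  have [measurable]: "f \<in> borel_measurable circle" "g \<in> borel_measurable circle"
    using f g periodic_measurable_circle by auto
  have le: "x * y \<le> l powr p * x powr p + l powr (- q) * y powr q" if "0 \<le> x" "0 \<le> y" for x y :: real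
  proof -
    have "x * y = (l * x) * (y / l)" using l by simp
    also have "\<dots> \<le> (l * x) powr p / p + (y / l) powr q / q"
      using that l pq by (intro Youngs_inequality) auto
    also have "\<dots> \<le> (l * x) powr p + (y / l) powr q"
      using pq by (intro add_mono) (simp_all add: divide_le_eq mult_le_cancel_left1)
    also have "\<dots> = l powr p * x powr p + l powr (- q) * y powr q"
      using that l by (simp add: powr_mult powr_divide powr_minus divide_simps)
    finally show ?thesis .
  qed
  have "pmass 1 (\<lambda>t. f t * g t) \<le> (\<integral>\<^sup>+ t. ennreal (l powr p) * ennreal (norm (f t) powr p)
      + ennreal (l powr (- q)) * ennreal (norm (g t) powr q) \<partial>circle)"
    unfolding pmass_1
  proof (rule nn_integral_mono)
    fix t
    have "norm (f t * g t) \<le> l powr p * norm (f t) powr p + l powr (- q) * norm (g t) powr q"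
      unfolding norm_mult by (rule le) auto
    then have "ennreal (norm (f t * g t))
      \<le> ennreal (l powr p * norm (f t) powr p + l powr (- q) * norm (g t) powr q)"
      by (rule ennreal_leI)
    also have "\<dots> = ennreal (l powr p) * ennreal (norm (f t) powr p)
      + ennreal (l powr (- q)) * ennreal (norm (g t) powr q)"
      by (subst ennreal_plus) (auto simp: ennreal_mult)
    finally show "ennreal (norm (f t * g t)) \<le> ennreal (l powr p) * ennreal (norm (f t) powr p)
      + ennreal (l powr (- q)) * ennreal (norm (g t) powr q)" .
  qed
  also have "\<dots> = ennreal (l powr p) * pmass p f + ennreal (l powr (- q)) * pmass q g"
    unfolding pmass_def by (simp add: nn_integral_add nn_integral_cmult)
  finally show ?thesis .
qed

lemma Lp_mult:
  assumes "f \<in> Lp p" "g \<in> Lp q" "1 < p" "1 < q" "1 / p + 1 / q = 1"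
  shows "(\<lambda>t. f t * g t) \<in> Lp 1"
  using pmass_mult_Young[of f g p q 1] assms
  by (auto simp: Lp_iff periodic_measurable_mult intro: le_less_trans)

lemma integral_tendsto_of_pmass:
  assumes f: "\<And>k. f k \<in> Lp 1" "g \<in> Lp 1" and lim: "((\<lambda>k. pmass 1 (\<lambda>t. f k t - g t)) \<longlongrightarrow> 0) F"
  shows "((\<lambda>k. integral\<^sup>L circle (f k)) \<longlongrightarrow> integral\<^sup>L circle g) F"
proof -
  have le: "ennreal (norm (integral\<^sup>L circle (f k) - integral\<^sup>L circle g)) \<le> pmass 1 (\<lambda>t. f k t - g t)" for k
    using norm_integral_le_pmass[of "\<lambda>t. f k t - g t"] Lp_diff[OF f] f
    by (simp add: Lp_1_integrable)
  have "((\<lambda>k. ennreal (norm (integral\<^sup>L circle (f k) - integral\<^sup>L circle g))) \<longlongrightarrow> ennreal 0) F"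
    by (rule tendsto_sandwich[OF _ _ tendsto_const]) (use le lim in auto)
  then have "((\<lambda>k. norm (integral\<^sup>L circle (f k) - integral\<^sup>L circle g)) \<longlongrightarrow> 0) F"
    by (subst (asm) tendsto_ennreal_iff) auto
  then show ?thesis by (simp add: tendsto_norm_zero_iff LIM_zero_iff)
qed

lemma fourier_coeff_tendsto:
  assumes f: "\<And>k. f k \<in> Lp p" and g: "g \<in> Lp p" and p: "1 \<le> p"
    and lim: "(\<lambda>k. pmass p (\<lambda>t. f k t - g t)) \<longlonglongrightarrow> 0"
  shows "(\<lambda>k. fourier_coeff (f k) n) \<longlonglongrightarrow> fourier_coeff g n"
proof -
  have lim1: "(\<lambda>k. pmass 1 (\<lambda>t. f k t - g t)) \<longlonglongrightarrow> 0"
    by (rule pmass_tendsto_lower_exponent[OF lim])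
       (use f g p in \<open>auto intro: periodic_measurable_diff simp: Lp_iff\<close>)
  have e: "(\<lambda>t. cis (- (of_int n * t))) \<in> periodic_measurable"
    using periodic_measurable_cis[of "-n"] by simp
  have m: "(\<lambda>t. h t * cis (- (of_int n * t))) \<in> Lp 1" if "h \<in> Lp p" for h
    using Lp_lower_exponent[OF that, of 1] p
    by (auto simp: Lp_iff periodic_measurable_mult[OF _ e] pmass_1 norm_mult)
  have "pmass 1 (\<lambda>t. f k t * cis (- (of_int n * t)) - g t * cis (- (of_int n * t)))
      = pmass 1 (\<lambda>t. f k t - g t)" for k
    by (simp add: pmass_1 norm_mult flip: left_diff_distrib)
  with lim1 show ?thesis unfolding fourier_coeff_circle
    by (intro tendsto_intros integral_tendsto_of_pmass m f g) simp
qed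

lemma pairing_tendsto:
  assumes f: "\<And>k. f k \<in> Lp p" and g: "g \<in> Lp p" and h: "h \<in> Lp q"
    and pq: "1 < p" "1 < q" "1 / p + 1 / q = 1"
    and lim: "(\<lambda>k. pmass p (\<lambda>t. f k t - g t)) \<longlonglongrightarrow> 0"
  shows "(\<lambda>k. LINT t|circle. f k t * h t) \<longlonglongrightarrow> (LINT t|circle. g t * h t)"
proof (rule integral_tendsto_of_pmass)
  define b where "b = enn2real (pmass q h)"
  have b: "pmass q h = ennreal b" "0 \<le> b"
    using h by (auto simp: b_def Lp_iff less_top)
  have fm: "(\<lambda>t. f k t - g t) \<in> periodic_measurable" for k
    using f g by (auto intro: periodic_measurable_diff simp: Lp_iff)
  show "(\<lambda>k. pmass 1 (\<lambda>t. f k t * h t - g t * h t)) \<longlonglongrightarrow> 0"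
  proof (rule order_tendstoI)
    fix a :: ennreal assume "0 < a"
    then obtain e where e: "0 < e" "ennreal e < a" by (rule ennreal_pos_lower)
    define l where "l = (e / (2 * (b + 1))) powr (- (1 / q))"
    have l: "0 < l" "l powr (- q) = e / (2 * (b + 1))"
      using e b pq by (auto simp: l_def powr_powr)
    have "l powr (- q) * b \<le> e / 2"
      using e b by (simp add: l field_simps)
    then have lb: "ennreal (l powr (- q)) * pmass q h \<le> ennreal (e / 2)"
      unfolding b using b by (simp flip: ennreal_mult add: ennreal_leI)
    have "(\<lambda>k. ennreal (l powr p) * pmass p (\<lambda>t. f k t - g t) + ennreal (e / 2)) \<longlonglongrightarrow>
        ennreal (l powr p) * 0 + ennreal (e / 2)"
      by (intro tendsto_intros lim) auto
    moreover have "ennreal (l powr p) * 0 + ennreal (e / 2) < a"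
      using e by (auto intro: le_less_trans[OF _ e(2)] ennreal_leI)
    ultimately have "eventually (\<lambda>k. ennreal (l powr p) * pmass p (\<lambda>t. f k t - g t) + ennreal (e / 2) < a)
        sequentially"
      by (rule order_tendstoD(2))
    then show "eventually (\<lambda>k. pmass 1 (\<lambda>t. f k t * h t - g t * h t) < a) sequentially"
    proof eventually_elim
      case (elim k)
      have "pmass 1 (\<lambda>t. f k t * h t - g t * h t) \<le>
          ennreal (l powr p) * pmass p (\<lambda>t. f k t - g t) + ennreal (l powr (- q)) * pmass q h"
        using pmass_mult_Young[OF fm Lp_periodic_measurable[OF h] pq l(1)] by (simp add: left_diff_distrib)
      also have "\<dots> \<le> ennreal (l powr p) * pmass p (\<lambda>t. f k t - g t) + ennreal (e / 2)"
        by (intro add_left_mono lb)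
      finally show ?case using elim by (rule le_less_trans)
    qed
  qed auto
qed (use f g h pq in \<open>auto intro: Lp_mult\<close>)

section \<open>Fourier series in \<open>L\<^sup>2\<close>\<close>

lemma integral_cis_circle: "(LINT t|circle. cis (of_int n * t)) = (if n = 0 then 2 * pi else 0)"
proof -
  have int: "integrable circle (\<lambda>t. cis (of_int n * t))"
    by (rule Lp_integrable[of _ 1, OF Lp_cis]) auto
  have eq: "(LINT t|circle. cis (of_int n * t)) = integral {0..2 * pi} (\<lambda>t. cis (of_int n * t))"
    by (rule lebesgue_integral_eq_integral[OF int]) simp
  show ?thesis
  proof (cases "n = 0")
    case True
    then show ?thesis unfolding eq by (simp add: scaleR_conv_of_real)
  next
    case False
    define G where "G = (\<lambda>t::real. exp (\<i> * of_int n * of_real t) / (\<i> * of_int n))"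
    have "((\<lambda>t. cis (of_int n * t)) has_integral (G (2 * pi) - G 0)) {0..2 * pi}"
    proof (rule fundamental_theorem_of_calculus)
      fix t :: real
      have "((\<lambda>z. exp (\<i> * of_int n * z) / (\<i> * of_int n)) has_field_derivative
          exp (\<i> * of_int n * of_real t)) (at (of_real t))"
        using False by (auto intro!: derivative_eq_intros)
      from has_vector_derivative_real_field[OF this]
      show "(G has_vector_derivative cis (of_int n * t)) (at t within {0..2 * pi})"
        by (simp add: G_def cis_conv_exp mult.assoc)
    qed simp
    moreover have "G (2 * pi) = G 0"
    proof -
      have "exp (\<i> * of_int n * of_real (2 * pi)) = cis (2 * pi * of_int n)"
        by (simp add: cis_conv_exp mult_ac)
      then show ?thesis by (simp add: G_def)
    qed
    ultimately show ?thesis unfolding eq using False by (simp add: integral_unique)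
  qed
qed

definition trig_sum :: "int set \<Rightarrow> (int \<Rightarrow> complex) \<Rightarrow> real \<Rightarrow> complex" where
  "trig_sum F a t = (\<Sum>n\<in>F. a n * cis (of_int n * t))"

lemma Lp_trig_sum: "finite F \<Longrightarrow> 0 \<le> p \<Longrightarrow> trig_sum F a \<in> Lp p"
  unfolding trig_sum_def[abs_def] by (intro Lp_sum Lp_cmult Lp_cis)

lemma trig_sum_periodic_measurable: "finite F \<Longrightarrow> trig_sum F a \<in> periodic_measurable"
  using Lp_trig_sum[of F 1] by (auto simp: Lp_iff)

lemma Lp_mult_cis:
  assumes "f \<in> Lp p"
  shows "(\<lambda>t. f t * cis (of_int n * t)) \<in> Lp p"
  using assms by (auto simp: Lp_iff periodic_measurable_mult periodic_measurable_cis pmass_def norm_mult)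

text \<open>
The pairing is bilinear, without conjugation, so the coefficient at \<open>n\<close> meets the Fourier coefficient
at \<open>- n\<close>.
\<close>

lemma pairing_trig_sum:
  assumes "f \<in> Lp 1" "finite F"
  shows "(LINT t|circle. f t * trig_sum F a t) = 2 * pi * (\<Sum>n\<in>F. a n * fourier_coeff f (- n))"
proof -
  have "(LINT t|circle. f t * trig_sum F a t) = (LINT t|circle. (\<Sum>n\<in>F. a n * (f t * cis (of_int n * t))))"
    by (simp add: trig_sum_def sum_distrib_left mult_ac)
  also have "\<dots> = (\<Sum>n\<in>F. LINT t|circle. a n * (f t * cis (of_int n * t)))"
    by (intro Bochner_Integration.integral_sum integrable_mult_right Lp_1_integrable Lp_mult_cis assms)
  also have "\<dots> = (\<Sum>n\<in>F. a n * (2 * pi * fourier_coeff f (- n)))"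
    by (simp add: fourier_coeff_circle)
  finally show ?thesis by (simp add: sum_distrib_left mult_ac)
qed

lemma cnj_trig_sum: "cnj (trig_sum F a t) = trig_sum (uminus ` F) (\<lambda>n. cnj (a (- n))) t"
  unfolding trig_sum_def by (simp add: sum.reindex cis_cnj flip: cis_cnj)

lemma fourier_coeff_trig_sum:
  assumes "finite F"
  shows "fourier_coeff (trig_sum F a) m = (if m \<in> F then a m else 0)"
proof -
  have "fourier_coeff (trig_sum F a) m
      = 1 / (2 * pi) * (LINT t|circle. cis (of_int (- m) * t) * trig_sum F a t)"
    unfolding fourier_coeff_circle by (simp add: mult.commute)
  also have "\<dots> = (\<Sum>n\<in>F. a n * fourier_coeff (\<lambda>t. cis (of_int (- m) * t)) (- n))"
    using Lp_cis[of 1 "- m"] by (subst pairing_trig_sum) (simp_all add: assms)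
  also have "\<dots> = (\<Sum>n\<in>F. a n * (if n = m then 1 else 0))"
  proof (rule sum.cong)
    fix n
    have "fourier_coeff (\<lambda>t. cis (of_int (- m) * t)) (- n)
        = 1 / (2 * pi) * (LINT t|circle. cis (of_int (n - m) * t))"
      unfolding fourier_coeff_circle by (simp add: cis_mult algebra_simps)
    then show "a n * fourier_coeff (\<lambda>t. cis (of_int (- m) * t)) (- n) = a n * (if n = m then 1 else 0)"
      by (simp only: integral_cis_circle) simp
  qed simp
  finally show ?thesis using assms by (simp add: if_distrib sum.delta cong: if_cong)
qed

lemma mult_cnj_norm: "z * cnj z = of_real ((norm z)\<^sup>2)" "cnj z * z = of_real ((norm z)\<^sup>2)"
  using complex_norm_square[of z] by (simp_all add: mult.commute)

lemma Lp_cnj: "f \<in> Lp p \<Longrightarrow> (\<lambda>t. cnj (f t)) \<in> Lp p"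
  using periodic_measurable_comp[of f cnj]
  by (simp add: Lp_iff pmass_def borel_measurable_continuous_onI continuous_on_cnj)

lemma Lp_2_mult: "f \<in> Lp 2 \<Longrightarrow> g \<in> Lp 2 \<Longrightarrow> (\<lambda>t. f t * g t) \<in> Lp 1"
  by (rule Lp_mult[where p=2 and q=2]) auto

lemma pmass_2_eq_integral:
  assumes "f \<in> Lp 2"
  shows "pmass 2 f = ennreal (Re (LINT t|circle. f t * cnj (f t)))"
proof -
  have int: "integrable circle (\<lambda>t. f t * cnj (f t))"
    by (intro Lp_1_integrable Lp_2_mult Lp_cnj assms)
  have eq: "norm (f t) powr 2 = Re (f t * cnj (f t))" for t
    by (simp add: mult_cnj_norm powr_numeral del: of_real_power)
  have "pmass 2 f = ennreal (LINT t|circle. Re (f t * cnj (f t)))"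
    unfolding pmass_def eq
    by (intro nn_integral_eq_integral integrable_Re int) (simp flip: eq)
  then show ?thesis unfolding integral_Re[OF int] .
qed

lemma pairing_cnj_trig_sum:
  assumes "f \<in> Lp 1" "finite F"
  shows "(LINT t|circle. f t * cnj (trig_sum F a t)) = 2 * pi * (\<Sum>n\<in>F. cnj (a n) * fourier_coeff f n)"
  unfolding cnj_trig_sum using assms by (subst pairing_trig_sum) (simp_all add: sum.reindex)

lemma pmass_2_trig_sum:
  assumes "finite F"
  shows "pmass 2 (trig_sum F a) = ennreal (2 * pi * (\<Sum>n\<in>F. (norm (a n))\<^sup>2))"
proof -
  have "(\<Sum>n\<in>F. cnj (a n) * fourier_coeff (trig_sum F a) n) = (\<Sum>n\<in>F. of_real ((norm (a n))\<^sup>2))"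
    by (rule sum.cong) (use assms in \<open>simp_all add: fourier_coeff_trig_sum mult_cnj_norm\<close>)
  then have "(LINT t|circle. trig_sum F a t * cnj (trig_sum F a t))
      = of_real (2 * pi * (\<Sum>n\<in>F. (norm (a n))\<^sup>2))"
    using assms by (subst pairing_cnj_trig_sum) (simp_all add: Lp_trig_sum)
  then show ?thesis using assms by (subst pmass_2_eq_integral) (simp_all add: Lp_trig_sum)
qed

text \<open>
Expand the square integral of \<open>f - s\<close>, where \<open>s\<close> is the Fourier sum over \<open>F\<close>: both mixed terms and the
square of \<open>s\<close> are equal to \<open>X\<close>, so the total is the square integral of \<open>f\<close> minus \<open>X\<close>.
\<close>

lemma Bessel_inequality:
  assumes f: "f \<in> Lp 2" and F: "finite F"
  shows "ennreal (2 * pi * (\<Sum>n\<in>F. (norm (fourier_coeff f n))\<^sup>2)) \<le> pmass 2 f"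
proof -
  define s where "s = trig_sum F (fourier_coeff f)"
  define X where "X = 2 * pi * (\<Sum>n\<in>F. (norm (fourier_coeff f n))\<^sup>2)"
  have s: "s \<in> Lp 2" unfolding s_def using F by (simp add: Lp_trig_sum)
  have f1: "f \<in> Lp 1" using Lp_lower_exponent[OF f] by simp
  have X1: "(LINT t|circle. f t * cnj (s t)) = of_real X"
    unfolding s_def X_def using f1 F
    by (subst pairing_cnj_trig_sum) (simp_all add: mult_cnj_norm)
  have X2: "(LINT t|circle. s t * cnj (f t)) = of_real X"
  proof -
    have "(LINT t|circle. s t * cnj (f t)) = (LINT t|circle. cnj (f t * cnj (s t)))"
      by (simp add: mult.commute)
    also have "\<dots> = cnj (LINT t|circle. f t * cnj (s t))"
      by (rule Bochner_Integration.integral_cnj)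
    finally show ?thesis by (simp add: X1)
  qed
  have X3: "(LINT t|circle. s t * cnj (s t)) = of_real X"
    unfolding s_def X_def using F
    by (subst pairing_cnj_trig_sum)
       (simp_all add: Lp_trig_sum fourier_coeff_trig_sum mult_cnj_norm)
  have "(LINT t|circle. (f t - s t) * cnj (f t - s t)) =
      (LINT t|circle. (f t * cnj (f t) - f t * cnj (s t)) - (s t * cnj (f t) - s t * cnj (s t)))"
    by (simp add: algebra_simps)
  also have "\<dots> = (LINT t|circle. f t * cnj (f t)) - of_real X"
    by (simp add: X1 X2 X3 Lp_1_integrable Lp_2_mult Lp_cnj f s)
  finally have eq: "Re (LINT t|circle. (f t - s t) * cnj (f t - s t)) = Re (LINT t|circle. f t * cnj (f t)) - X"
    by simp
  have "0 \<le> Re (LINT t|circle. (f t - s t) * cnj (f t - s t))"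
  proof -
    have "0 \<le> (LINT t|circle. Re ((f t - s t) * cnj (f t - s t)))"
      by (rule integral_nonneg_AE) (simp add: mult_cnj_norm del: complex_cnj_diff of_real_power)
    moreover have "integrable circle (\<lambda>t. (f t - s t) * cnj (f t - s t))"
      using f s by (intro Lp_1_integrable Lp_2_mult Lp_cnj Lp_diff) auto
    ultimately show ?thesis by (simp only: integral_Re)
  qed
  then show ?thesis
    unfolding pmass_2_eq_integral[OF f] X_def[symmetric] using eq by (intro ennreal_leI) linarith
qed

lemma Lp_norm_tendsto_0_iff:
  assumes h: "\<And>x. h x \<in> Lp p" and p: "0 < p"
  shows "((\<lambda>x. Lp_norm p (h x)) \<longlongrightarrow> 0) F \<longleftrightarrow> ((\<lambda>x. pmass p (h x)) \<longlongrightarrow> 0) F"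
proof -
  define m where "m = (\<lambda>x. enn2real (pmass p (h x)))"
  have m: "pmass p (h x) = ennreal (m x)" "0 \<le> m x" for x
    using Lp_pmass_finite[OF h] by (auto simp: m_def less_top)
  have N: "Lp_norm p (h x) = (m x / (2 * pi)) powr (1 / p)" for x
    using Lp_norm_eq[OF Lp_periodic_measurable[OF h]] by (simp add: m_def)
  have "((\<lambda>x. pmass p (h x)) \<longlongrightarrow> 0) F \<longleftrightarrow> (m \<longlongrightarrow> 0) F"
    unfolding m(1) using tendsto_ennreal_iff[of m F 0] m(2) by simp
  also have "\<dots> \<longleftrightarrow> ((\<lambda>x. Lp_norm p (h x)) \<longlongrightarrow> 0) F"
  proof
    assume "(m \<longlongrightarrow> 0) F"
    then have "((\<lambda>x. (m x / (2 * pi)) powr (1 / p)) \<longlongrightarrow> (0 / (2 * pi)) powr (1 / p)) F"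
      using p m(2) by (intro tendsto_powr' tendsto_intros) auto
    then show "((\<lambda>x. Lp_norm p (h x)) \<longlongrightarrow> 0) F" by (simp add: N)
  next
    assume "((\<lambda>x. Lp_norm p (h x)) \<longlongrightarrow> 0) F"
    then have "((\<lambda>x. 2 * pi * Lp_norm p (h x) powr p) \<longlongrightarrow> 2 * pi * 0 powr p) F"
      using p by (intro tendsto_powr' tendsto_intros) (auto simp: N)
    then show "(m \<longlongrightarrow> 0) F" using p m(2) by (simp add: N powr_powr)
  qed
  finally show ?thesis by simp
qed

lemma filterlim_symmetric_intervals:
  "filterlim (\<lambda>N. {- int N..int N}) (finite_subsets_at_top UNIV) sequentially"
proof (subst filterlim_finite_subsets_at_top, intro allI impI)
  fix X :: "int set" assume X: "finite X \<and> X \<subseteq> UNIV"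
  define M where "M = nat (Max (insert 0 (abs ` X)))"
  have M: "\<bar>x\<bar> \<le> int M" if "x \<in> X" for x
    using that X by (auto simp: M_def intro!: Max_ge)
  show "eventually (\<lambda>N. finite {- int N..int N} \<and> X \<subseteq> {- int N..int N} \<and> {- int N..int N} \<subseteq> UNIV) sequentially"
    using eventually_ge_at_top[of M]
    by eventually_elim (use M in fastforce)
qed

text \<open>
The common terms cancel, and on the symmetric difference the signs are invisible to the norm. This
makes the net of all finite partial sums Cauchy as soon as the squares are summable.
\<close>

lemma trig_sum_diff:
  assumes "finite F" "finite G"
  shows "pmass 2 (\<lambda>t. trig_sum F a t - trig_sum G a t)
    = ennreal (2 * pi * (\<Sum>n\<in>(F - G) \<union> (G - F). (norm (a n))\<^sup>2))"
proof -
  define b where "b = (\<lambda>n. if n \<in> F then a n else - a n)"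
  have "trig_sum F a t - trig_sum G a t = trig_sum ((F - G) \<union> (G - F)) b t" for t
  proof -
    let ?u = "\<lambda>n. a n * cis (of_int n * t)"
    have "sum ?u F = sum ?u (F - G) + sum ?u (F \<inter> G)" "sum ?u G = sum ?u (G - F) + sum ?u (F \<inter> G)"
      using assms sum.Int_Diff[of F ?u G] sum.Int_Diff[of G ?u F] by (simp_all add: Int_commute add.commute)
    moreover have "trig_sum ((F - G) \<union> (G - F)) b t = sum ?u (F - G) + (\<Sum>n\<in>G - F. - ?u n)"
      unfolding trig_sum_def b_def using assms
      by (subst sum.union_disjoint) (auto intro!: arg_cong2[where f="(+)"] sum.cong)
    ultimately show ?thesis by (simp add: trig_sum_def sum_negf)
  qed
  then have "pmass 2 (\<lambda>t. trig_sum F a t - trig_sum G a t) = pmass 2 (trig_sum ((F - G) \<union> (G - F)) b)"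
    by simp
  also have "\<dots> = ennreal (2 * pi * (\<Sum>n\<in>(F - G) \<union> (G - F). (norm (b n))\<^sup>2))"
    using assms by (intro pmass_2_trig_sum) simp
  also have "(\<Sum>n\<in>(F - G) \<union> (G - F). (norm (b n))\<^sup>2) = (\<Sum>n\<in>(F - G) \<union> (G - F). (norm (a n))\<^sup>2)"
    by (rule sum.cong) (auto simp: b_def)
  finally show ?thesis .
qed

lemma square_summable_tail:
  fixes a :: "int \<Rightarrow> complex"
  assumes B: "\<And>F. finite F \<Longrightarrow> (\<Sum>n\<in>F. (norm (a n))\<^sup>2) \<le> B" and e: "0 < e"
  shows "\<exists>F0. finite F0 \<and> (\<forall>G. finite G \<longrightarrow> G \<inter> F0 = {} \<longrightarrow> (\<Sum>n\<in>G. (norm (a n))\<^sup>2) \<le> e)"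
proof -
  let ?S = "(\<lambda>F. \<Sum>n\<in>F. (norm (a n))\<^sup>2) ` {F. finite F}"
  have bdd: "bdd_above ?S" using B by (auto intro!: bdd_aboveI[of _ B])
  have "Sup ?S - e < Sup ?S" using e by simp
  then obtain F0 where F0: "finite F0" "Sup ?S - e < (\<Sum>n\<in>F0. (norm (a n))\<^sup>2)"
    by (subst (asm) less_cSup_iff[OF _ bdd]) auto
  have "(\<Sum>n\<in>G. (norm (a n))\<^sup>2) \<le> e" if "finite G" "G \<inter> F0 = {}" for G
  proof -
    have "(\<Sum>n\<in>G \<union> F0. (norm (a n))\<^sup>2) \<le> Sup ?S"
      by (rule cSup_upper[OF _ bdd]) (use that F0 in auto)
    then show ?thesis using F0 that by (simp add: sum.union_disjoint)
  qed
  with F0(1) show ?thesis by blast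
qed

lemma has_sum_L2_iff_pmass:
  "has_sum_L2 u g \<longleftrightarrow> (\<forall>n. u n \<in> Lp 2) \<and> g \<in> Lp 2 \<and>
     ((\<lambda>F. pmass 2 (\<lambda>t. (\<Sum>n\<in>F. u n t) - g t)) \<longlongrightarrow> 0) (finite_subsets_at_top UNIV)"
proof (cases "(\<forall>n. u n \<in> Lp 2) \<and> g \<in> Lp 2")
  case True
  have "(\<lambda>t. (\<Sum>n\<in>F. u n t) - g t) \<in> Lp 2" for F
  proof (cases "finite F")
    case fin: True
    show ?thesis using True fin by (intro Lp_diff Lp_sum) auto
  next
    case False
    then show ?thesis using True Lp_diff[OF Lp_const[of 2 0], of g] by simp
  qed
  from Lp_norm_tendsto_0_iff[OF this] show ?thesis using True by (simp add: has_sum_L2_def)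
qed (auto simp: has_sum_L2_def)

text \<open>
Completeness gives the limit along the symmetric intervals. Any finite set of frequencies containing
a large interval has almost the same partial sum as that interval, so the whole net converges to
this limit.
\<close>

lemma Riesz_Fischer:
  assumes B: "\<And>F. finite F \<Longrightarrow> (\<Sum>n\<in>F. (norm (a n))\<^sup>2) \<le> B"
  obtains g where "has_sum_L2 (\<lambda>n t. a n * cis (of_int n * t)) g"
proof -
  define S where "S = (\<lambda>N::nat. trig_sum {- int N..int N} a)"
  have S: "S N \<in> Lp 2" for N unfolding S_def by (simp add: Lp_trig_sum)
  have tail: "\<exists>N. \<forall>G. finite G \<longrightarrow> G \<inter> {- int N..int N} = {} \<longrightarrow> (\<Sum>n\<in>G. (norm (a n))\<^sup>2) \<le> e"
    if "0 < e" for e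
  proof -
    obtain F0 where F0: "finite F0" "\<And>G. finite G \<Longrightarrow> G \<inter> F0 = {} \<Longrightarrow> (\<Sum>n\<in>G. (norm (a n))\<^sup>2) \<le> e"
      using square_summable_tail[OF B \<open>0 < e\<close>] by blast
    have "eventually (\<lambda>N. F0 \<subseteq> {- int N..int N}) sequentially"
      using filterlim_symmetric_intervals F0(1) by (auto simp: filterlim_finite_subsets_at_top)
    then obtain N where "F0 \<subseteq> {- int N..int N}" by (auto simp: eventually_sequentially)
    then show ?thesis using F0(2) by blast
  qed
  have tail': "\<exists>N. \<forall>F G. finite F \<longrightarrow> finite G \<longrightarrow> {- int N..int N} \<subseteq> F \<longrightarrow> {- int N..int N} \<subseteq> G \<longrightarrow>
      pmass 2 (\<lambda>t. trig_sum F a t - trig_sum G a t) \<le> ennreal e" if e: "0 < e" for e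
  proof -
    obtain N where N: "\<And>G. finite G \<Longrightarrow> G \<inter> {- int N..int N} = {} \<Longrightarrow> (\<Sum>n\<in>G. (norm (a n))\<^sup>2) \<le> e / (2 * pi)"
      using tail[of "e / (2 * pi)"] e by auto
    have "pmass 2 (\<lambda>t. trig_sum F a t - trig_sum G a t) \<le> ennreal e"
      if "finite F" "finite G" "{- int N..int N} \<subseteq> F" "{- int N..int N} \<subseteq> G" for F G
      unfolding trig_sum_diff[OF that(1,2)]
    proof (rule ennreal_leI)
      have "(\<Sum>n\<in>(F - G) \<union> (G - F). (norm (a n))\<^sup>2) \<le> e / (2 * pi)"
        by (rule N) (use that in auto)
      then show "2 * pi * (\<Sum>n\<in>(F - G) \<union> (G - F). (norm (a n))\<^sup>2) \<le> e"
        by (simp add: field_simps)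
    qed
    then show ?thesis by blast
  qed
  have Cauchy: "\<exists>N. \<forall>m\<ge>N. \<forall>n\<ge>N. pmass 2 (\<lambda>t. S m t - S n t) \<le> ennreal e" if e: "0 < e" for e
  proof -
    obtain N where N: "\<And>F G. finite F \<Longrightarrow> finite G \<Longrightarrow> {- int N..int N} \<subseteq> F \<Longrightarrow> {- int N..int N} \<subseteq> G \<Longrightarrow>
      pmass 2 (\<lambda>t. trig_sum F a t - trig_sum G a t) \<le> ennreal e" using tail'[OF e] by blast
    show ?thesis unfolding S_def by (intro exI[of _ N] allI impI N) auto
  qed
  obtain g where g: "g \<in> Lp 2" "(\<lambda>N. pmass 2 (\<lambda>t. S N t - g t)) \<longlonglongrightarrow> 0"
    by (rule Lp_complete[OF S _ Cauchy]) auto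
  have "((\<lambda>F. pmass 2 (\<lambda>t. (\<Sum>n\<in>F. a n * cis (of_int n * t)) - g t)) \<longlongrightarrow> 0) (finite_subsets_at_top UNIV)"
  proof (rule order_tendstoI)
    fix c :: ennreal assume "0 < c"
    then obtain e where e: "0 < e" "ennreal e < c" by (rule ennreal_pos_lower)
    have "0 < e / 8" using e by simp
    from tail'[OF this] obtain N where N: "\<And>F G. finite F \<Longrightarrow> finite G \<Longrightarrow> {- int N..int N} \<subseteq> F \<Longrightarrow>
      {- int N..int N} \<subseteq> G \<Longrightarrow> pmass 2 (\<lambda>t. trig_sum F a t - trig_sum G a t) \<le> ennreal (e / 8)"
      by blast
    have "eventually (\<lambda>M. pmass 2 (\<lambda>t. S M t - g t) < ennreal (e / 8)) sequentially"
      using g(2) by (rule order_tendstoD(2)) (use e in simp)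
    with eventually_ge_at_top[of N]
    have "eventually (\<lambda>M. N \<le> M \<and> pmass 2 (\<lambda>t. S M t - g t) < ennreal (e / 8)) sequentially"
      by (rule eventually_conj)
    then obtain M where M: "N \<le> M" "pmass 2 (\<lambda>t. S M t - g t) < ennreal (e / 8)"
      using eventually_happens' sequentially_bot by blast
    have "eventually (\<lambda>F. finite F \<and> {- int M..int M} \<subseteq> F \<and> F \<subseteq> UNIV) (finite_subsets_at_top UNIV)"
      unfolding eventually_finite_subsets_at_top by (intro exI[of _ "{- int M..int M}"]) simp
    then show "eventually (\<lambda>F. pmass 2 (\<lambda>t. (\<Sum>n\<in>F. a n * cis (of_int n * t)) - g t) < c)
        (finite_subsets_at_top UNIV)"
    proof eventually_elim
      case (elim F)
      have "pmass 2 (\<lambda>t. trig_sum F a t - g t) \<le> ennreal (2 powr 2) *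
          (pmass 2 (\<lambda>t. trig_sum F a t - S M t) + pmass 2 (\<lambda>t. S M t - g t))"
        using elim by (intro pmass_diff_triangle) (simp_all add: trig_sum_periodic_measurable S g Lp_periodic_measurable[of _ 2])
      also have "\<dots> \<le> ennreal (2 powr 2) * (ennreal (e / 8) + ennreal (e / 8))"
      proof (intro mult_left_mono add_mono)
        show "pmass 2 (\<lambda>t. trig_sum F a t - S M t) \<le> ennreal (e / 8)"
          unfolding S_def using elim M(1) by (intro N) auto
      qed (use M(2) in auto)
      also have "\<dots> = ennreal e"
        using e by (simp del: ennreal_plus add: ennreal_plus[symmetric] ennreal_mult[symmetric] flip: ennreal_numeral)
      finally show ?case using e(2) unfolding trig_sum_def[abs_def] by (rule le_less_trans)
    qed
  qed auto
  moreover have "(\<lambda>t. a n * cis (of_int n * t)) \<in> Lp 2" for n by (intro Lp_cmult Lp_cis) simp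
  ultimately have "has_sum_L2 (\<lambda>n t. a n * cis (of_int n * t)) g"
    using g(1) by (simp add: has_sum_L2_iff_pmass)
  then show ?thesis using that by blast
qed

section \<open>Analytic functions with positive real part\<close>

text \<open>
By homogeneity put \<open>z = cis \<theta>\<close> with \<open>\<bar>\<theta>\<bar> < pi / 2\<close>. Since \<open>1 < p \<le> 2\<close>, the angle \<open>p * \<theta>\<close> lies between
\<open>pi / 2\<close> and \<open>pi\<close> in absolute value when \<open>\<theta>\<close> is close to \<open>\<plusminus> pi / 2\<close>, so there \<open>- cos (p * \<theta>)\<close> is bounded
below and a multiple of it dominates the left-hand side. Elsewhere \<open>cos \<theta>\<close> is bounded below, and \<open>A\<close>
pays for everything, including the wrong sign of the other term.
\<close>

lemma sector_inequality:
  fixes p :: real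
  assumes p: "1 < p" "p \<le> 2"
  obtains A B :: real where "0 \<le> A" "0 \<le> B"
    "\<And>z. 0 < Re z \<Longrightarrow> \<bar>Im z\<bar> powr p \<le> A * Re z powr p - B * Re (z powr of_real p)"
proof -
  \<comment> \<open>any angle strictly between \<open>pi / (2 * p)\<close> and \<open>pi / 2\<close> separates the two regimes\<close>
  define \<gamma> where "\<gamma> = (pi / (2 * p) + pi / 2) / 2"
  have \<gamma>: "0 < \<gamma>" "\<gamma> < pi / 2" "pi / 2 < p * \<gamma>" "p * \<gamma> \<le> pi"
  proof -
    have "pi / (2 * p) < pi / 2" using p by (simp add: field_simps)
    then show "\<gamma> < pi / 2" by (simp add: \<gamma>_def)
    show "0 < \<gamma>" using p by (simp add: \<gamma>_def add_pos_pos)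
    define x where "x = p * pi"
    have "p * \<gamma> = pi / 4 + x / 4" using p by (simp add: \<gamma>_def x_def field_simps)
    moreover have "pi < x" "x \<le> 2 * pi" using p by (simp_all add: x_def)
    ultimately show "pi / 2 < p * \<gamma>" "p * \<gamma> \<le> pi" using pi_gt_zero by simp_all
  qed
  have c: "cos (p * \<gamma>) < 0" using \<gamma> cos_monotone_0_pi[of "pi / 2" "p * \<gamma>"] by auto
  have cg: "0 < cos \<gamma>" using \<gamma> by (intro cos_gt_zero) auto
  define B where "B = - 1 / cos (p * \<gamma>)"
  define A where "A = (1 + B) / cos \<gamma> powr p"
  have B: "0 < B" using c by (simp add: B_def divide_neg_neg)
  have A: "0 < A" using B cg by (simp add: A_def)
  have unit: "\<bar>sin \<theta>\<bar> powr p \<le> A * cos \<theta> powr p - B * cos (p * \<theta>)" if \<theta>: "\<bar>\<theta>\<bar> < pi / 2" for \<theta>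
  proof -
    have s1: "\<bar>sin \<theta>\<bar> powr p \<le> 1" using p by (intro powr_le1) auto
    show ?thesis
    proof (cases "\<gamma> \<le> \<bar>\<theta>\<bar>")
      case True
      have "p * \<bar>\<theta>\<bar> \<le> p * (pi / 2)" using p \<theta> by (intro mult_left_mono) auto
      also have "\<dots> \<le> pi" using p by simp
      finally have "cos (p * \<bar>\<theta>\<bar>) \<le> cos (p * \<gamma>)"
        using True p \<gamma> by (intro cos_monotone_0_pi_le mult_left_mono) auto
      then have "cos (p * \<theta>) \<le> cos (p * \<gamma>)" by (simp add: abs_if split: if_splits)
      then have "B * cos (p * \<theta>) \<le> B * cos (p * \<gamma>)" using B by simp
      also have "\<dots> = - 1" using c by (simp add: B_def)
      finally have "1 \<le> - B * cos (p * \<theta>)" by simp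
      moreover have "0 \<le> A * cos \<theta> powr p" using A by simp
      ultimately show ?thesis using s1 by linarith
    next
      case False
      have "cos \<gamma> \<le> cos \<bar>\<theta>\<bar>" using False \<gamma> by (intro cos_monotone_0_pi_le) auto
      then have "cos \<gamma> powr p \<le> cos \<theta> powr p" using cg p by (intro powr_mono2) auto
      then have "A * cos \<gamma> powr p \<le> A * cos \<theta> powr p" using A by simp
      moreover have "A * cos \<gamma> powr p = 1 + B" using cg by (simp add: A_def)
      moreover have "B * cos (p * \<theta>) \<le> B" using B by simp
      ultimately show ?thesis using s1 by linarith
    qed
  qed
  show ?thesis
  proof (rule that)
    show "0 \<le> A" "0 \<le> B" using A B by auto
    fix z :: complex assume z: "0 < Re z"
    define \<theta> where "\<theta> = Im (Ln z)"
    define \<rho> where "\<rho> = exp (Re (Ln z))"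
    have z0: "z \<noteq> 0" using z by auto
    have \<theta>: "\<bar>\<theta>\<bar> < pi / 2" using Re_Ln_pos_lt[OF z0] z by (simp add: \<theta>_def)
    have "Re z = \<rho> * cos \<theta>" "Im z = \<rho> * sin \<theta>"
      using exp_Ln[OF z0] Re_exp[of "Ln z"] Im_exp[of "Ln z"] by (simp_all add: \<rho>_def \<theta>_def)
    moreover have "Re (z powr of_real p) = \<rho> powr p * cos (p * \<theta>)"
      using z0 by (simp add: powr_def Re_exp \<rho>_def \<theta>_def)
    moreover have "0 < cos \<theta>" using \<theta> by (intro cos_gt_zero_pi) auto
    moreover have "0 < \<rho>" by (simp add: \<rho>_def)
    moreover have "\<rho> powr p * \<bar>sin \<theta>\<bar> powr p \<le> \<rho> powr p * (A * cos \<theta> powr p - B * cos (p * \<theta>))"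
      by (intro mult_left_mono unit \<theta>) auto
    ultimately show "\<bar>Im z\<bar> powr p \<le> A * Re z powr p - B * Re (z powr of_real p)"
      by (simp add: abs_mult powr_mult algebra_simps)
  qed
qed

text \<open>
The minimum principle for the harmonic function \<open>Re F\<close>, as the maximum principle for \<open>- F\<close>.
\<close>

lemma Re_ge_on_disc:
  fixes F :: "complex \<Rightarrow> complex"
  assumes F: "F holomorphic_on UNIV" and bd: "\<And>t. \<delta> \<le> Re (F (cis t))" and z: "norm z \<le> 1"
  shows "\<delta> \<le> Re (F z)"
proof -
  have "Re (- F z) \<le> - \<delta>"
  proof (rule maximum_real_frontier[where S="cball 0 1" and f="\<lambda>z. - F z"])
    show "(\<lambda>z. - F z) holomorphic_on interior (cball 0 1)"
      using F by (auto intro!: holomorphic_intros intro: holomorphic_on_subset)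
    show "continuous_on (closure (cball 0 1)) (\<lambda>z. - F z)"
      using holomorphic_on_imp_continuous_on[OF F] by (auto intro!: continuous_intros intro: continuous_on_subset)
    fix w :: complex assume "w \<in> frontier (cball 0 1)"
    then have "norm w = 1" by simp
    then obtain t where "w = cis t" by (metis cis_Arg norm_eq_zero sgn_eq div_by_1 of_real_1 zero_neq_one)
    then show "Re (- F w) \<le> - \<delta>" using bd[of t] by simp
  qed (use z in auto)
  then show ?thesis by simp
qed

text \<open>
In the closed disc \<open>F\<close> has positive real part and so avoids the branch cut; hence \<open>F powr p\<close> is analytic and
has the mean value property.
\<close>

lemma integral_powr_circle:
  fixes F :: "complex \<Rightarrow> complex"
  assumes F: "F holomorphic_on UNIV" and bd: "\<And>t. \<delta> \<le> Re (F (cis t))" and \<delta>: "0 < \<delta>"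
  shows "((\<lambda>t. F (cis t) powr of_real p) has_integral 2 * pi * F 0 powr of_real p) {0..2 * pi}"
proof -
  define G where "G = (\<lambda>z. F z powr of_real p)"
  have Re_pos: "0 < Re (F z)" if "norm z \<le> 1" for z
    using Re_ge_on_disc[OF F bd that] \<delta> by linarith
  then have pos: "F z \<notin> \<real>\<^sub>\<le>\<^sub>0" "0 \<le> Re (F z)" "F z \<noteq> 0" if "norm z \<le> 1" for z
    using that by (fastforce simp: complex_nonpos_Reals_iff)+
  have hol: "G holomorphic_on ball 0 1"
    unfolding G_def using pos F
    by (intro holomorphic_on_powr holomorphic_intros) (auto intro: holomorphic_on_subset)
  have cont: "continuous_on (cball 0 1) G"
    unfolding G_def using pos holomorphic_on_imp_continuous_on[OF F]
    by (intro continuous_on_powr_complex continuous_intros) (auto intro: continuous_on_subset)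
  have "((\<lambda>u. G u / (u - 0)) has_contour_integral (2 * of_real pi * \<i> * G 0)) (circlepath 0 1)"
    by (rule Cauchy_integral_circlepath[OF cont hol]) simp
  then have "((\<lambda>t. G (cis t) / cis t * \<i> * cis t) has_integral (2 * of_real pi * \<i> * G 0)) {0..2 * pi}"
    unfolding circlepath_def by (subst (asm) has_contour_integral_part_circlepath_iff) auto
  from has_integral_mult_right[OF this, of "- \<i>"]
  show ?thesis by (simp add: G_def field_simps)
qed

lemma integrable_circle_continuous:
  fixes f :: "real \<Rightarrow> 'a :: euclidean_space"
  assumes "continuous_on UNIV f"
  shows "integrable circle f"
proof -
  have "f absolutely_integrable_on {0..2 * pi}"
    by (intro absolutely_integrable_continuous_real continuous_on_subset[OF assms]) auto
  then show ?thesis unfolding set_integrable_def by (subst integrable_restrict_space) auto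
qed

text \<open>
  M. Riesz's inequality for an analytic function with positive real part. Raising to the power
  \<open>p\<close> keeps analyticity, so the mean over the circle of \<open>F powr p\<close> is its value at the centre,
  a power of the positive real number \<open>F 0\<close>; integrating the sector inequality, this term can be
  dropped.
\<close>

lemma conjugate_inequality_positive:
  fixes p :: real
  assumes p: "1 < p" "p \<le> 2"
  obtains A where "0 \<le> A" and
    "\<And>F \<delta>. F holomorphic_on UNIV \<Longrightarrow> 0 < \<delta> \<Longrightarrow> (\<And>t. \<delta> \<le> Re (F (cis t))) \<Longrightarrow> Im (F 0) = 0 \<Longrightarrow>
      pmass p (\<lambda>t. of_real (Im (F (cis t)))) \<le> ennreal A * pmass p (\<lambda>t. of_real (Re (F (cis t))))"
proof -
  obtain A B :: real where AB: "0 \<le> A" "0 \<le> B"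
    "\<And>z. 0 < Re z \<Longrightarrow> \<bar>Im z\<bar> powr p \<le> A * Re z powr p - B * Re (z powr of_real p)"
    using sector_inequality[OF p] by blast
  show ?thesis
  proof (rule that[OF AB(1)])
    fix F :: "complex \<Rightarrow> complex" and \<delta> :: real
    assume F: "F holomorphic_on UNIV" and \<delta>: "0 < \<delta>" and bd: "\<And>t. \<delta> \<le> Re (F (cis t))"
      and F0: "Im (F 0) = 0"
    have cF: "continuous_on UNIV (\<lambda>t. F (cis t))"
      by (rule continuous_on_compose2[OF holomorphic_on_imp_continuous_on[OF F]])
         (auto intro!: continuous_intros)
    have pos: "0 < Re (F (cis t))" for t using bd[of t] \<delta> by linarith
    define U where "U = (\<lambda>t. Re (F (cis t)) powr p)"
    define V where "V = (\<lambda>t. \<bar>Im (F (cis t))\<bar> powr p)"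
    define G where "G = (\<lambda>t. F (cis t) powr of_real p)"
    have intU: "integrable circle U" unfolding U_def
      by (intro integrable_circle_continuous continuous_on_powr' continuous_intros cF) (use pos less_imp_le p in auto)
    have intV: "integrable circle V" unfolding V_def
      by (intro integrable_circle_continuous continuous_on_powr' continuous_intros cF) (use p in auto)
    have intG: "integrable circle G" unfolding G_def
      by (intro integrable_circle_continuous continuous_on_powr_complex continuous_intros cF)
         (use pos p in \<open>auto simp: less_imp_le complex_eq_iff\<close>)
    have "integral\<^sup>L circle G = integral {0..2 * pi} G"
      by (rule lebesgue_integral_eq_integral[OF intG]) simp
    also have "\<dots> = 2 * pi * F 0 powr of_real p"
      unfolding G_def by (rule integral_unique[OF integral_powr_circle[OF F bd \<delta>]])
    finally have G0: "integral\<^sup>L circle G = 2 * pi * F 0 powr of_real p" .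
    have "F 0 = of_real (Re (F 0))" using F0 by (simp add: complex_eq_iff)
    moreover have "0 \<le> Re (F 0)" using Re_ge_on_disc[OF F bd, of 0] \<delta> by simp
    ultimately have "F 0 powr of_real p = of_real (Re (F 0) powr p)"
      by (metis powr_of_real)
    then have G1: "0 \<le> Re (integral\<^sup>L circle G)" unfolding G0 by simp
    have "integral\<^sup>L circle V \<le> (LINT t|circle. A * U t - B * Re (G t))"
      using intU intV intG AB(3)[OF pos] unfolding U_def V_def G_def
      by (intro integral_mono) auto
    also have "\<dots> = A * integral\<^sup>L circle U - B * Re (integral\<^sup>L circle G)"
      using intU intG by (simp add: integral_Re[OF intG])
    also have "\<dots> \<le> A * integral\<^sup>L circle U"
      using G1 AB(2) by simp
    finally have le: "integral\<^sup>L circle V \<le> A * integral\<^sup>L circle U" .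
    have "pmass p (\<lambda>t. of_real (Im (F (cis t)))) = ennreal (integral\<^sup>L circle V)"
      unfolding pmass_def using nn_integral_eq_integral[OF intV] by (simp add: V_def)
    also have "\<dots> \<le> ennreal (A * integral\<^sup>L circle U)" using le by (rule ennreal_leI)
    also have "\<dots> = ennreal A * ennreal (integral\<^sup>L circle U)" using AB(1) by (simp add: ennreal_mult')
    also have "ennreal (integral\<^sup>L circle U) = pmass p (\<lambda>t. of_real (Re (F (cis t))))"
      unfolding pmass_def using nn_integral_eq_integral[OF intU] pos by (simp add: U_def less_imp_le)
    finally show "pmass p (\<lambda>t. of_real (Im (F (cis t)))) \<le> ennreal A * pmass p (\<lambda>t. of_real (Re (F (cis t))))" .
  qed
qed

section \<open>The Hilbert transform on \<open>L\<^sup>2\<close>\<close>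

abbreviation hilbert_mult :: "int \<Rightarrow> complex" where
  "hilbert_mult n \<equiv> - \<i> * of_int (sgn n)"

definition hilbert_partial :: "(real \<Rightarrow> complex) \<Rightarrow> nat \<Rightarrow> real \<Rightarrow> complex" where
  "hilbert_partial f N = trig_sum {- int N..int N} (\<lambda>n. hilbert_mult n * fourier_coeff f n)"

lemma norm_hilbert_mult_le: "norm (hilbert_mult n) \<le> 1"
  by (simp add: norm_mult sgn_if)

text \<open>
The multiplier has modulus at most 1, so by Bessel's inequality the coefficients of the conjugate
series are square summable and the choice in the definition picks an actual sum.
\<close>

lemma hilbert_L2_has_sum:
  assumes f: "f \<in> Lp 2"
  shows "has_sum_L2 (\<lambda>n t. hilbert_mult n * fourier_coeff f n * cis (of_int n * t)) (hilbert_L2 f)"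
proof -
  have le: "(\<Sum>n\<in>F. (norm (hilbert_mult n * fourier_coeff f n))\<^sup>2) \<le> enn2real (pmass 2 f) / (2 * pi)"
    if F: "finite F" for F
  proof -
    have "(\<Sum>n\<in>F. (norm (hilbert_mult n * fourier_coeff f n))\<^sup>2) \<le> (\<Sum>n\<in>F. (norm (fourier_coeff f n))\<^sup>2)"
    proof (intro sum_mono power_mono norm_ge_zero)
      fix n
      show "norm (hilbert_mult n * fourier_coeff f n) \<le> norm (fourier_coeff f n)"
        using norm_hilbert_mult_le[of n] unfolding norm_mult[of "hilbert_mult n"]
        by (rule mult_left_le_one_le[rotated 2]) simp_all
    qed
    also have "\<dots> \<le> enn2real (pmass 2 f) / (2 * pi)"
    proof -
      have "2 * pi * (\<Sum>n\<in>F. (norm (fourier_coeff f n))\<^sup>2) \<le> enn2real (pmass 2 f)"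
        using enn2real_mono[OF Bessel_inequality[OF f F]] Lp_pmass_finite[OF f]
        by (simp add: sum_nonneg)
      then show ?thesis by (simp add: field_simps)
    qed
    finally show ?thesis .
  qed
  obtain g where "has_sum_L2 (\<lambda>n t. hilbert_mult n * fourier_coeff f n * cis (of_int n * t)) g"
    using Riesz_Fischer[OF le] by blast
  then show ?thesis unfolding hilbert_L2_def
    by (rule someI[of "has_sum_L2 (\<lambda>n t. hilbert_mult n * fourier_coeff f n * cis (of_int n * t))"])
qed

lemma hilbert_L2_Lp: "f \<in> Lp 2 \<Longrightarrow> hilbert_L2 f \<in> Lp 2"
  using hilbert_L2_has_sum by (auto simp: has_sum_L2_def)

lemma hilbert_partial_Lp: "0 \<le> p \<Longrightarrow> hilbert_partial f N \<in> Lp p"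
  by (simp add: hilbert_partial_def Lp_trig_sum)

lemma hilbert_partial_periodic_measurable: "hilbert_partial f N \<in> periodic_measurable"
  using hilbert_partial_Lp[of 1] by (auto simp: Lp_iff)

lemma hilbert_partial_tendsto:
  assumes "f \<in> Lp 2"
  shows "(\<lambda>N. pmass 2 (\<lambda>t. hilbert_partial f N t - hilbert_L2 f t)) \<longlonglongrightarrow> 0"
proof -
  have "((\<lambda>F. pmass 2 (\<lambda>t. (\<Sum>n\<in>F. hilbert_mult n * fourier_coeff f n * cis (of_int n * t)) - hilbert_L2 f t))
      \<longlongrightarrow> 0) (finite_subsets_at_top UNIV)"
    using hilbert_L2_has_sum[OF assms] unfolding has_sum_L2_iff_pmass by blast
  from filterlim_compose[OF this filterlim_symmetric_intervals]
  show ?thesis by (simp add: hilbert_partial_def trig_sum_def)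
qed

lemma hilbert_L2_unique:
  assumes "f \<in> Lp 2" "g \<in> Lp 2" "(\<lambda>N. pmass 2 (\<lambda>t. hilbert_partial f N t - g t)) \<longlonglongrightarrow> 0"
  shows "hilbert_L2 f =\<^sub>a\<^sub>e g"
  by (rule pmass_limit_unique[OF hilbert_partial_tendsto assms(3)])
     (auto intro: assms hilbert_L2_Lp hilbert_partial_periodic_measurable Lp_periodic_measurable)

lemma fourier_coeff_hilbert_L2:
  assumes f: "f \<in> Lp 2"
  shows "fourier_coeff (hilbert_L2 f) n = hilbert_mult n * fourier_coeff f n"
proof -
  have "(\<lambda>N. fourier_coeff (hilbert_partial f N) n) \<longlonglongrightarrow> fourier_coeff (hilbert_L2 f) n"
    by (rule fourier_coeff_tendsto[of _ 2])
       (use f hilbert_partial_tendsto hilbert_L2_Lp hilbert_partial_Lp[of 2] in auto)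
  moreover have "eventually (\<lambda>N. fourier_coeff (hilbert_partial f N) n = hilbert_mult n * fourier_coeff f n) sequentially"
    using eventually_ge_at_top[of "nat \<bar>n\<bar>"]
  proof eventually_elim
    case (elim N)
    then have "n \<in> {- int N..int N}" by auto
    then show ?case by (simp add: hilbert_partial_def fourier_coeff_trig_sum)
  qed
  ultimately show ?thesis
    by (rule LIMSEQ_unique[OF _ tendsto_eventually])
qed

lemma fourier_coeff_add:
  assumes "f \<in> Lp 1" "g \<in> Lp 1"
  shows "fourier_coeff (\<lambda>t. f t + g t) n = fourier_coeff f n + fourier_coeff g n"
  using Lp_1_integrable[OF Lp_mult_cis[OF assms(1), of "- n"]]
    Lp_1_integrable[OF Lp_mult_cis[OF assms(2), of "- n"]]
  by (simp add: fourier_coeff_circle distrib_left distrib_right add_divide_distrib)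

lemma fourier_coeff_cmult: "fourier_coeff (\<lambda>t. c * f t) n = c * fourier_coeff f n"
  by (simp add: fourier_coeff_circle mult.assoc)

lemma pmass_tendsto_0_add:
  assumes f: "\<And>k. f k \<in> periodic_measurable" and g: "\<And>k. g k \<in> periodic_measurable"
    and p: "0 \<le> p" and lim: "(\<lambda>k. pmass p (f k)) \<longlonglongrightarrow> 0" "(\<lambda>k. pmass p (g k)) \<longlonglongrightarrow> 0"
  shows "(\<lambda>k. pmass p (\<lambda>t. f k t + g k t)) \<longlonglongrightarrow> 0"
proof (rule tendsto_sandwich[OF _ _ tendsto_const])
  show "eventually (\<lambda>k. pmass p (\<lambda>t. f k t + g k t) \<le> ennreal (2 powr p) * (pmass p (f k) + pmass p (g k))) sequentially"
    by (intro always_eventually allI pmass_add f g p)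
  have "(\<lambda>k. ennreal (2 powr p) * (pmass p (f k) + pmass p (g k))) \<longlonglongrightarrow> ennreal (2 powr p) * (0 + 0)"
    by (intro tendsto_intros lim) auto
  then show "(\<lambda>k. ennreal (2 powr p) * (pmass p (f k) + pmass p (g k))) \<longlonglongrightarrow> 0" by simp
qed simp

lemma pmass_tendsto_0_mult:
  assumes f: "\<And>k. f k \<in> periodic_measurable" and lim: "(\<lambda>k. pmass p (f k)) \<longlonglongrightarrow> 0"
  shows "(\<lambda>k. pmass p (\<lambda>t. c * f k t)) \<longlonglongrightarrow> 0"
proof -
  have "(\<lambda>k. ennreal (norm c powr p) * pmass p (f k)) \<longlonglongrightarrow> ennreal (norm c powr p) * 0"
    by (intro tendsto_intros lim) auto
  then show ?thesis by (simp add: pmass_mult f)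
qed

lemma hilbert_L2_add:
  assumes f: "f \<in> Lp 2" and g: "g \<in> Lp 2"
  shows "hilbert_L2 (\<lambda>t. f t + g t) =\<^sub>a\<^sub>e (\<lambda>t. hilbert_L2 f t + hilbert_L2 g t)"
proof (rule hilbert_L2_unique)
  have f1: "f \<in> Lp 1" "g \<in> Lp 1" using f g Lp_lower_exponent[of _ 2 1] by auto
  have "hilbert_partial (\<lambda>t. f t + g t) N t = hilbert_partial f N t + hilbert_partial g N t" for N t
    unfolding hilbert_partial_def trig_sum_def fourier_coeff_add[OF f1] sum.distrib[symmetric]
    by (rule sum.cong) (simp_all add: algebra_simps)
  then have eq: "hilbert_partial (\<lambda>t. f t + g t) N t - (hilbert_L2 f t + hilbert_L2 g t)
      = (hilbert_partial f N t - hilbert_L2 f t) + (hilbert_partial g N t - hilbert_L2 g t)" for N t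
    by simp
  show "(\<lambda>N. pmass 2 (\<lambda>t. hilbert_partial (\<lambda>t. f t + g t) N t - (hilbert_L2 f t + hilbert_L2 g t))) \<longlonglongrightarrow> 0"
    unfolding eq
    by (intro pmass_tendsto_0_add hilbert_partial_tendsto periodic_measurable_diff
        hilbert_partial_periodic_measurable Lp_periodic_measurable[OF hilbert_L2_Lp] f g) simp
qed (auto intro!: Lp_add hilbert_L2_Lp f g)

lemma hilbert_L2_cmult:
  assumes f: "f \<in> Lp 2"
  shows "hilbert_L2 (\<lambda>t. c * f t) =\<^sub>a\<^sub>e (\<lambda>t. c * hilbert_L2 f t)"
proof (rule hilbert_L2_unique)
  have eq: "hilbert_partial (\<lambda>t. c * f t) N t - (c * hilbert_L2 f t)
      = c * (hilbert_partial f N t - hilbert_L2 f t)" for N t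
    by (simp add: hilbert_partial_def trig_sum_def fourier_coeff_cmult right_diff_distrib sum_distrib_left mult_ac)
  show "(\<lambda>N. pmass 2 (\<lambda>t. hilbert_partial (\<lambda>t. c * f t) N t - (c * hilbert_L2 f t))) \<longlonglongrightarrow> 0"
    unfolding eq
    by (intro pmass_tendsto_0_mult hilbert_partial_tendsto f)
       (intro periodic_measurable_diff hilbert_partial_periodic_measurable Lp_periodic_measurable[OF hilbert_L2_Lp] f)
qed (auto intro!: Lp_cmult hilbert_L2_Lp f)

text \<open>
  The multiplier is odd, so in the bilinear pairing the Hilbert transform is antisymmetric. Both
  sides are limits of the finite sums \<open>\<Sum>n. m n * fourier_coeff f n * fourier_coeff g (- n)\<close>.
\<close>

lemma hilbert_L2_antisymmetric:
  assumes f: "f \<in> Lp 2" and g: "g \<in> Lp 2"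
  shows "(LINT t|circle. hilbert_L2 f t * g t) = - (LINT t|circle. f t * hilbert_L2 g t)"
proof -
  have lim: "(\<lambda>N. LINT t|circle. hilbert_partial f N t * g t) \<longlonglongrightarrow> (LINT t|circle. hilbert_L2 f t * g t)"
    if "f \<in> Lp 2" "g \<in> Lp 2" for f g
    by (rule pairing_tendsto[where p=2 and q=2])
       (use that in \<open>auto intro: hilbert_partial_Lp hilbert_L2_Lp hilbert_partial_tendsto\<close>)
  have val: "(LINT t|circle. hilbert_partial f N t * g t) =
      2 * pi * (\<Sum>n\<in>{- int N..int N}. hilbert_mult n * fourier_coeff f n * fourier_coeff g (- n))"
    if "g \<in> Lp 2" for f g N
    using pairing_trig_sum[of g "{- int N..int N}" "\<lambda>n. hilbert_mult n * fourier_coeff f n"]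
      Lp_lower_exponent[OF that, of 1] by (simp add: hilbert_partial_def mult.commute)
  have "(LINT t|circle. hilbert_partial f N t * g t) = - (LINT t|circle. hilbert_partial g N t * f t)" for N
  proof -
    have "(\<Sum>n\<in>{- int N..int N}. hilbert_mult n * fourier_coeff f n * fourier_coeff g (- n)) =
        (\<Sum>n\<in>{- int N..int N}. hilbert_mult (- n) * fourier_coeff f (- n) * fourier_coeff g (- (- n)))"
      by (rule sum.reindex_bij_witness[of _ uminus uminus]) auto
    also have "\<dots> = - (\<Sum>n\<in>{- int N..int N}. hilbert_mult n * fourier_coeff g n * fourier_coeff f (- n))"
      unfolding sum_negf[symmetric] by (rule sum.cong) (simp_all add: sgn_minus)
    finally show ?thesis unfolding val[OF f] val[OF g] by simp
  qed
  then have "(\<lambda>N. - (LINT t|circle. hilbert_partial g N t * f t)) \<longlonglongrightarrow> (LINT t|circle. hilbert_L2 f t * g t)"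
    using lim[OF f g] by simp
  moreover have "(\<lambda>N. - (LINT t|circle. hilbert_partial g N t * f t)) \<longlonglongrightarrow> - (LINT t|circle. hilbert_L2 g t * f t)"
    by (intro tendsto_minus lim f g)
  ultimately have "(LINT t|circle. hilbert_L2 f t * g t) = - (LINT t|circle. hilbert_L2 g t * f t)"
    by (rule LIMSEQ_unique)
  then show ?thesis by (simp only: mult.commute)
qed

section \<open>Fejer means\<close>

lemma sum_symmetric_interval:
  fixes \<phi> :: "int \<Rightarrow> 'a :: comm_monoid_add"
  shows "(\<Sum>n\<in>{- int M..int M}. \<phi> n) = \<phi> 0 + (\<Sum>k<M. \<phi> (int k + 1) + \<phi> (- (int k + 1)))"
proof (induction M)
  case (Suc M)
  have "{- int (Suc M)..int (Suc M)} = insert (int M + 1) (insert (- (int M + 1)) {- int M..int M})" by auto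
  then show ?case using Suc by (simp add: add_ac)
qed simp

text \<open>
Passing from \<open>N\<close> to \<open>N + 1\<close> adds to the square of index pairs one more row and column, on which the
difference runs once through \<open>{- N..N}\<close>. For exponentials this says that the squared modulus of a
geometric sum is a sum of Dirichlet kernels.
\<close>

lemma sum_differences:
  fixes \<phi> :: "int \<Rightarrow> 'a :: comm_monoid_add"
  shows "(\<Sum>j<N. \<Sum>k<N. \<phi> (int j - int k)) = (\<Sum>M<N. \<Sum>n\<in>{- int M..int M}. \<phi> n)"
proof (induction N)
  case (Suc N)
  have a: "(\<Sum>j<N. \<phi> (int j - int N)) = (\<Sum>k<N. \<phi> (- (int k + 1)))"
    by (subst sum.nat_diff_reindex[symmetric]) (auto intro!: sum.cong arg_cong[where f=\<phi>])
  have b: "(\<Sum>k<N. \<phi> (int N - int k)) = (\<Sum>k<N. \<phi> (int k + 1))"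
    by (subst sum.nat_diff_reindex[symmetric]) (auto intro!: sum.cong arg_cong[where f=\<phi>])
  have "(\<Sum>j<Suc N. \<Sum>k<Suc N. \<phi> (int j - int k)) =
      (\<Sum>j<N. \<Sum>k<N. \<phi> (int j - int k)) + (\<Sum>n\<in>{- int N..int N}. \<phi> n)"
    unfolding sum_symmetric_interval by (simp add: sum.distrib a b add_ac)
  then show ?case using Suc by simp
qed simp

text \<open>
The kernel is normalised to have integral 1 over a period, and is given by the square that makes it
visibly nonnegative.
\<close>

definition fejer_kernel :: "nat \<Rightarrow> real \<Rightarrow> real" where
  "fejer_kernel N x = (norm (\<Sum>k<N. cis (of_nat k * x)))\<^sup>2 / (2 * pi * N)"

definition fejer_mean :: "nat \<Rightarrow> (real \<Rightarrow> complex) \<Rightarrow> real \<Rightarrow> complex" where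
  "fejer_mean N f t = 1 / of_nat N * (\<Sum>M<N. trig_sum {- int M..int M} (fourier_coeff f) t)"

lemma fejer_kernel_nonneg: "0 \<le> fejer_kernel N x"
  by (simp add: fejer_kernel_def)

lemma fejer_kernel_eq:
  "of_real (fejer_kernel N x) = 1 / (2 * pi * N) * (\<Sum>M<N. \<Sum>n\<in>{- int M..int M}. cis (of_int n * x))"
proof -
  let ?D = "\<Sum>k<N. cis (of_nat k * x)"
  have "of_real ((norm ?D)\<^sup>2) = ?D * cnj ?D" by (rule complex_norm_square)
  also have "\<dots> = (\<Sum>j<N. \<Sum>k<N. cis (of_int (int j - int k) * x))"
    by (simp add: sum_product cis_cnj cis_mult left_diff_distrib)
  also have "\<dots> = (\<Sum>M<N. \<Sum>n\<in>{- int M..int M}. cis (of_int n * x))"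
    by (rule sum_differences)
  finally show ?thesis by (simp add: fejer_kernel_def)
qed

lemma fejer_mean_integral:
  assumes f: "(\<lambda>s. of_real (h s)) \<in> Lp 1"
  shows "integrable circle (\<lambda>s. h s * fejer_kernel N (t - s))"
    and "fejer_mean N (\<lambda>s. of_real (h s)) t = of_real (LINT s|circle. h s * fejer_kernel N (t - s))"
proof -
  let ?f = "\<lambda>s. complex_of_real (h s)"
  let ?u = "\<lambda>M n s. 1 / (2 * pi * N) * cis (of_int n * t) * (?f s * cis (- (of_int n * s)))"
  have eq: "of_real (h s * fejer_kernel N (t - s)) = (\<Sum>M<N. \<Sum>n\<in>{- int M..int M}. ?u M n s)" for s
    unfolding of_real_mult fejer_kernel_eq
    by (simp add: sum_distrib_left right_diff_distrib mult_ac cis_mult)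
  have int: "integrable circle (?u M n)" for M n
    using Lp_1_integrable[OF Lp_mult_cis[OF f, of "- n"]] by (intro integrable_mult_right) simp
  have "integrable circle (\<lambda>s. complex_of_real (h s * fejer_kernel N (t - s)))"
    unfolding eq by (intro Bochner_Integration.integrable_sum int)
  from integrable_Re[OF this] show "integrable circle (\<lambda>s. h s * fejer_kernel N (t - s))" by simp
  have "of_real (LINT s|circle. h s * fejer_kernel N (t - s))
      = (LINT s|circle. complex_of_real (h s * fejer_kernel N (t - s)))"
    by (rule integral_complex_of_real[symmetric])
  also have "\<dots> = (\<Sum>M<N. \<Sum>n\<in>{- int M..int M}. integral\<^sup>L circle (?u M n))"
    unfolding eq by (simp only: Bochner_Integration.integral_sum Bochner_Integration.integrable_sum int)
  also have "\<dots> = (\<Sum>M<N. \<Sum>n\<in>{- int M..int M}.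
      1 / (2 * pi * N) * cis (of_int n * t) * (LINT s|circle. ?f s * cis (- (of_int n * s))))"
    by (simp only: integral_mult_right_zero)
  also have "\<dots> = fejer_mean N ?f t"
    by (simp add: fejer_mean_def trig_sum_def fourier_coeff_circle sum_distrib_left mult_ac)
  finally show "fejer_mean N ?f t = of_real (LINT s|circle. h s * fejer_kernel N (t - s))" by simp
qed

lemma integral_fejer_kernel:
  assumes N: "0 < N"
  shows "integrable circle (\<lambda>s. fejer_kernel N (t - s))"
    and "(LINT s|circle. fejer_kernel N (t - s)) = 1"
proof -
  have one: "(\<lambda>s. complex_of_real 1) \<in> Lp 1" by (rule Lp_const) simp
  show "integrable circle (\<lambda>s. fejer_kernel N (t - s))"
    using fejer_mean_integral(1)[OF one] by simp
  have "(\<lambda>s::real. complex_of_real 1) = trig_sum {0} (\<lambda>n. 1)" by (simp add: trig_sum_def fun_eq_iff)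
  then have c: "fourier_coeff (\<lambda>s. complex_of_real 1) n = (if n = 0 then 1 else 0)" for n
    by (simp only: fourier_coeff_trig_sum finite.intros) simp
  have "trig_sum {- int M..int M} (fourier_coeff (\<lambda>s. complex_of_real 1)) t = 1" for M
    unfolding trig_sum_def c by (simp add: if_distrib[of "\<lambda>x. x * _"] cong: if_cong)
  then have "fejer_mean N (\<lambda>s. complex_of_real 1) t = 1"
    using N by (simp add: fejer_mean_def)
  then show "(LINT s|circle. fejer_kernel N (t - s)) = 1"
    using fejer_mean_integral(2)[OF one, of N t] by (simp only: mult_1 of_real_eq_1_iff)
qed

lemma fejer_mean_ge:
  assumes f: "(\<lambda>s. of_real (h s)) \<in> Lp 1" and h: "\<And>s. \<delta> \<le> h s" and N: "0 < N"
  shows "\<delta> \<le> Re (fejer_mean N (\<lambda>s. of_real (h s)) t)"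
proof -
  have "\<delta> = (LINT s|circle. \<delta> * fejer_kernel N (t - s))"
    using integral_fejer_kernel[OF N] by simp
  also have "\<dots> \<le> (LINT s|circle. h s * fejer_kernel N (t - s))"
    by (intro integral_mono mult_right_mono h fejer_kernel_nonneg fejer_mean_integral(1)[OF f]
        integrable_mult_right integral_fejer_kernel N)
  finally show ?thesis by (simp add: fejer_mean_integral(2)[OF f])
qed

text \<open>
A convex function lies above its tangent at \<open>b\<close>; here the inequality is Young's, with \<open>b powr (p - 1)\<close> as the
second factor.
\<close>

lemma powr_tangent:
  fixes b x p :: real
  assumes "0 \<le> b" "0 \<le> x" "1 < p"
  shows "p * b powr (p - 1) * x - (p - 1) * b powr p \<le> x powr p"
proof -
  define q where "q = p / (p - 1)"
  have q: "1 < q" "1 / p + 1 / q = 1" "p / q = p - 1" "(p - 1) * q = p"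
    using assms by (auto simp: q_def field_simps)
  have "x * b powr (p - 1) \<le> x powr p / p + (b powr (p - 1)) powr q / q"
    using assms q by (intro Youngs_inequality) auto
  also have "(b powr (p - 1)) powr q = b powr p"
    using q by (simp add: powr_powr)
  finally have "p * (x * b powr (p - 1)) \<le> p * (x powr p / p + b powr p / q)"
    using assms by (intro mult_left_mono) auto
  also have "\<dots> = x powr p + (p / q) * b powr p" using assms by (simp add: distrib_left)
  finally show ?thesis unfolding q(3) by (simp add: mult_ac)
qed

text \<open>
Jensen's inequality for the probability density \<open>fejer_kernel N (t - s)\<close>: integrate the tangent
inequality at the point \<open>b\<close>, the mean of \<open>h\<close> itself.
\<close>

lemma fejer_mean_powr_le:
  assumes f: "(\<lambda>s. of_real (h s)) \<in> Lp 1" "(\<lambda>s. of_real (h s powr p)) \<in> Lp 1"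
    and h: "\<And>s. 0 \<le> h s" and N: "0 < N" and p: "1 < p"
  shows "Re (fejer_mean N (\<lambda>s. of_real (h s)) t) powr p \<le> Re (fejer_mean N (\<lambda>s. of_real (h s powr p)) t)"
proof -
  let ?K = "\<lambda>s. fejer_kernel N (t - s)"
  define b where "b = (LINT s|circle. h s * ?K s)"
  have b: "Re (fejer_mean N (\<lambda>s. of_real (h s)) t) = b" by (simp add: fejer_mean_integral(2)[OF f(1)] b_def)
  have b0: "0 \<le> b" using fejer_mean_ge[OF f(1) h N] b by metis
  have "b powr p = p * b powr (p - 1) * b - (p - 1) * b powr p"
    using b0 by (cases "b = 0") (simp_all add: powr_diff algebra_simps)
  also have "\<dots> = (LINT s|circle. p * b powr (p - 1) * (h s * ?K s) - (p - 1) * b powr p * ?K s)"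
    using integral_fejer_kernel[OF N] fejer_mean_integral(1)[OF f(1)]
    by (subst Bochner_Integration.integral_diff) (simp_all add: b_def[symmetric])
  also have "\<dots> \<le> (LINT s|circle. h s powr p * ?K s)"
  proof (rule integral_mono)
    fix s
    have "(p * b powr (p - 1) * h s - (p - 1) * b powr p) * ?K s \<le> h s powr p * ?K s"
      by (intro mult_right_mono powr_tangent b0 h p fejer_kernel_nonneg)
    moreover have "(x * y - z) * k = x * (y * k) - z * k" for x y z k :: real
      by (simp add: algebra_simps)
    ultimately show "p * b powr (p - 1) * (h s * ?K s) - (p - 1) * b powr p * ?K s \<le> h s powr p * ?K s"
      by simp
  qed (use integral_fejer_kernel[OF N] fejer_mean_integral(1)[OF f(1)] fejer_mean_integral(1)[OF f(2)] in auto)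
  finally show ?thesis unfolding b by (simp add: fejer_mean_integral(2)[OF f(2)])
qed

lemma fejer_mean_Lp: "0 \<le> p \<Longrightarrow> fejer_mean N f \<in> Lp p"
  unfolding fejer_mean_def[abs_def] by (intro Lp_cmult Lp_sum Lp_trig_sum) auto

text \<open>
Taking Fejer means does not change the zeroth Fourier coefficient.
\<close>

lemma integral_fejer_mean:
  assumes "0 < N"
  shows "integral\<^sup>L circle (fejer_mean N f) = integral\<^sup>L circle f"
proof -
  have int: "integrable circle (trig_sum {- int M..int M} (fourier_coeff f))" for M
    by (intro Lp_1_integrable Lp_trig_sum) auto
  have "integral\<^sup>L circle (trig_sum {- int M..int M} (fourier_coeff f)) = integral\<^sup>L circle f" for M
  proof -
    have "fourier_coeff (trig_sum {- int M..int M} (fourier_coeff f)) 0 = fourier_coeff f 0"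
      by (simp add: fourier_coeff_trig_sum)
    then show ?thesis by (simp add: fourier_coeff_circle)
  qed
  then show ?thesis
    using assms int by (simp add: fejer_mean_def[abs_def] Bochner_Integration.integral_sum)
qed

text \<open>
By Jensen's inequality the \<open>p\<close>-th power of the mean of \<open>h\<close> is at most the mean of \<open>h powr p\<close>, whose integral
is that of \<open>h powr p\<close>. The integral of a mean, a finite trigonometric sum, is read off from its zeroth
coefficient.
\<close>

lemma pmass_fejer_mean_le:
  assumes f: "(\<lambda>s. of_real (h s)) \<in> Lp p" and h: "\<And>s. 0 \<le> h s" and N: "0 < N" and p: "1 < p"
  shows "pmass p (fejer_mean N (\<lambda>s. of_real (h s))) \<le> pmass p (\<lambda>s. of_real (h s))"
proof -
  let ?w = "\<lambda>s. complex_of_real (h s powr p)"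
  have f1: "(\<lambda>s. of_real (h s)) \<in> Lp 1" using Lp_lower_exponent[OF f, of 1] p by simp
  have wm: "pmass 1 ?w = pmass p (\<lambda>s. of_real (h s))" by (simp add: pmass_def h)
  have w: "?w \<in> Lp 1"
  proof -
    have "(\<lambda>z::complex. complex_of_real (norm z powr p)) \<in> borel_measurable borel" by measurable
    from periodic_measurable_comp[OF Lp_periodic_measurable[OF f] this]
    show ?thesis using wm f h by (simp add: Lp_iff)
  qed
  have real: "fejer_mean N (\<lambda>s. of_real (h s)) t = of_real (Re (fejer_mean N (\<lambda>s. of_real (h s)) t))" for t
    by (simp add: fejer_mean_integral(2)[OF f1])
  have pos: "0 \<le> Re (fejer_mean N (\<lambda>s. of_real (h s)) t)" for t by (rule fejer_mean_ge[OF f1 h N])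
  have "pmass p (fejer_mean N (\<lambda>s. of_real (h s))) \<le> (\<integral>\<^sup>+ t. ennreal (Re (fejer_mean N ?w t)) \<partial>circle)"
    unfolding pmass_def
  proof (intro nn_integral_mono ennreal_leI)
    fix t
    have "norm (fejer_mean N (\<lambda>s. of_real (h s)) t) = Re (fejer_mean N (\<lambda>s. of_real (h s)) t)"
      by (subst real) (simp add: pos)
    then show "norm (fejer_mean N (\<lambda>s. of_real (h s)) t) powr p \<le> Re (fejer_mean N ?w t)"
      using fejer_mean_powr_le[OF f1 w h N p] by simp
  qed
  also have "\<dots> = ennreal (LINT t|circle. Re (fejer_mean N ?w t))"
    by (intro nn_integral_eq_integral integrable_Re Lp_1_integrable fejer_mean_Lp AE_I2 fejer_mean_ge[OF w _ N]) simp_all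
  also have "(LINT t|circle. Re (fejer_mean N ?w t)) = Re (integral\<^sup>L circle ?w)"
    using Lp_1_integrable[OF fejer_mean_Lp[of 1 N ?w]] by (simp only: integral_Re integral_fejer_mean[OF N])
  also have "ennreal \<dots> = pmass p (\<lambda>s. of_real (h s))"
  proof -
    have "Re (integral\<^sup>L circle ?w) = (LINT s|circle. h s powr p)"
      by (simp only: integral_complex_of_real Re_complex_of_real)
    moreover have "integrable circle (\<lambda>s. h s powr p)"
      using integrable_Re[OF Lp_1_integrable[OF w]] by simp
    ultimately show ?thesis
      unfolding wm[symmetric] pmass_1 by (subst nn_integral_eq_integral) simp_all
  qed
  finally show ?thesis .
qed

section \<open>Cesaro means of the conjugate series\<close>

lemma Cesaro_tendsto_0:
  fixes m :: "nat \<Rightarrow> real"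
  assumes lim: "m \<longlonglongrightarrow> 0" and m: "\<And>k. 0 \<le> m k"
  shows "(\<lambda>N. (\<Sum>M<Suc N. m M) / Suc N) \<longlonglongrightarrow> 0"
proof (rule LIMSEQ_I)
  fix e :: real assume e: "0 < e"
  obtain K where K: "\<And>k. K \<le> k \<Longrightarrow> m k < e / 2"
    using LIMSEQ_D[OF lim, of "e / 2"] e m by auto
  define C where "C = (\<Sum>M<K. m M)"
  have C: "0 \<le> C" using m by (simp add: C_def sum_nonneg)
  obtain L :: nat where L: "2 * C / e < L" using reals_Archimedean2 by blast
  show "\<exists>no. \<forall>n\<ge>no. norm ((\<Sum>M<Suc n. m M) / Suc n - 0) < e"
  proof (intro exI[of _ "max K L"] allI impI)
    fix n assume n: "max K L \<le> n"
    have "(\<Sum>M<Suc n. m M) = C + (\<Sum>M\<in>{K..<Suc n}. m M)"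
      using sum.atLeastLessThan_concat[of 0 K "Suc n" m] n by (simp add: C_def lessThan_atLeast0)
    also have "(\<Sum>M\<in>{K..<Suc n}. m M) \<le> (\<Sum>M\<in>{K..<Suc n}. e / 2)"
      using K by (intro sum_mono) (auto intro: less_imp_le)
    also have "\<dots> \<le> Suc n * (e / 2)" using e by (simp add: mult_right_mono)
    finally have le: "(\<Sum>M<Suc n. m M) \<le> C + Suc n * (e / 2)" by simp
    have "C < Suc n * (e / 2)"
    proof -
      have "C < L * (e / 2)" using L e by (simp add: field_simps)
      also have "\<dots> \<le> Suc n * (e / 2)" using n e by (intro mult_right_mono) auto
      finally show ?thesis .
    qed
    with le have "(\<Sum>M<Suc n. m M) < Suc n * e" by simp
    moreover have "0 \<le> (\<Sum>M<Suc n. m M)" using m by (intro sum_nonneg) auto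
    ultimately show "norm ((\<Sum>M<Suc n. m M) / Suc n - 0) < e"
      by (simp add: divide_less_eq mult.commute del: sum.lessThan_Suc)
  qed
qed

text \<open>
Convexity of the square bounds the error of the average by the average of the errors.
\<close>

lemma pmass_2_Cesaro:
  assumes S: "\<And>M. S M \<in> Lp 2" and g: "g \<in> Lp 2"
    and lim: "(\<lambda>M. pmass 2 (\<lambda>t. S M t - g t)) \<longlonglongrightarrow> 0"
  shows "(\<lambda>N. pmass 2 (\<lambda>t. 1 / of_nat (Suc N) * (\<Sum>M<Suc N. S M t) - g t)) \<longlonglongrightarrow> 0"
proof -
  define m where "m = (\<lambda>M. enn2real (pmass 2 (\<lambda>t. S M t - g t)))"
  have dm: "(\<lambda>t. S M t - g t) \<in> periodic_measurable" for M
    using S g by (intro periodic_measurable_diff Lp_periodic_measurable)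
  have m: "pmass 2 (\<lambda>t. S M t - g t) = ennreal (m M)" "0 \<le> m M" for M
    using Lp_pmass_finite[OF Lp_diff[OF S g]] by (auto simp: m_def less_top)
  have "m \<longlonglongrightarrow> 0" using lim unfolding m(1) using tendsto_ennreal_iff[of m sequentially 0] m(2) by simp
  from tendsto_ennrealI[OF Cesaro_tendsto_0[OF this m(2)]]
  have lim': "(\<lambda>N. ennreal ((\<Sum>M<Suc N. m M) / Suc N)) \<longlonglongrightarrow> 0" by simp
  have le: "pmass 2 (\<lambda>t. 1 / of_nat (Suc N) * (\<Sum>M<Suc N. S M t) - g t) \<le> ennreal ((\<Sum>M<Suc N. m M) / Suc N)" for N
  proof -
    let ?n = "real (Suc N)"
    have pw: "norm (1 / of_nat (Suc N) * (\<Sum>M<Suc N. S M t) - g t) powr 2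
        \<le> 1 / ?n * (\<Sum>M<Suc N. norm (S M t - g t) powr 2)" for t
    proof -
      have "1 / of_nat (Suc N) * (\<Sum>M<Suc N. S M t) - g t = (\<Sum>M<Suc N. S M t - g t) / of_nat (Suc N)"
        by (simp add: sum_subtractf diff_divide_distrib del: sum.lessThan_Suc of_nat_Suc)
      then have "norm (1 / of_nat (Suc N) * (\<Sum>M<Suc N. S M t) - g t) = norm (\<Sum>M<Suc N. S M t - g t) / ?n"
        by (simp only: norm_divide norm_of_nat)
      also have "\<dots> \<le> (\<Sum>M<Suc N. norm (S M t - g t)) / ?n"
        by (intro divide_right_mono norm_sum) simp
      finally have "(norm (1 / of_nat (Suc N) * (\<Sum>M<Suc N. S M t) - g t))\<^sup>2 \<le> ((\<Sum>M<Suc N. norm (S M t - g t)) / ?n)\<^sup>2"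
        by (intro power_mono) auto
      also have "\<dots> = (\<Sum>M<Suc N. norm (S M t - g t))\<^sup>2 / ?n\<^sup>2" by (rule power_divide)
      also have "\<dots> \<le> (?n * (\<Sum>M<Suc N. (norm (S M t - g t))\<^sup>2)) / ?n\<^sup>2"
        using sum_squared_le_sum_of_squares[of "\<lambda>M. norm (S M t - g t)" "{..<Suc N}"]
        by (intro divide_right_mono) (auto simp: mult.commute)
      also have "\<dots> = 1 / ?n * (\<Sum>M<Suc N. (norm (S M t - g t))\<^sup>2)"
        by (simp add: power2_eq_square del: sum.lessThan_Suc of_nat_Suc)
      finally show ?thesis by (simp add: powr_numeral del: sum.lessThan_Suc of_nat_Suc)
    qed
    have "pmass 2 (\<lambda>t. 1 / of_nat (Suc N) * (\<Sum>M<Suc N. S M t) - g t) \<le>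
        (\<integral>\<^sup>+ t. ennreal (1 / ?n) * (\<Sum>M<Suc N. ennreal (norm (S M t - g t) powr 2)) \<partial>circle)"
      unfolding pmass_def
    proof (rule nn_integral_mono)
      fix t
      have "ennreal (norm (1 / of_nat (Suc N) * (\<Sum>M<Suc N. S M t) - g t) powr 2)
          \<le> ennreal (1 / ?n * (\<Sum>M<Suc N. norm (S M t - g t) powr 2))"
        by (rule ennreal_leI[OF pw])
      also have "\<dots> = ennreal (1 / ?n) * (\<Sum>M<Suc N. ennreal (norm (S M t - g t) powr 2))"
        by (subst ennreal_mult) (auto simp: sum_nonneg sum_ennreal simp del: sum.lessThan_Suc of_nat_Suc)
      finally show "ennreal (norm (1 / of_nat (Suc N) * (\<Sum>M<Suc N. S M t) - g t) powr 2) \<le> \<dots>" .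
    qed
    also have "\<dots> = ennreal (1 / ?n) * (\<Sum>M<Suc N. pmass 2 (\<lambda>t. S M t - g t))"
      unfolding pmass_def
      by (subst nn_integral_cmult, intro borel_measurable_sum ennreal_norm_powr_measurable_circle dm,
          subst nn_integral_sum) (rule ennreal_norm_powr_measurable_circle[OF dm], rule refl)
    also have "\<dots> = ennreal (1 / ?n) * ennreal (\<Sum>M<Suc N. m M)"
      unfolding m(1) using m(2) by (subst sum_ennreal) auto
    also have "\<dots> = ennreal ((\<Sum>M<Suc N. m M) / Suc N)"
      using m(2) by (subst ennreal_mult[symmetric]) (auto simp: sum_nonneg simp del: sum.lessThan_Suc of_nat_Suc)
    finally show ?thesis .
  qed
  show ?thesis by (rule tendsto_sandwich[OF _ _ tendsto_const lim']) (use le in auto)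
qed

section \<open>The strong type bound for \<open>p \<le> 2\<close>\<close>

text \<open>
The Cesaro means of the Taylor polynomials of \<open>c 0 + 2 * (\<Sum>k\<ge>1. c k * z ^ k)\<close>, the analytic function
whose real part has the boundary Fourier coefficients \<open>c\<close> when these come from a real function.
\<close>

definition herglotz_mean :: "nat \<Rightarrow> (int \<Rightarrow> complex) \<Rightarrow> complex \<Rightarrow> complex" where
  "herglotz_mean N c z = 1 / of_nat N * (\<Sum>M<N. c 0 + (\<Sum>k<M. 2 * c (int k + 1) * z ^ Suc k))"

text \<open>
On the circle the real part of \<open>herglotz_mean\<close> is the Fejer mean and its imaginary part is the same mean of
the conjugate series: adding to, or subtracting from, a Taylor polynomial its conjugate fills in the
negative frequencies with the sign that the multiplier prescribes.
\<close>

lemma herglotz_mean_circle: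
  assumes c: "\<And>n. fourier_coeff f (- n) = cnj (fourier_coeff f n)"
  shows "of_real (Re (herglotz_mean N (fourier_coeff f) (cis t))) = fejer_mean N f t"
    and "of_real (Im (herglotz_mean N (fourier_coeff f) (cis t)))
      = 1 / of_nat N * (\<Sum>M<N. hilbert_partial f M t)"
proof -
  define c where "c = fourier_coeff f"
  define P where "P = (\<lambda>M. c 0 + (\<Sum>k<M. 2 * c (int k + 1) * cis t ^ Suc k))"
  have cc: "cnj (c n) = c (- n)" for n using assms by (simp add: c_def)
  have e: "cis t ^ Suc k = cis (of_int (int k + 1) * t)" for k
    by (simp only: Complex.DeMoivre) (simp add: algebra_simps)
  have cP: "cnj (P M) = c 0 + (\<Sum>k<M. 2 * c (- (int k + 1)) * cis (of_int (- (int k + 1)) * t))" for M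
  proof -
    have "cnj (2 * c n * cis (of_int n * t)) = 2 * c (- n) * cis (of_int (- n) * t)" for n
      by (simp add: cc cis_cnj)
    moreover have "cnj (c 0) = c 0" using cc[of 0] by simp
    ultimately show ?thesis unfolding P_def e by (simp only: complex_cnj_add cnj_sum)
  qed
  have re: "of_real (Re (P M)) = trig_sum {- int M..int M} c t" for M
  proof -
    have "of_real (Re (P M)) = (P M + cnj (P M)) / 2" by (simp add: complex_add_cnj)
    also have "\<dots> = trig_sum {- int M..int M} c t"
      unfolding cP unfolding P_def e trig_sum_def sum_symmetric_interval
      by (simp add: sum.distrib algebra_simps flip: sum_distrib_left)
    finally show ?thesis .
  qed
  have im: "of_real (Im (P M)) = hilbert_partial f M t" for M
  proof -
    have m: "hilbert_mult (int k + 1) = - \<i>" "hilbert_mult (- (int k + 1)) = \<i>" for k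
      by (simp_all add: sgn_if)
    have "of_real (Im (P M)) = - (\<i> / 2) * (P M - cnj (P M))" by (simp add: complex_eq_iff)
    also have "P M - cnj (P M) = (\<Sum>k<M. 2 * c (int k + 1) * cis (of_int (int k + 1) * t) -
        2 * c (- (int k + 1)) * cis (of_int (- (int k + 1)) * t))"
      unfolding cP unfolding P_def e sum_subtractf by simp
    also have "- (\<i> / 2) * \<dots> = hilbert_partial f M t"
      unfolding hilbert_partial_def trig_sum_def sum_symmetric_interval m c_def[symmetric] sum_distrib_left
      by (simp add: algebra_simps)
    finally show ?thesis .
  qed
  have H: "herglotz_mean N c (cis t) = of_real (1 / of_nat N) * (\<Sum>M<N. P M)"
    by (simp add: herglotz_mean_def P_def)
  show "of_real (Re (herglotz_mean N (fourier_coeff f) (cis t))) = fejer_mean N f t"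
    unfolding c_def[symmetric] H by (simp add: fejer_mean_def re[symmetric] c_def[symmetric])
  show "of_real (Im (herglotz_mean N (fourier_coeff f) (cis t)))
      = 1 / of_nat N * (\<Sum>M<N. hilbert_partial f M t)"
    unfolding c_def[symmetric] H by (simp add: im[symmetric])
qed

lemma fourier_coeff_of_real_uminus:
  "fourier_coeff (\<lambda>t. of_real (h t)) (- n) = cnj (fourier_coeff (\<lambda>t. of_real (h t)) n)"
proof -
  have "(LINT t|circle. of_real (h t) * cis (- (of_int (- n) * t)))
      = (LINT t|circle. cnj (of_real (h t) * cis (- (of_int n * t))))"
    by (simp add: cis_cnj)
  then show ?thesis unfolding fourier_coeff_circle
    by (simp only: Bochner_Integration.integral_cnj) simp
qed

text \<open>
The Fejer means of a function bounded below by \<open>\<delta>\<close> are bounded below by \<open>\<delta>\<close>, so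
\<open>conjugate_inequality_positive\<close> applies to \<open>herglotz_mean\<close>. Its right-hand side is controlled by the
contraction property of Fejer means, and its left-hand side converges in \<open>L\<^sup>2\<close> to the Hilbert
transform.
\<close>

lemma hilbert_positive_bound:
  fixes p :: real
  assumes p: "1 < p" "p \<le> 2"
  obtains A where "0 \<le> A" and
    "\<And>h \<delta>. (\<lambda>t. of_real (h t)) \<in> Lp 2 \<Longrightarrow> 0 < \<delta> \<Longrightarrow> (\<And>t. \<delta> \<le> h t) \<Longrightarrow>
      pmass p (hilbert_L2 (\<lambda>t. of_real (h t))) \<le> ennreal A * pmass p (\<lambda>t. of_real (h t))"
proof -
  obtain A where A: "0 \<le> A" and
    conj: "\<And>F \<delta>. F holomorphic_on UNIV \<Longrightarrow> 0 < \<delta> \<Longrightarrow> (\<And>t. \<delta> \<le> Re (F (cis t))) \<Longrightarrow> Im (F 0) = 0 \<Longrightarrow>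
      pmass p (\<lambda>t. of_real (Im (F (cis t)))) \<le> ennreal A * pmass p (\<lambda>t. of_real (Re (F (cis t))))"
    using conjugate_inequality_positive[OF p] by metis
  show ?thesis
  proof (rule that[OF A])
    fix h :: "real \<Rightarrow> real" and \<delta> :: real
    assume f2: "(\<lambda>t. of_real (h t)) \<in> Lp 2" and \<delta>: "0 < \<delta>" and h: "\<And>t. \<delta> \<le> h t"
    define f where "f = (\<lambda>t. complex_of_real (h t))"
    have f: "f \<in> Lp 2" "f \<in> Lp 1" "f \<in> Lp p"
      using f2 Lp_lower_exponent[OF f2] p by (auto simp: f_def)
    have h0: "0 \<le> h t" for t using h[of t] \<delta> by linarith
    define v where "v = (\<lambda>N t. 1 / of_nat (Suc N) * (\<Sum>M<Suc N. hilbert_partial f M t))"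
    have cc: "fourier_coeff f (- n) = cnj (fourier_coeff f n)" for n
      unfolding f_def by (rule fourier_coeff_of_real_uminus)
    have le: "pmass p (v N) \<le> ennreal A * pmass p f" for N
    proof -
      let ?F = "herglotz_mean (Suc N) (fourier_coeff f)"
      have hol: "?F holomorphic_on UNIV"
        unfolding herglotz_mean_def by (intro holomorphic_intros)
      have re: "\<delta> \<le> Re (?F (cis t))" for t
      proof -
        have "\<delta> \<le> Re (fejer_mean (Suc N) f t)"
          unfolding f_def by (rule fejer_mean_ge) (use f(2) h in \<open>auto simp: f_def\<close>)
        then show ?thesis by (simp flip: herglotz_mean_circle(1)[OF cc])
      qed
      have "Im (fourier_coeff f 0) = 0" using cc[of 0] by (simp add: complex_eq_iff)
      then have im: "Im (?F 0) = 0" by (simp add: herglotz_mean_def Im_divide_of_nat)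
      have "pmass p (v N) = pmass p (\<lambda>t. of_real (Im (?F (cis t))))"
        by (simp only: v_def herglotz_mean_circle(2)[OF cc])
      also have "\<dots> \<le> ennreal A * pmass p (\<lambda>t. of_real (Re (?F (cis t))))"
        by (rule conj[OF hol \<delta> re im])
      also have "pmass p (\<lambda>t. of_real (Re (?F (cis t)))) = pmass p (fejer_mean (Suc N) f)"
        by (simp only: herglotz_mean_circle(1)[OF cc])
      also have "\<dots> \<le> pmass p f"
        unfolding f_def by (rule pmass_fejer_mean_le) (use f(3) h0 p in \<open>auto simp: f_def\<close>)
      finally show ?thesis by (simp add: mult_left_mono)
    qed
    have lim: "(\<lambda>N. pmass 2 (\<lambda>t. v N t - hilbert_L2 f t)) \<longlonglongrightarrow> 0"
      unfolding v_def
      by (intro pmass_2_Cesaro hilbert_partial_Lp hilbert_L2_Lp hilbert_partial_tendsto f) simp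
    have "v N \<in> Lp 2" for N unfolding v_def by (intro Lp_cmult Lp_sum hilbert_partial_Lp) auto
    from pmass_le_of_tendsto[OF lim this hilbert_L2_Lp[OF f(1)] _ _ le tendsto_const] p
    show "pmass p (hilbert_L2 (\<lambda>t. of_real (h t))) \<le> ennreal A * pmass p (\<lambda>t. of_real (h t))"
      unfolding f_def by simp
  qed
qed

text \<open>
  Adding a constant \<open>\<delta>\<close> to \<open>h\<close> does not change the Hilbert transform, since the multiplier vanishes at
  frequency 0; the strictly positive case applies to the sum, and then \<open>\<delta>\<close> may tend to 0.
\<close>

lemma hilbert_nonneg_bound:
  fixes p :: real
  assumes p: "1 < p" "p \<le> 2"
  obtains A where "0 \<le> A" and
    "\<And>h. (\<lambda>t. of_real (h t)) \<in> Lp 2 \<Longrightarrow> (\<And>t. 0 \<le> h t) \<Longrightarrow>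
      pmass p (hilbert_L2 (\<lambda>t. of_real (h t))) \<le> ennreal A * pmass p (\<lambda>t. of_real (h t))"
proof -
  obtain A where A: "0 \<le> A" and
    pos: "\<And>h \<delta>. (\<lambda>t. of_real (h t)) \<in> Lp 2 \<Longrightarrow> 0 < \<delta> \<Longrightarrow> (\<And>t. \<delta> \<le> h t) \<Longrightarrow>
      pmass p (hilbert_L2 (\<lambda>t. of_real (h t))) \<le> ennreal A * pmass p (\<lambda>t. of_real (h t))"
    using hilbert_positive_bound[OF p] by metis
  show ?thesis
  proof (rule that)
    show "0 \<le> A * 2 powr p" using A by simp
    fix h :: "real \<Rightarrow> real" assume f2: "(\<lambda>t. of_real (h t)) \<in> Lp 2" and h: "\<And>t. 0 \<le> h t"
    define f where "f = (\<lambda>t. complex_of_real (h t))"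
    have f: "f \<in> Lp 2" "f \<in> Lp 1" using f2 Lp_lower_exponent[OF f2] by (auto simp: f_def)
    have bd: "pmass p (hilbert_L2 f) \<le>
        ennreal A * (ennreal (2 powr p) * (pmass p f + ennreal (\<delta> powr p * (2 * pi))))"
      if \<delta>: "0 < \<delta>" for \<delta>
    proof -
      have k: "(\<lambda>t. complex_of_real \<delta>) \<in> Lp q" if "0 \<le> q" for q using that by (rule Lp_const)
      have "(\<lambda>t::real. complex_of_real \<delta>) = trig_sum {0} (\<lambda>n. of_real \<delta>)"
        by (simp add: trig_sum_def fun_eq_iff)
      then have c: "fourier_coeff (\<lambda>t. complex_of_real \<delta>) n = (if n = 0 then of_real \<delta> else 0)" for n
        by (simp only: fourier_coeff_trig_sum finite.intros) simp
      have mult: "of_int (sgn n) * fourier_coeff (\<lambda>t. f t + complex_of_real \<delta>) n = of_int (sgn n) * fourier_coeff f n" for n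
        by (simp add: fourier_coeff_add[OF f(2) k[of 1]] c)
      have "hilbert_L2 (\<lambda>t. f t + complex_of_real \<delta>) = hilbert_L2 f"
        unfolding hilbert_L2_def mult.assoc mult by simp
      moreover have "(\<lambda>t. f t + complex_of_real \<delta>) = (\<lambda>t. of_real (h t + \<delta>))" by (simp add: f_def)
      ultimately have eq: "hilbert_L2 f = hilbert_L2 (\<lambda>t. of_real (h t + \<delta>))" by simp
      have "(\<lambda>t. complex_of_real (h t + \<delta>)) \<in> Lp 2" using Lp_add[OF f(1) k[of 2]] by (simp add: f_def)
      then have "pmass p (hilbert_L2 f) \<le> ennreal A * pmass p (\<lambda>t. of_real (h t + \<delta>))"
        unfolding eq by (rule pos[OF _ \<delta>]) (simp add: h)
      also have "pmass p (\<lambda>t. of_real (h t + \<delta>)) \<le>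
          ennreal (2 powr p) * (pmass p f + pmass p (\<lambda>t. complex_of_real \<delta>))"
        using pmass_add[OF Lp_periodic_measurable[OF f(1)] Lp_periodic_measurable[OF k[of 1]], of p] p
        by (simp add: f_def)
      also have "pmass p (\<lambda>t. complex_of_real \<delta>) = ennreal (\<delta> powr p * (2 * pi))"
        unfolding pmass_def using \<delta> by (subst nn_integral_circle_const) (simp add: ennreal_mult)
      finally show ?thesis by (simp add: mult_left_mono)
    qed
    have "(\<lambda>k. ennreal A * (ennreal (2 powr p) * (pmass p f + ennreal (inverse (real (Suc k)) powr p * (2 * pi)))))
        \<longlonglongrightarrow> ennreal A * (ennreal (2 powr p) * (pmass p f + ennreal (0 powr p * (2 * pi))))"
      using p LIMSEQ_inverse_real_of_nat
      by (intro ennreal_tendsto_cmult tendsto_add tendsto_const tendsto_ennrealI tendsto_mult_right tendsto_powr') auto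
    then have "pmass p (hilbert_L2 f) \<le>
        ennreal A * (ennreal (2 powr p) * (pmass p f + ennreal (0 powr p * (2 * pi))))"
      by (rule LIMSEQ_le_const) (use bd in auto)
    also have "\<dots> = ennreal (A * 2 powr p) * pmass p f"
      using A by (simp add: ennreal_mult mult.assoc)
    finally show "pmass p (hilbert_L2 (\<lambda>t. of_real (h t))) \<le> ennreal (A * 2 powr p) * pmass p (\<lambda>t. of_real (h t))"
      unfolding f_def .
  qed
qed

text \<open>
A complex function is a combination of four nonnegative ones, the positive and negative parts of its
real and imaginary part, each dominated by its modulus.
\<close>

lemma hilbert_strong_type_le_2:
  fixes p :: real
  assumes p: "1 < p" "p \<le> 2"
  obtains C where "0 \<le> C" "\<And>f. f \<in> Lp 2 \<Longrightarrow> pmass p (hilbert_L2 f) \<le> ennreal C * pmass p f"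
proof -
  obtain A where A: "0 \<le> A" and
    pos: "\<And>h. (\<lambda>t. of_real (h t)) \<in> Lp 2 \<Longrightarrow> (\<And>t. 0 \<le> h t) \<Longrightarrow>
      pmass p (hilbert_L2 (\<lambda>t. of_real (h t))) \<le> ennreal A * pmass p (\<lambda>t. of_real (h t))"
    using hilbert_nonneg_bound[OF p] by metis
  \<comment> \<open>One nonnegative part \<open>\<psi> f\<close>, carried by a unimodular constant \<open>c\<close>.\<close>
  have part: "pmass p (hilbert_L2 (\<lambda>t. c * of_real (h t))) \<le> ennreal A * pmass p f"
    and part2: "(\<lambda>t. c * of_real (h t)) \<in> Lp 2"
    if f: "f \<in> Lp 2" and h: "h = (\<lambda>t. \<psi> (f t))" "\<And>z. 0 \<le> \<psi> z" "\<And>z. \<psi> z \<le> norm z"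
      "continuous_on UNIV \<psi>" and c: "norm c = 1" for f h c and \<psi> :: "complex \<Rightarrow> real"
  proof -
    let ?g = "\<lambda>t. complex_of_real (h t)"
    have m: "?g \<in> periodic_measurable"
      using periodic_measurable_comp[OF Lp_periodic_measurable[OF f], of "\<lambda>z. of_real (\<psi> z)"] h
      by (simp add: borel_measurable_continuous_onI continuous_on_of_real)
    have le: "pmass q ?g \<le> pmass q f" if "0 \<le> q" for q
      using h that by (intro pmass_mono) auto
    have g: "?g \<in> Lp 2" using le[of 2] f m by (auto simp: Lp_iff intro: le_less_trans)
    then show "(\<lambda>t. c * of_real (h t)) \<in> Lp 2" by (rule Lp_cmult)
    have "AE t in circle. hilbert_L2 (\<lambda>t. c * ?g t) t = c * hilbert_L2 ?g t"
      using hilbert_L2_cmult[OF g, of c] g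
      by (subst AE_circle_iff_ae_eq) (auto intro!: Lp_periodic_measurable[of _ 2] hilbert_L2_Lp Lp_cmult)
    then have "pmass p (hilbert_L2 (\<lambda>t. c * ?g t)) = pmass p (\<lambda>t. c * hilbert_L2 ?g t)"
      by (rule pmass_cong_AE)
    also have "\<dots> = pmass p (hilbert_L2 ?g)"
      using c by (simp add: pmass_mult Lp_periodic_measurable[OF hilbert_L2_Lp[OF g]])
    also have "\<dots> \<le> ennreal A * pmass p ?g" by (rule pos[OF g]) (simp add: h)
    also have "\<dots> \<le> ennreal A * pmass p f" using le[of p] p by (intro mult_left_mono) auto
    finally show "pmass p (hilbert_L2 (\<lambda>t. c * of_real (h t))) \<le> ennreal A * pmass p f" .
  qed
  have plus: "pmass p (hilbert_L2 (\<lambda>t. f t + g t)) \<le> ennreal (2 powr p) * (a + b)"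
    if "f \<in> Lp 2" "g \<in> Lp 2" "pmass p (hilbert_L2 f) \<le> a" "pmass p (hilbert_L2 g) \<le> b" for f g a b
  proof -
    have m: "hilbert_L2 f \<in> periodic_measurable" "hilbert_L2 g \<in> periodic_measurable"
      using that hilbert_L2_Lp Lp_periodic_measurable by blast+
    have "AE t in circle. hilbert_L2 (\<lambda>t. f t + g t) t = hilbert_L2 f t + hilbert_L2 g t"
      using hilbert_L2_add[OF that(1,2)] that m
      by (subst AE_circle_iff_ae_eq) (auto intro!: Lp_periodic_measurable[of _ 2] hilbert_L2_Lp Lp_add)
    then have "pmass p (hilbert_L2 (\<lambda>t. f t + g t)) = pmass p (\<lambda>t. hilbert_L2 f t + hilbert_L2 g t)"
      by (rule pmass_cong_AE)
    also have "\<dots> \<le> ennreal (2 powr p) * (pmass p (hilbert_L2 f) + pmass p (hilbert_L2 g))"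
      using m p by (intro pmass_add) auto
    also have "\<dots> \<le> ennreal (2 powr p) * (a + b)"
      using that by (intro mult_left_mono add_mono) auto
    finally show ?thesis .
  qed
  show ?thesis
  proof (rule that)
    show "0 \<le> 4 * (2 powr p * (2 powr p * A))" using A by simp
    fix f assume f: "f \<in> Lp 2"
    define r1 where "r1 = (\<lambda>t. 1 * complex_of_real (max 0 (Re (f t))))"
    define r2 where "r2 = (\<lambda>t. - 1 * complex_of_real (max 0 (- Re (f t))))"
    define i1 where "i1 = (\<lambda>t. \<i> * complex_of_real (max 0 (Im (f t))))"
    define i2 where "i2 = (\<lambda>t. - \<i> * complex_of_real (max 0 (- Im (f t))))"
    have cont: "continuous_on UNIV (\<lambda>z. max 0 (Re z))" "continuous_on UNIV (\<lambda>z. max 0 (- Re z))"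
      "continuous_on UNIV (\<lambda>z. max 0 (Im z))" "continuous_on UNIV (\<lambda>z. max 0 (- Im z))"
      by (intro continuous_intros)+
    have le: "max 0 (Re z) \<le> norm z" "max 0 (- Re z) \<le> norm z" "max 0 (Im z) \<le> norm z" "max 0 (- Im z) \<le> norm z" for z
      using abs_Re_le_cmod[of z] abs_Im_le_cmod[of z] by auto
    let ?a = "ennreal A * pmass p f"
    have b: "pmass p (hilbert_L2 r1) \<le> ?a" "pmass p (hilbert_L2 r2) \<le> ?a"
        "pmass p (hilbert_L2 i1) \<le> ?a" "pmass p (hilbert_L2 i2) \<le> ?a"
      unfolding r1_def r2_def i1_def i2_def
      using part[OF f refl _ le(1) cont(1), of 1] part[OF f refl _ le(2) cont(2), of "- 1"]
        part[OF f refl _ le(3) cont(3), of \<i>] part[OF f refl _ le(4) cont(4), of "- \<i>"] by simp_all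
    have L: "r1 \<in> Lp 2" "r2 \<in> Lp 2" "i1 \<in> Lp 2" "i2 \<in> Lp 2"
      unfolding r1_def r2_def i1_def i2_def
      using part2[OF f refl _ le(1) cont(1), of 1] part2[OF f refl _ le(2) cont(2), of "- 1"]
        part2[OF f refl _ le(3) cont(3), of \<i>] part2[OF f refl _ le(4) cont(4), of "- \<i>"] by simp_all
    have "pmass p (hilbert_L2 (\<lambda>t. (r1 t + r2 t) + (i1 t + i2 t))) \<le>
        ennreal (2 powr p) * (ennreal (2 powr p) * (?a + ?a) + ennreal (2 powr p) * (?a + ?a))"
      using L b by (intro plus Lp_add) auto
    moreover have "(\<lambda>t. (r1 t + r2 t) + (i1 t + i2 t)) = f"
      by (auto simp: fun_eq_iff r1_def r2_def i1_def i2_def complex_eq_iff max_def)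
    moreover have "ennreal (2 powr p) * (ennreal (2 powr p) * (?a + ?a) + ennreal (2 powr p) * (?a + ?a))
        = ennreal (4 * (2 powr p * (2 powr p * A))) * pmass p f"
    proof -
      have "x * (x * (y + y) + x * (y + y)) = 4 * (x * (x * y))" for x y :: ennreal
      proof -
        have "x * (x * (y + y) + x * (y + y)) = x * (2 * (x * (2 * y)))" by (simp only: mult_2)
        also have "\<dots> = (2 * 2) * (x * (x * y))" by (simp only: mult_ac)
        finally show ?thesis by simp
      qed
      then show ?thesis using A by (simp add: ennreal_mult mult.assoc)
    qed
    ultimately show "pmass p (hilbert_L2 f) \<le> ennreal (4 * (2 powr p * (2 powr p * A))) * pmass p f" by simp
  qed
qed

section \<open>The strong type bound for \<open>p > 2\<close> by duality\<close>

text \<open>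
Let \<open>G\<close> be the Hilbert transform of \<open>f\<close>. The function \<open>g\<close> dual to \<open>G\<close>, cut off where \<open>G\<close> is large to keep
it bounded, satisfies \<open>G * g = \<bar>G\<bar> powr p\<close> and \<open>\<bar>g\<bar> powr q = \<bar>G\<bar> powr p\<close> on the set that is kept. Moving the Hilbert
transform from \<open>f\<close> to \<open>g\<close> and using the bound for \<open>q < 2\<close> gives an inequality in which \<open>pmass p (cut N)\<close>
occurs on both sides; it is finite by the cut-off, so the smaller occurrence can be absorbed. Finally
let the cut-off tend to infinity.
\<close>

lemma hilbert_strong_type_gt_2:
  fixes p :: real
  assumes p: "2 < p"
  obtains C where "0 \<le> C" "\<And>f. f \<in> Lp p \<Longrightarrow> pmass p (hilbert_L2 f) \<le> ennreal C * pmass p f"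
proof -
  define q where "q = p / (p - 1)"
  have q: "1 < q" "q \<le> 2" "1 / p + 1 / q = 1" "(p - 1) * q = p"
    using p by (auto simp: q_def field_simps)
  obtain C where C: "0 \<le> C" and bound: "\<And>g. g \<in> Lp 2 \<Longrightarrow> pmass q (hilbert_L2 g) \<le> ennreal C * pmass q g"
    using hilbert_strong_type_le_2[OF q(1,2)] by metis
  \<comment> \<open>This weight makes the term coming from \<open>pmass q g\<close> at most half of the left-hand side.\<close>
  define l where "l = (2 * (C + 1)) powr (1 / q)"
  have l: "0 < l" "l powr (- q) * C \<le> 1 / 2"
  proof -
    show "0 < l" using C by (simp add: l_def)
    have "l powr (- q) = 1 / (2 * (C + 1))"
      using C q by (simp add: l_def powr_powr powr_minus_divide)
    then have "l powr (- q) * C = (C / (C + 1)) / 2" by simp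
    also have "\<dots> \<le> 1 / 2" using C by (intro divide_right_mono) (simp_all add: divide_le_eq_1)
    finally show "l powr (- q) * C \<le> 1 / 2" .
  qed
  show ?thesis
  proof (rule that)
    show "0 \<le> 2 * l powr p" by simp
    fix f assume f: "f \<in> Lp p"
    have f2: "f \<in> Lp 2" using Lp_lower_exponent[OF f, of 2] p by simp
    define G where "G = hilbert_L2 f"
    have G: "G \<in> Lp 2" unfolding G_def by (rule hilbert_L2_Lp[OF f2])
    define cut where "cut = (\<lambda>(N::nat) t. if norm (G t) \<le> N then G t else 0)"
    have cutm: "cut N \<in> periodic_measurable" for N
    proof -
      have "(\<lambda>z::complex. if norm z \<le> N then z else 0) \<in> borel_measurable borel" by measurable
      from periodic_measurable_comp[OF Lp_periodic_measurable[OF G] this] show ?thesis by (simp add: cut_def)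
    qed
    have main: "pmass p (cut N) \<le> ennreal (2 * l powr p) * pmass p f" for N
    proof -
      define g where "g = (\<lambda>t. of_real (norm (cut N t) powr (p - 2)) * cnj (cut N t))"
      have gm: "g \<in> periodic_measurable"
      proof -
        have "(\<lambda>z::complex. of_real (norm z powr (p - 2)) * cnj z) \<in> borel_measurable borel"
          by (intro borel_measurable_times borel_measurable_continuous_onI[of cnj] continuous_intros) measurable
        from periodic_measurable_comp[OF cutm this] show ?thesis by (simp add: g_def)
      qed
      have norm_g: "norm (g t) = norm (cut N t) powr (p - 1)" for t
      proof (cases "cut N t = 0")
        case False
        then have "norm (cut N t) powr (p - 2) * norm (cut N t) = norm (cut N t) powr (p - 2 + 1)"
          by (subst powr_add) simp
        then show ?thesis by (simp add: g_def norm_mult)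
      qed (use p in \<open>simp add: g_def\<close>)
      have "norm (cut N t) \<le> N" for t by (simp add: cut_def)
      then have "norm (g t) \<le> real N powr (p - 1)" for t
        unfolding norm_g using p by (intro powr_mono2) auto
      then have g2: "g \<in> Lp 2" using gm by (intro Lp_bounded) auto
      have gq: "pmass q g = pmass p (cut N)"
        unfolding pmass_def norm_g using q by (simp add: powr_powr)
      have Gg: "G t * g t = of_real (norm (cut N t) powr p)" for t
      proof (cases "cut N t = 0")
        case False
        then have "cut N t = G t" by (auto simp: cut_def split: if_splits)
        then have "G t * g t = of_real (norm (cut N t) powr (p - 2)) * (cut N t * cnj (cut N t))"
          by (simp add: g_def mult_ac)
        also have "\<dots> = of_real (norm (cut N t) powr (p - 2) * (norm (cut N t))\<^sup>2)"
          by (simp add: mult_cnj_norm)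
        also have "norm (cut N t) powr (p - 2) * (norm (cut N t))\<^sup>2 = norm (cut N t) powr p"
          using False powr_add[of "norm (cut N t)" "p - 2" 2] by (simp add: powr_numeral)
        finally show ?thesis .
      qed (use p in \<open>simp add: g_def\<close>)
      have "pmass p (cut N) = pmass 1 (\<lambda>t. G t * g t)"
        by (simp add: pmass_def Gg)
      also have "\<dots> = ennreal (norm (LINT t|circle. G t * g t))"
      proof -
        have int: "integrable circle (\<lambda>t. complex_of_real (norm (cut N t) powr p))"
          using Lp_1_integrable[OF Lp_2_mult[OF G g2]] by (simp add: Gg)
        have "integrable circle (\<lambda>t. norm (cut N t) powr p)"
          using integrable_Re[OF int] by simp
        then have "pmass 1 (\<lambda>t. G t * g t) = ennreal (LINT t|circle. norm (cut N t) powr p)"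
          unfolding pmass_1 Gg by (subst nn_integral_eq_integral[symmetric]) auto
        moreover have "0 \<le> (LINT t|circle. norm (cut N t) powr p)"
          by (rule Bochner_Integration.integral_nonneg) simp
        ultimately show ?thesis
          unfolding Gg integral_complex_of_real by simp
      qed
      also have "(LINT t|circle. G t * g t) = - (LINT t|circle. f t * hilbert_L2 g t)"
        unfolding G_def by (rule hilbert_L2_antisymmetric[OF f2 g2])
      also have "ennreal (norm (- (LINT t|circle. f t * hilbert_L2 g t))) \<le> pmass 1 (\<lambda>t. f t * hilbert_L2 g t)"
        using norm_integral_le_pmass[OF Lp_2_mult[OF f2 hilbert_L2_Lp[OF g2]]] by simp
      also have "\<dots> \<le> ennreal (l powr p) * pmass p f + ennreal (l powr (- q)) * pmass q (hilbert_L2 g)"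
        using p q l by (intro pmass_mult_Young Lp_periodic_measurable[OF f]
            Lp_periodic_measurable[OF hilbert_L2_Lp[OF g2]]) auto
      also have "\<dots> \<le> ennreal (l powr p) * pmass p f + ennreal (l powr (- q)) * (ennreal C * pmass p (cut N))"
        using bound[OF g2] unfolding gq by (intro add_left_mono mult_left_mono) auto
      finally have ineq: "pmass p (cut N) \<le>
          ennreal (l powr p) * pmass p f + ennreal (l powr (- q)) * (ennreal C * pmass p (cut N))" .
      have "cut N \<in> Lp p"
        by (rule Lp_bounded[OF cutm, where B=N]) (use p in \<open>auto simp: cut_def\<close>)
      then obtain x where x: "pmass p (cut N) = ennreal x" "0 \<le> x"
        using Lp_pmass_finite by (metis enn2real_nonneg ennreal_enn2real infinity_ennreal_def)
      obtain y where y: "pmass p f = ennreal y" "0 \<le> y"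
        using Lp_pmass_finite[OF f] by (metis enn2real_nonneg ennreal_enn2real infinity_ennreal_def)
      have "ennreal x \<le> ennreal (l powr p * y + l powr (- q) * (C * x))"
        using ineq unfolding x(1) y(1) using x(2) y(2) C by (simp add: ennreal_mult)
      then have "x \<le> l powr p * y + l powr (- q) * (C * x)"
        using x(2) y(2) C by (subst (asm) ennreal_le_iff) auto
      also have "l powr (- q) * (C * x) \<le> 1 / 2 * x"
        using mult_right_mono[OF l(2) x(2)] by (simp add: mult.assoc)
      finally have "x \<le> 2 * l powr p * y" by simp
      then show ?thesis unfolding x(1) y(1) using y(2) by (simp add: ennreal_leI flip: ennreal_mult)
    qed
    have "pmass p G \<le> liminf (\<lambda>N. pmass p (cut N))"
    proof (rule pmass_Fatou)
      show "AE t in circle. (\<lambda>N. cut N t) \<longlonglongrightarrow> G t"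
      proof (rule AE_I2)
        fix t
        obtain K :: nat where "norm (G t) \<le> K" using real_arch_simple by blast
        have "eventually (\<lambda>N. cut N t = G t) sequentially"
          using eventually_ge_at_top[of K]
        proof eventually_elim
          case (elim N)
          then have "norm (G t) \<le> N" using \<open>norm (G t) \<le> K\<close> by linarith
          then show ?case by (simp add: cut_def)
        qed
        then show "(\<lambda>N. cut N t) \<longlonglongrightarrow> G t" by (rule tendsto_eventually)
      qed
    qed (use cutm p in auto)
    also have "\<dots> \<le> liminf (\<lambda>N. ennreal (2 * l powr p) * pmass p f)"
      by (intro Liminf_mono always_eventually allI main)
    also have "\<dots> = ennreal (2 * l powr p) * pmass p f" by (simp add: Liminf_const)
    finally show "pmass p (hilbert_L2 f) \<le> ennreal (2 * l powr p) * pmass p f" unfolding G_def .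
  qed
qed

lemma hilbert_L2_pmass_bound:
  fixes p :: real
  assumes p: "1 < p"
  obtains C where "0 \<le> C" "\<And>f. f \<in> Lp p \<Longrightarrow> f \<in> Lp 2 \<Longrightarrow> pmass p (hilbert_L2 f) \<le> ennreal C * pmass p f"
  using hilbert_strong_type_le_2[OF p] hilbert_strong_type_gt_2[of p] by (metis not_le)

lemma hilbert_L2_maps_Lp:
  assumes p: "1 < p" and f: "f \<in> Lp p" "f \<in> Lp 2"
  shows "hilbert_L2 f \<in> Lp p"
proof -
  obtain C where "0 \<le> C" and
    bound: "\<And>f. f \<in> Lp p \<Longrightarrow> f \<in> Lp 2 \<Longrightarrow> pmass p (hilbert_L2 f) \<le> ennreal C * pmass p f"
    using hilbert_L2_pmass_bound[OF p] by metis
  have "ennreal C * pmass p f < \<infinity>"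
    using Lp_pmass_finite[OF f(1)] by (simp add: ennreal_mult_less_top)
  with bound[OF f] have "pmass p (hilbert_L2 f) < \<infinity>" by (rule le_less_trans)
  with Lp_periodic_measurable[OF hilbert_L2_Lp[OF f(2)]] show ?thesis by (simp add: Lp_iff)
qed

section \<open>Extension by density\<close>

lemma ae_eq_circle: "f =\<^sub>a\<^sub>e g \<Longrightarrow> AE t in circle. f t = g t"
  by (auto simp: ae_eq_def AE_restrict_space_iff)

lemma pmass_cong_ae_eq: "f =\<^sub>a\<^sub>e g \<Longrightarrow> pmass p f = pmass p g"
  by (intro pmass_cong_AE ae_eq_circle)

lemma Lp_norm_le_iff_pmass:
  assumes "f \<in> Lp p" "h \<in> Lp p" "0 < p" "0 \<le> C"
  shows "Lp_norm p h \<le> C * Lp_norm p f \<longleftrightarrow> pmass p h \<le> ennreal (C powr p) * pmass p f"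
proof -
  define x where "x = enn2real (pmass p h)"
  define y where "y = enn2real (pmass p f)"
  have x: "pmass p h = ennreal x" "0 \<le> x" and y: "pmass p f = ennreal y" "0 \<le> y"
    using assms Lp_pmass_finite by (auto simp: x_def y_def less_top)
  have "Lp_norm p h \<le> C * Lp_norm p f \<longleftrightarrow> (x / (2 * pi)) powr (1 / p) \<le> C * (y / (2 * pi)) powr (1 / p)"
    using assms by (simp add: Lp_norm_eq Lp_periodic_measurable x_def y_def)
  also have "C * (y / (2 * pi)) powr (1 / p) = (C powr p * (y / (2 * pi))) powr (1 / p)"
    using assms(3,4) y(2) by (subst powr_mult) (simp_all add: powr_powr)
  also have "(x / (2 * pi)) powr (1 / p) \<le> \<dots> \<longleftrightarrow> x / (2 * pi) \<le> C powr p * (y / (2 * pi))"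
  proof -
    have "a powr (1 / p) \<le> b powr (1 / p) \<longleftrightarrow> a \<le> b" if "0 \<le> a" "0 \<le> b" for a b
      using that assms powr_mono2[of "1 / p" a b] powr_less_mono2[of "1 / p" b a] by (auto simp: not_le[symmetric])
    then show ?thesis using x y by simp
  qed
  also have "\<dots> \<longleftrightarrow> x \<le> C powr p * y" by (simp add: field_simps)
  also have "\<dots> \<longleftrightarrow> pmass p h \<le> ennreal (C powr p) * pmass p f"
    using x y by (simp flip: ennreal_mult)
  finally show ?thesis .
qed

lemma hilbert_L2_diff:
  assumes f: "f \<in> Lp 2" and g: "g \<in> Lp 2"
  shows "hilbert_L2 (\<lambda>t. f t - g t) =\<^sub>a\<^sub>e (\<lambda>t. hilbert_L2 f t - hilbert_L2 g t)"
proof -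
  have "hilbert_L2 (\<lambda>t. f t + - 1 * g t) =\<^sub>a\<^sub>e (\<lambda>t. hilbert_L2 f t + hilbert_L2 (\<lambda>t. - 1 * g t) t)"
    by (intro hilbert_L2_add f Lp_cmult g)
  moreover have "hilbert_L2 (\<lambda>t. - 1 * g t) =\<^sub>a\<^sub>e (\<lambda>t. - 1 * hilbert_L2 g t)"
    by (intro hilbert_L2_cmult g)
  ultimately show ?thesis unfolding ae_eq_def by (auto elim: AE_mp)
qed

definition truncate :: "nat \<Rightarrow> (real \<Rightarrow> complex) \<Rightarrow> real \<Rightarrow> complex" where
  "truncate k f t = (if norm (f t) \<le> k then f t else 0)"

lemma truncate_Lp:
  assumes "f \<in> periodic_measurable" "0 \<le> p"
  shows "truncate k f \<in> Lp p"
proof (rule Lp_bounded)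
  have "(\<lambda>z::complex. if norm z \<le> k then z else 0) \<in> borel_measurable borel" by measurable
  from periodic_measurable_comp[OF assms(1) this]
  show "truncate k f \<in> periodic_measurable" by (simp add: truncate_def[abs_def])
  show "norm (truncate k f t) \<le> k" for t by (simp add: truncate_def)
qed (fact assms)

lemma truncate_tendsto:
  assumes f: "f \<in> Lp p" and p: "0 < p"
  shows "(\<lambda>k. pmass p (\<lambda>t. truncate k f t - f t)) \<longlonglongrightarrow> 0"
proof -
  have fm: "f \<in> periodic_measurable" using f by (rule Lp_periodic_measurable)
  have m: "(\<lambda>t. truncate k f t - f t) \<in> periodic_measurable" for k
    using Lp_periodic_measurable[OF truncate_Lp[OF fm, of 1 k]] fm by (intro periodic_measurable_diff) auto
  have "(\<lambda>k. \<integral>\<^sup>+ t. ennreal (norm (truncate k f t - f t) powr p) \<partial>circle) \<longlonglongrightarrow> (\<integral>\<^sup>+ t. 0 \<partial>circle)"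
  proof (rule nn_integral_dominated_convergence)
    show "(\<integral>\<^sup>+ t. ennreal (norm (f t) powr p) \<partial>circle) < \<infinity>"
      using Lp_pmass_finite[OF f] by (simp add: pmass_def)
    show "AE t in circle. ennreal (norm (truncate k f t - f t) powr p) \<le> ennreal (norm (f t) powr p)" for k
      using p by (auto simp: truncate_def intro!: AE_I2)
    show "AE t in circle. (\<lambda>k. ennreal (norm (truncate k f t - f t) powr p)) \<longlonglongrightarrow> 0"
    proof (rule AE_I2)
      fix t
      obtain K :: nat where K: "norm (f t) \<le> K" using real_arch_simple by blast
      have "eventually (\<lambda>k. ennreal (norm (truncate k f t - f t) powr p) = 0) sequentially"
        using eventually_ge_at_top[of K]
      proof eventually_elim
        case (elim k)
        then have "norm (f t) \<le> k" using K by linarith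
        then show ?case using p by (simp add: truncate_def)
      qed
      then show "(\<lambda>k. ennreal (norm (truncate k f t - f t) powr p)) \<longlonglongrightarrow> 0"
        by (rule tendsto_eventually)
    qed
  qed (intro ennreal_norm_powr_measurable_circle m fm | simp)+
  then show ?thesis by (simp add: pmass_def)
qed

text \<open>
By the bound on \<open>L\<^sup>p \<inter> L\<^sup>2\<close>, the Hilbert transforms of the truncations inherit the Cauchy property from
the truncations.
\<close>

lemma hilbert_Lp_limit_exists:
  assumes p: "1 < p" and f: "f \<in> Lp p"
  shows "\<exists>g. g \<in> Lp p \<and> (\<lambda>k. pmass p (\<lambda>t. hilbert_L2 (truncate k f) t - g t)) \<longlonglongrightarrow> 0"
proof -
  obtain C where C: "0 \<le> C" and
    bound: "\<And>f. f \<in> Lp p \<Longrightarrow> f \<in> Lp 2 \<Longrightarrow> pmass p (hilbert_L2 f) \<le> ennreal C * pmass p f"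
    using hilbert_L2_pmass_bound[OF p] by metis
  have fm: "f \<in> periodic_measurable" using f by (rule Lp_periodic_measurable)
  have T: "truncate k f \<in> Lp p" "truncate k f \<in> Lp 2" for k
    using truncate_Lp[OF fm] p by auto
  let ?h = "\<lambda>k. hilbert_L2 (truncate k f)"
  have h: "?h k \<in> Lp p" for k by (rule hilbert_L2_maps_Lp[OF p T])
  have "\<exists>N. \<forall>m\<ge>N. \<forall>n\<ge>N. pmass p (\<lambda>t. ?h m t - ?h n t) \<le> ennreal e" if e: "0 < e" for e
  proof -
    define d where "d = e / ((C + 1) * 2 powr p * 2)"
    have d: "0 < d" using e C by (simp add: d_def)
    have "eventually (\<lambda>k. pmass p (\<lambda>t. truncate k f t - f t) < ennreal d) sequentially"
      using truncate_tendsto[OF f] p by (intro order_tendstoD(2)[of _ 0]) (auto simp: d)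
    then obtain N where N: "\<And>k. N \<le> k \<Longrightarrow> pmass p (\<lambda>t. truncate k f t - f t) < ennreal d"
      by (auto simp: eventually_sequentially)
    have "pmass p (\<lambda>t. ?h m t - ?h n t) \<le> ennreal e" if mn: "N \<le> m" "N \<le> n" for m n
    proof -
      have "pmass p (\<lambda>t. ?h m t - ?h n t) = pmass p (hilbert_L2 (\<lambda>t. truncate m f t - truncate n f t))"
        by (rule pmass_cong_ae_eq[symmetric], rule hilbert_L2_diff) (rule T)+
      also have "\<dots> \<le> ennreal C * pmass p (\<lambda>t. truncate m f t - truncate n f t)"
        using p by (intro bound Lp_diff T) auto
      also have "\<dots> \<le> ennreal C * (ennreal (2 powr p) *
          (pmass p (\<lambda>t. truncate m f t - f t) + pmass p (\<lambda>t. f t - truncate n f t)))"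
        using p by (intro mult_left_mono pmass_diff_triangle Lp_periodic_measurable[OF T(1)] fm) auto
      also have "\<dots> \<le> ennreal C * (ennreal (2 powr p) * (ennreal d + ennreal d))"
        using N[OF mn(1)] N[OF mn(2)] pmass_diff_commute[of p f "truncate n f"]
        by (intro mult_left_mono add_mono) auto
      also have "\<dots> = ennreal (C * (2 powr p * (d + d)))"
        using C d by (subst ennreal_mult, simp, simp, subst ennreal_mult, simp, simp, subst ennreal_plus) simp_all
      also have "\<dots> \<le> ennreal e"
      proof (rule ennreal_leI)
        have "C * (2 powr p * (d + d)) \<le> (C + 1) * (2 powr p * (d + d))"
          using d by (intro mult_right_mono) auto
        also have "\<dots> = ((C + 1) * 2 powr p * 2) * d" by (simp add: algebra_simps)
        also have "\<dots> = e"
        proof -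
          have "(C + 1) * 2 powr p * 2 \<noteq> 0" using C by simp
          then show ?thesis unfolding d_def by (rule nonzero_mult_div_cancel_left[of _ e, folded times_divide_eq_right])
        qed
        finally show "C * (2 powr p * (d + d)) \<le> e" .
      qed
      finally show ?thesis .
    qed
    then show ?thesis by blast
  qed
  then obtain g where "g \<in> Lp p" "(\<lambda>k. pmass p (\<lambda>t. ?h k t - g t)) \<longlonglongrightarrow> 0"
    by (rule Lp_complete[OF h less_imp_le[OF p]]) auto
  then show ?thesis by blast
qed

definition hilbert_Lp :: "real \<Rightarrow> (real \<Rightarrow> complex) \<Rightarrow> real \<Rightarrow> complex" where
  "hilbert_Lp p f = (SOME g. g \<in> Lp p \<and> (\<lambda>k. pmass p (\<lambda>t. hilbert_L2 (truncate k f) t - g t)) \<longlonglongrightarrow> 0)"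

lemma hilbert_Lp_spec:
  assumes "1 < p" "f \<in> Lp p"
  shows "hilbert_Lp p f \<in> Lp p"
    and "(\<lambda>k. pmass p (\<lambda>t. hilbert_L2 (truncate k f) t - hilbert_Lp p f t)) \<longlonglongrightarrow> 0"
  using someI_ex[OF hilbert_Lp_limit_exists[OF assms]] unfolding hilbert_Lp_def by blast+

text \<open>
Any approximation of \<open>f\<close> from \<open>L\<^sup>p \<inter> L\<^sup>2\<close> produces the same limit as the truncations. This is what
makes the extension additive although truncation is not.
\<close>

lemma hilbert_Lp_tendsto:
  assumes p: "1 < p" and h: "\<And>k. h k \<in> Lp p" "\<And>k. h k \<in> Lp 2" and f: "f \<in> Lp p"
    and lim: "(\<lambda>k. pmass p (\<lambda>t. h k t - f t)) \<longlonglongrightarrow> 0"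
  shows "(\<lambda>k. pmass p (\<lambda>t. hilbert_L2 (h k) t - hilbert_Lp p f t)) \<longlonglongrightarrow> 0"
proof -
  obtain C where C: "0 \<le> C" and
    bound: "\<And>f. f \<in> Lp p \<Longrightarrow> f \<in> Lp 2 \<Longrightarrow> pmass p (hilbert_L2 f) \<le> ennreal C * pmass p f"
    using hilbert_L2_pmass_bound[OF p] by metis
  have fm: "f \<in> periodic_measurable" using f by (rule Lp_periodic_measurable)
  have T: "truncate k f \<in> Lp p" "truncate k f \<in> Lp 2" for k
    using truncate_Lp[OF fm] p by auto
  have Hm: "hilbert_L2 (truncate k f) \<in> periodic_measurable" "hilbert_L2 (h k) \<in> periodic_measurable" for k
    using T h hilbert_L2_Lp Lp_periodic_measurable by blast+
  have "(\<lambda>k. pmass p (\<lambda>t. (h k t - f t) + (f t - truncate k f t))) \<longlonglongrightarrow> 0"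
  proof (rule pmass_tendsto_0_add)
    show "(\<lambda>k. pmass p (\<lambda>t. f t - truncate k f t)) \<longlonglongrightarrow> 0"
      using truncate_tendsto[OF f] p by (simp add: pmass_diff_commute[of p f])
  qed (use lim p in \<open>auto intro!: periodic_measurable_diff fm Lp_periodic_measurable[OF T(1)] Lp_periodic_measurable[OF h(1)]\<close>)
  then have "(\<lambda>k. ennreal C * pmass p (\<lambda>t. h k t - truncate k f t)) \<longlonglongrightarrow> ennreal C * 0"
    by (intro ennreal_tendsto_cmult) auto
  then have C0: "(\<lambda>k. ennreal C * pmass p (\<lambda>t. h k t - truncate k f t)) \<longlonglongrightarrow> 0" by simp
  have le: "pmass p (\<lambda>t. hilbert_L2 (h k) t - hilbert_L2 (truncate k f) t) \<le> ennreal C * pmass p (\<lambda>t. h k t - truncate k f t)" for k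
  proof -
    have "pmass p (\<lambda>t. hilbert_L2 (h k) t - hilbert_L2 (truncate k f) t) = pmass p (hilbert_L2 (\<lambda>t. h k t - truncate k f t))"
      by (rule pmass_cong_ae_eq[symmetric], rule hilbert_L2_diff) (rule T h)+
    also have "\<dots> \<le> ennreal C * pmass p (\<lambda>t. h k t - truncate k f t)"
      using p by (intro bound Lp_diff T h) auto
    finally show ?thesis .
  qed
  have "(\<lambda>k. pmass p (\<lambda>t. hilbert_L2 (h k) t - hilbert_L2 (truncate k f) t)) \<longlonglongrightarrow> 0"
    by (rule tendsto_sandwich[OF _ _ tendsto_const C0]) (use le in auto)
  then have "(\<lambda>k. pmass p (\<lambda>t. (hilbert_L2 (h k) t - hilbert_L2 (truncate k f) t)
      + (hilbert_L2 (truncate k f) t - hilbert_Lp p f t))) \<longlonglongrightarrow> 0"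
    using hilbert_Lp_spec[OF p f] p
    by (intro pmass_tendsto_0_add) (auto intro!: periodic_measurable_diff Hm Lp_periodic_measurable[of "hilbert_Lp p f" p])
  then show ?thesis by simp
qed

lemma hilbert_Lp_unique:
  assumes p: "1 < p" and h: "\<And>k. h k \<in> Lp p" "\<And>k. h k \<in> Lp 2" and f: "f \<in> Lp p" and g: "g \<in> Lp p"
    and lim: "(\<lambda>k. pmass p (\<lambda>t. h k t - f t)) \<longlonglongrightarrow> 0"
      "(\<lambda>k. pmass p (\<lambda>t. hilbert_L2 (h k) t - g t)) \<longlonglongrightarrow> 0"
  shows "hilbert_Lp p f =\<^sub>a\<^sub>e g"
  by (rule pmass_limit_unique[OF hilbert_Lp_tendsto[OF p h f lim(1)] lim(2)])
     (use p Lp_periodic_measurable[OF hilbert_L2_Lp[OF h(2)]] Lp_periodic_measurable[OF g]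
       Lp_periodic_measurable[OF hilbert_Lp_spec(1)[OF p f]] in auto)

text \<open>
Each property is read off by choosing a suitable approximating sequence: a constant one for functions
already in \<open>L\<^sup>2\<close>, the truncations of an almost everywhere equal function for invariance, and sums and
multiples of truncations for linearity.
\<close>

lemma hilbert_Lp_extends:
  assumes p: "1 < p"
  shows "extends_hilbert p (hilbert_Lp p)"
proof -
  obtain C where C: "0 \<le> C" and
    bound: "\<And>f. f \<in> Lp p \<Longrightarrow> f \<in> Lp 2 \<Longrightarrow> pmass p (hilbert_L2 f) \<le> ennreal C * pmass p f"
    using hilbert_L2_pmass_bound[OF p] by metis
  note HLp = hilbert_L2_maps_Lp[OF p]
  have T: "truncate k f \<in> Lp p" "truncate k f \<in> Lp 2" if "f \<in> Lp p" for f k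
    using truncate_Lp[OF Lp_periodic_measurable[OF that]] p by auto
  have lim: "(\<lambda>k. pmass p (\<lambda>t. truncate k f t - f t)) \<longlonglongrightarrow> 0" if "f \<in> Lp p" for f
    using truncate_tendsto[OF that] p by simp
  note spec = hilbert_Lp_spec[OF p]
  note pm = Lp_periodic_measurable
  have ext: "hilbert_Lp p f =\<^sub>a\<^sub>e hilbert_L2 f" if f: "f \<in> Lp p" "f \<in> Lp 2" for f
    using f HLp[OF f] p by (intro hilbert_Lp_unique[where h="\<lambda>k. f"]) (simp_all add: pmass_def)
  have cong: "hilbert_Lp p f =\<^sub>a\<^sub>e hilbert_Lp p g" if f: "f \<in> Lp p" and g: "g \<in> Lp p" and eq: "f =\<^sub>a\<^sub>e g" for f g
  proof (rule hilbert_Lp_unique[OF p T[OF g] f spec(1)[OF g] _ spec(2)[OF g]])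
    have "pmass p (\<lambda>t. truncate k g t - f t) = pmass p (\<lambda>t. truncate k g t - g t)" for k
      using ae_eq_circle[OF eq] by (intro pmass_cong_AE) auto
    then show "(\<lambda>k. pmass p (\<lambda>t. truncate k g t - f t)) \<longlonglongrightarrow> 0" using lim[OF g] by simp
  qed
  have add: "hilbert_Lp p (\<lambda>t. f t + g t) =\<^sub>a\<^sub>e (\<lambda>t. hilbert_Lp p f t + hilbert_Lp p g t)"
    if f: "f \<in> Lp p" and g: "g \<in> Lp p" for f g
  proof (rule hilbert_Lp_unique[where h="\<lambda>k t. truncate k f t + truncate k g t"])
    have "(\<lambda>k. pmass p (\<lambda>t. (truncate k f t - f t) + (truncate k g t - g t))) \<longlonglongrightarrow> 0"
      using p by (intro pmass_tendsto_0_add lim f g periodic_measurable_diff pm[OF T(1)] pm[OF f] pm[OF g]) auto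
    then show "(\<lambda>k. pmass p (\<lambda>t. truncate k f t + truncate k g t - (f t + g t))) \<longlonglongrightarrow> 0"
      by (simp add: algebra_simps)
    have "pmass p (\<lambda>t. hilbert_L2 (\<lambda>t. truncate k f t + truncate k g t) t - (hilbert_Lp p f t + hilbert_Lp p g t))
      = pmass p (\<lambda>t. (hilbert_L2 (truncate k f) t - hilbert_Lp p f t) + (hilbert_L2 (truncate k g) t - hilbert_Lp p g t))" for k
      using ae_eq_circle[OF hilbert_L2_add[OF T(2)[OF f, of k] T(2)[OF g, of k]]]
      by (intro pmass_cong_AE) (auto simp: algebra_simps)
    moreover have "(\<lambda>k. pmass p (\<lambda>t. (hilbert_L2 (truncate k f) t - hilbert_Lp p f t)
        + (hilbert_L2 (truncate k g) t - hilbert_Lp p g t))) \<longlonglongrightarrow> 0"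
      using p by (intro pmass_tendsto_0_add spec(2) f g periodic_measurable_diff pm[OF hilbert_L2_Lp[OF T(2)]]
          pm[OF spec(1)[OF f]] pm[OF spec(1)[OF g]]) auto
    ultimately show "(\<lambda>k. pmass p (\<lambda>t. hilbert_L2 (\<lambda>t. truncate k f t + truncate k g t) t
        - (hilbert_Lp p f t + hilbert_Lp p g t))) \<longlonglongrightarrow> 0" by simp
  qed (use p in \<open>auto intro!: Lp_add T f g spec\<close>)
  have cmult: "hilbert_Lp p (\<lambda>t. c * f t) =\<^sub>a\<^sub>e (\<lambda>t. c * hilbert_Lp p f t)" if f: "f \<in> Lp p" for f c
  proof (rule hilbert_Lp_unique[where h="\<lambda>k t. c * truncate k f t"])
    have "(\<lambda>k. pmass p (\<lambda>t. c * (truncate k f t - f t))) \<longlonglongrightarrow> 0"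
      by (intro pmass_tendsto_0_mult lim f periodic_measurable_diff pm[OF T(1)] pm[OF f])
    then show "(\<lambda>k. pmass p (\<lambda>t. c * truncate k f t - c * f t)) \<longlonglongrightarrow> 0"
      by (simp add: right_diff_distrib)
    have "pmass p (\<lambda>t. hilbert_L2 (\<lambda>t. c * truncate k f t) t - c * hilbert_Lp p f t)
      = pmass p (\<lambda>t. c * (hilbert_L2 (truncate k f) t - hilbert_Lp p f t))" for k
      using ae_eq_circle[OF hilbert_L2_cmult[OF T(2)[OF f, of k], of c]]
      by (intro pmass_cong_AE) (auto simp: right_diff_distrib)
    moreover have "(\<lambda>k. pmass p (\<lambda>t. c * (hilbert_L2 (truncate k f) t - hilbert_Lp p f t))) \<longlonglongrightarrow> 0"
      by (intro pmass_tendsto_0_mult spec(2) f periodic_measurable_diff pm[OF hilbert_L2_Lp[OF T(2)]] pm[OF spec(1)[OF f]])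
    ultimately show "(\<lambda>k. pmass p (\<lambda>t. hilbert_L2 (\<lambda>t. c * truncate k f t) t - c * hilbert_Lp p f t)) \<longlonglongrightarrow> 0"
      by simp
  qed (use p in \<open>auto intro!: Lp_cmult T f spec\<close>)
  have bd: "Lp_norm p (hilbert_Lp p f) \<le> C powr (1 / p) * Lp_norm p f" if f: "f \<in> Lp p" for f
  proof -
    have "pmass p (hilbert_Lp p f) \<le> ennreal C * pmass p f"
    proof (rule pmass_le_of_tendsto[OF spec(2)[OF f]])
      show "pmass p (hilbert_L2 (truncate k f)) \<le> ennreal C * pmass p f" for k
      proof -
        have "pmass p (truncate k f) \<le> pmass p f" using p by (intro pmass_mono) (auto simp: truncate_def)
        with bound[OF T[OF f], of k] show ?thesis by (meson mult_left_mono order_trans zero_le)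
      qed
    qed (use p in \<open>auto intro!: HLp T f spec\<close>)
    then show ?thesis
      using p C by (subst Lp_norm_le_iff_pmass[OF f spec(1)[OF f]]) (auto simp: powr_powr)
  qed
  show ?thesis
    unfolding extends_hilbert_def bounded_linear_Lp_def
    using spec(1) cong add cmult bd ext by blast
qed

text \<open>
On the truncations both operators agree with the Hilbert transform on \<open>L\<^sup>2\<close>, and \<open>H'\<close> is continuous.
\<close>

lemma extends_hilbert_unique:
  assumes p: "1 < p" and H': "extends_hilbert p H'" and f: "f \<in> Lp p"
  shows "H' f =\<^sub>a\<^sub>e hilbert_Lp p f"
proof -
  have bl: "bounded_linear_Lp p H'" and ext: "\<And>f. f \<in> Lp p \<Longrightarrow> f \<in> Lp 2 \<Longrightarrow> H' f =\<^sub>a\<^sub>e hilbert_L2 f"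
    using H' by (auto simp: extends_hilbert_def)
  have HL: "\<And>f. f \<in> Lp p \<Longrightarrow> H' f \<in> Lp p"
    and add: "\<And>f g. f \<in> Lp p \<Longrightarrow> g \<in> Lp p \<Longrightarrow> H' (\<lambda>t. f t + g t) =\<^sub>a\<^sub>e (\<lambda>t. H' f t + H' g t)"
    and cmult: "\<And>f c. f \<in> Lp p \<Longrightarrow> H' (\<lambda>t. c * f t) =\<^sub>a\<^sub>e (\<lambda>t. c * H' f t)"
    using bl unfolding bounded_linear_Lp_def by blast+
  obtain C where C: "\<And>f. f \<in> Lp p \<Longrightarrow> Lp_norm p (H' f) \<le> C * Lp_norm p f"
    using bl unfolding bounded_linear_Lp_def by blast
  have bound: "pmass p (H' f) \<le> ennreal (\<bar>C\<bar> powr p) * pmass p f" if "f \<in> Lp p" for f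
  proof -
    have "C * Lp_norm p f \<le> \<bar>C\<bar> * Lp_norm p f" by (intro mult_right_mono) (auto simp: Lp_norm_def)
    with C[OF that] have "Lp_norm p (H' f) \<le> \<bar>C\<bar> * Lp_norm p f" by linarith
    then show ?thesis using Lp_norm_le_iff_pmass[OF that HL[OF that], of "\<bar>C\<bar>"] p by simp
  qed
  have T: "truncate k f \<in> Lp p" "truncate k f \<in> Lp 2" for k
    using truncate_Lp[OF Lp_periodic_measurable[OF f]] p by auto
  have le: "pmass p (\<lambda>t. hilbert_L2 (truncate k f) t - H' f t) \<le> ennreal (\<bar>C\<bar> powr p) * pmass p (\<lambda>t. truncate k f t - f t)" for k
  proof -
    have "AE t in circle. hilbert_L2 (truncate k f) t - H' f t = H' (\<lambda>t. truncate k f t + - 1 * f t) t"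
      using ae_eq_circle[OF ext[OF T, of k]] ae_eq_circle[OF cmult[OF f, of "- 1"]]
        ae_eq_circle[OF add[OF T(1)[of k] Lp_cmult[OF f, of "- 1"]]]
      by eventually_elim simp
    then have "pmass p (\<lambda>t. hilbert_L2 (truncate k f) t - H' f t) = pmass p (H' (\<lambda>t. truncate k f t + - 1 * f t))"
      by (rule pmass_cong_AE)
    also have "\<dots> \<le> ennreal (\<bar>C\<bar> powr p) * pmass p (\<lambda>t. truncate k f t + - 1 * f t)"
      using p by (intro bound Lp_add T Lp_cmult f) auto
    finally show ?thesis by simp
  qed
  have "(\<lambda>k. ennreal (\<bar>C\<bar> powr p) * pmass p (\<lambda>t. truncate k f t - f t)) \<longlonglongrightarrow> ennreal (\<bar>C\<bar> powr p) * 0"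
    using truncate_tendsto[OF f] p by (intro ennreal_tendsto_cmult) auto
  then have lim: "(\<lambda>k. ennreal (\<bar>C\<bar> powr p) * pmass p (\<lambda>t. truncate k f t - f t)) \<longlonglongrightarrow> 0" by simp
  have "(\<lambda>k. pmass p (\<lambda>t. hilbert_L2 (truncate k f) t - H' f t)) \<longlonglongrightarrow> 0"
    by (rule tendsto_sandwich[OF _ _ tendsto_const lim]) (use le in auto)
  then have "hilbert_Lp p f =\<^sub>a\<^sub>e H' f"
    using truncate_tendsto[OF f] p by (intro hilbert_Lp_unique[OF p T f HL[OF f]]) auto
  then show ?thesis by (auto simp: ae_eq_def elim: AE_mp)
qed

lemma fourier_coeff_hilbert_Lp:
  assumes p: "1 < p" and f: "f \<in> Lp p"
  shows "fourier_coeff (hilbert_Lp p f) n = hilbert_mult n * fourier_coeff f n"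
proof (rule LIMSEQ_unique)
  have T: "truncate k f \<in> Lp p" "truncate k f \<in> Lp 2" for k
    using truncate_Lp[OF Lp_periodic_measurable[OF f]] p by auto
  show "(\<lambda>k. fourier_coeff (hilbert_L2 (truncate k f)) n) \<longlonglongrightarrow> fourier_coeff (hilbert_Lp p f) n"
    using p by (intro fourier_coeff_tendsto[of _ p] hilbert_L2_maps_Lp T hilbert_Lp_spec f) auto
  have "(\<lambda>k. fourier_coeff (truncate k f) n) \<longlonglongrightarrow> fourier_coeff f n"
    using p truncate_tendsto[OF f] by (intro fourier_coeff_tendsto[of _ p] T f) auto
  then show "(\<lambda>k. fourier_coeff (hilbert_L2 (truncate k f)) n) \<longlonglongrightarrow> hilbert_mult n * fourier_coeff f n"
    unfolding fourier_coeff_hilbert_L2[OF T(2)] by (intro tendsto_mult_left)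
qed

theorem corollary12p2:
  fixes p :: real
  assumes "1 < p"
  shows "strong_type p (Lp 2) hilbert_L2 \<and>
    (\<exists>H. extends_hilbert p H \<and>
         (\<forall>H'. extends_hilbert p H' \<longrightarrow> (\<forall>f \<in> Lp p. H' f =\<^sub>a\<^sub>e H f)) \<and>
         (\<forall>f \<in> Lp p. \<forall>n. fourier_coeff (H f) n = - \<i> * of_int (sgn n) * fourier_coeff f n))"
proof
  obtain C where C: "0 \<le> C" and
    bound: "\<And>f. f \<in> Lp p \<Longrightarrow> f \<in> Lp 2 \<Longrightarrow> pmass p (hilbert_L2 f) \<le> ennreal C * pmass p f"
    using hilbert_L2_pmass_bound[OF assms] by metis
  show "strong_type p (Lp 2) hilbert_L2"
    unfolding strong_type_def
  proof (intro exI ballI conjI)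
    fix f assume "f \<in> Lp p \<inter> Lp 2"
    then have f: "f \<in> Lp p" "f \<in> Lp 2" by auto
    show H: "hilbert_L2 f \<in> Lp p" by (rule hilbert_L2_maps_Lp[OF assms f])
    show "Lp_norm p (hilbert_L2 f) \<le> C powr (1 / p) * Lp_norm p f"
      using bound[OF f] assms C by (subst Lp_norm_le_iff_pmass[OF f(1) H]) (auto simp: powr_powr)
  qed
  show "\<exists>H. extends_hilbert p H \<and>
         (\<forall>H'. extends_hilbert p H' \<longrightarrow> (\<forall>f \<in> Lp p. H' f =\<^sub>a\<^sub>e H f)) \<and>
         (\<forall>f \<in> Lp p. \<forall>n. fourier_coeff (H f) n = - \<i> * of_int (sgn n) * fourier_coeff f n)"
    using hilbert_Lp_extends[OF assms] extends_hilbert_unique[OF assms] fourier_coeff_hilbert_Lp[OF assms]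
    by blast
qed

end
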